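(* Let $(M,g)$ be a spacetime. Then $(M,g)$ is future distinguishing if and only if for every $x,z\in M$, $(x,z)\in J^{+}$ and $x\in\overline{J^{+}(z)}$ imply $x=z$. Likewise, $(M,g)$ is past distinguishing if and only if for every $x,z\in M$, $(x,z)\in J^{+}$ and $z\in\overline{J^{-}(x)}$ imply $x=z$.
   Context: A spacetime $(M,g)$ is a connected, time-oriented $C^{r}$ Lorentzian manifold ($r\in\{3,\dots,\infty\}$) of dimension $n\ge 2$ and signature $(-,+,\dots,+)$. $p\ll q$ means that there is a future-directed timelike curve from $p$ to $q$; $p\le q$ means that there is a future-directed causal curve from $p$ to $q$ or $p=q$. $J^{+}=\{(p,q)\in M\times M:p\le q\}$, $J^{+}(x)=\{y:x\le y\}$, $J^{-}(x)=\{y:y\le x\}$, $I^{+}(x)=\{y:x\ll y\}$, $I^{-}(x)=\{y:y\ll x\}$. Overline denotes topological closure in $M$. $(M,g)$ is future (resp. past) distinguishing if for all $x,z\in M$, $I^{+}(x)=I^{+}(z)$ (resp. $I^{-}(x)=I^{-}(z)$) implies $x=z$. *)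

theory Defs
  imports "HOL-Analysis.Analysis" "HOL-Library.Extended_Nat"
begin

section \<open>Maps of class \<open>C\<^sup>k\<close> between Euclidean spaces\<close>

text \<open>Meant for open \<open>S\<close>: all iterated directional derivatives up to order \<open>n\<close> exist and are
  continuous on \<open>S\<close>.\<close>

primrec Cn_on :: "nat \<Rightarrow> 'a::euclidean_space set \<Rightarrow> ('a \<Rightarrow> 'b::real_normed_vector) \<Rightarrow> bool" where
  "Cn_on 0 S f \<longleftrightarrow> continuous_on S f"
| "Cn_on (Suc n) S f \<longleftrightarrow> (\<forall>x\<in>S. f differentiable (at x)) \<and>
     (\<forall>v. Cn_on n S (\<lambda>x. frechet_derivative f (at x) v))"

definition C_on :: "enat \<Rightarrow> 'a::euclidean_space set \<Rightarrow> ('a \<Rightarrow> 'b::real_normed_vector) \<Rightarrow> bool" where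
  "C_on k S f \<longleftrightarrow> (\<forall>n. enat n \<le> k \<longrightarrow> Cn_on n S f)"


section \<open>Atlases\<close>

text \<open>The manifold is the whole type \<open>'a\<close>, modelled on the Euclidean space \<open>'e\<close>, so its dimension
  is \<open>DIM('e)\<close>. A chart is a pair of its domain and its coordinate map; the values of the
  coordinate map off the domain are irrelevant.\<close>

type_synonym ('a, 'e) chart = "'a set \<times> ('a \<Rightarrow> 'e)"

definition is_chart :: "('a::topological_space, 'e::euclidean_space) chart \<Rightarrow> bool" where
  "is_chart c \<longleftrightarrow> open (fst c) \<and> open (snd c ` fst c) \<and>
     homeomorphism (fst c) (snd c ` fst c) (snd c) (inv_into (fst c) (snd c))"

definition transition :: "('a, 'e) chart \<Rightarrow> ('a, 'e) chart \<Rightarrow> 'e \<Rightarrow> 'e" where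
  "transition c d = snd d \<circ> inv_into (fst c) (snd c)"

text \<open>The Jacobian at \<open>p\<close> of the change of coordinates from \<open>c\<close> to \<open>d\<close>.\<close>

definition jacobian ::
  "('a, 'e::euclidean_space) chart \<Rightarrow> ('a, 'e) chart \<Rightarrow> 'a \<Rightarrow> 'e \<Rightarrow> 'e" where
  "jacobian c d p = frechet_derivative (transition c d) (at (snd c p))"

definition C_atlas ::
  "enat \<Rightarrow> ('a::topological_space, 'e::euclidean_space) chart set \<Rightarrow> bool" where
  "C_atlas r A \<longleftrightarrow> (\<forall>c\<in>A. is_chart c) \<and> (\<Union>c\<in>A. fst c) = UNIV \<and>
     (\<forall>c\<in>A. \<forall>d\<in>A. C_on r (snd c ` (fst c \<inter> fst d)) (transition c d))"


section \<open>Spacetimes\<close>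

text \<open>Tensor fields are given by their components in each chart of the atlas, subject to the tensor
  transformation law: \<open>metric M c p u v\<close> is the value of the metric at \<open>p\<close> on the tangent vectors
  whose components in the chart \<open>c\<close> are \<open>u\<close> and \<open>v\<close>, and \<open>tfield M c p\<close> are the components at \<open>p\<close>
  of a continuous timelike vector field that represents the time orientation.\<close>

record ('a, 'e) lorentz_manifold =
  charts :: "('a, 'e) chart set"
  metric :: "('a, 'e) chart \<Rightarrow> 'a \<Rightarrow> 'e \<Rightarrow> 'e \<Rightarrow> real"
  tfield :: "('a, 'e) chart \<Rightarrow> 'a \<Rightarrow> 'e"

text \<open>Symmetric bilinear forms of signature \<open>(-,+,\<dots>,+)\<close>; the frame \<open>b\<close> is necessarily a basis.\<close>

definition lorentz_form :: "('e::euclidean_space \<Rightarrow> 'e \<Rightarrow> real) \<Rightarrow> bool" where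
  "lorentz_form B \<longleftrightarrow> bilinear B \<and> (\<forall>u v. B u v = B v u) \<and>
     (\<exists>i0\<in>(Basis :: 'e set). \<exists>b. \<forall>i\<in>Basis. \<forall>j\<in>Basis.
        B (b i) (b j) = (if i \<noteq> j then 0 else if i = i0 then -1 else 1))"

text \<open>On a \<open>C\<^sup>r\<close> manifold the Jacobians are only \<open>C\<^sup>r\<^sup>-\<^sup>1\<close>, so the regularity of the metric is
  \<open>C\<^sup>r\<^sup>-\<^sup>1\<close> (with \<open>\<infinity> - 1 = \<infinity>\<close>).\<close>

definition lorentz_metric ::
  "enat \<Rightarrow> ('a::topological_space, 'e::euclidean_space) lorentz_manifold \<Rightarrow> bool" where
  "lorentz_metric r M \<longleftrightarrow>
     (\<forall>c\<in>charts M. \<forall>p\<in>fst c. lorentz_form (metric M c p)) \<and>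
     (\<forall>c\<in>charts M. \<forall>d\<in>charts M. \<forall>p\<in>fst c \<inter> fst d. \<forall>u v.
        metric M d p (jacobian c d p u) (jacobian c d p v) = metric M c p u v) \<and>
     (\<forall>c\<in>charts M. \<forall>u v.
        C_on (r - 1) (snd c ` fst c) (\<lambda>x. metric M c (inv_into (fst c) (snd c) x) u v))"

definition time_oriented ::
  "('a::topological_space, 'e::euclidean_space) lorentz_manifold \<Rightarrow> bool" where
  "time_oriented M \<longleftrightarrow>
     (\<forall>c\<in>charts M. \<forall>p\<in>fst c. metric M c p (tfield M c p) (tfield M c p) < 0) \<and>
     (\<forall>c\<in>charts M. \<forall>d\<in>charts M. \<forall>p\<in>fst c \<inter> fst d.
        tfield M d p = jacobian c d p (tfield M c p)) \<and>
     (\<forall>c\<in>charts M. continuous_on (fst c) (tfield M c))"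

definition spacetime ::
  "enat \<Rightarrow> ('a::{t2_space, second_countable_topology}, 'e::euclidean_space) lorentz_manifold \<Rightarrow> bool"
  where
  "spacetime r M \<longleftrightarrow> 3 \<le> r \<and> 2 \<le> DIM('e) \<and> connected (UNIV :: 'a set) \<and>
     C_atlas r (charts M) \<and> lorentz_metric r M \<and> time_oriented M"


section \<open>Curves and causal relations\<close>

definition future_timelike ::
  "('a, 'e::euclidean_space) lorentz_manifold \<Rightarrow> ('a, 'e) chart \<Rightarrow> 'a \<Rightarrow> 'e \<Rightarrow> bool" where
  "future_timelike M c p v \<longleftrightarrow> metric M c p v v < 0 \<and> metric M c p v (tfield M c p) < 0"

definition future_causal ::
  "('a, 'e::euclidean_space) lorentz_manifold \<Rightarrow> ('a, 'e) chart \<Rightarrow> 'a \<Rightarrow> 'e \<Rightarrow> bool" where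
  "future_causal M c p v \<longleftrightarrow>
     v \<noteq> 0 \<and> metric M c p v v \<le> 0 \<and> metric M c p v (tfield M c p) < 0"

text \<open>\<open>\<gamma>\<close> is \<open>C\<^sup>1\<close> on \<open>[s, t]\<close>, with one-sided derivatives at the end points, and all its velocities
  satisfy \<open>K\<close>; \<open>v c u\<close> are the components in the chart \<open>c\<close> of the velocity at parameter \<open>u\<close>.\<close>

definition C1_arc ::
  "('a::topological_space, 'e::euclidean_space) lorentz_manifold \<Rightarrow>
   (('a, 'e) chart \<Rightarrow> 'a \<Rightarrow> 'e \<Rightarrow> bool) \<Rightarrow> (real \<Rightarrow> 'a) \<Rightarrow> real \<Rightarrow> real \<Rightarrow> bool" where
  "C1_arc M K \<gamma> s t \<longleftrightarrow> continuous_on {s..t} \<gamma> \<and>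
     (\<exists>v. \<forall>c\<in>charts M.
        continuous_on {u \<in> {s..t}. \<gamma> u \<in> fst c} (v c) \<and>
        (\<forall>u\<in>{s..t}. \<gamma> u \<in> fst c \<longrightarrow>
           ((snd c \<circ> \<gamma>) has_vector_derivative v c u) (at u within {s..t}) \<and> K c (\<gamma> u) (v c u)))"

text \<open>Piecewise \<open>C\<^sup>1\<close> curves on \<open>[0, 1]\<close>, with \<open>S\<close> the set of break points. Both one-sided velocities
  at a break point have to satisfy \<open>K\<close>.\<close>

definition piecewise_curve ::
  "('a::topological_space, 'e::euclidean_space) lorentz_manifold \<Rightarrow>
   (('a, 'e) chart \<Rightarrow> 'a \<Rightarrow> 'e \<Rightarrow> bool) \<Rightarrow> (real \<Rightarrow> 'a) \<Rightarrow> bool" where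
  "piecewise_curve M K \<gamma> \<longleftrightarrow> path \<gamma> \<and>
     (\<exists>S. finite S \<and>
        (\<forall>s t. 0 \<le> s \<and> s < t \<and> t \<le> 1 \<and> {s<..<t} \<inter> S = {} \<longrightarrow> C1_arc M K \<gamma> s t))"

definition chron ::
  "('a::topological_space, 'e::euclidean_space) lorentz_manifold \<Rightarrow> 'a \<Rightarrow> 'a \<Rightarrow> bool" where
  "chron M p q \<longleftrightarrow>
     (\<exists>\<gamma>. piecewise_curve M (future_timelike M) \<gamma> \<and> pathstart \<gamma> = p \<and> pathfinish \<gamma> = q)"

definition causal ::
  "('a::topological_space, 'e::euclidean_space) lorentz_manifold \<Rightarrow> 'a \<Rightarrow> 'a \<Rightarrow> bool" where
  "causal M p q \<longleftrightarrow> p = q \<or>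
     (\<exists>\<gamma>. piecewise_curve M (future_causal M) \<gamma> \<and> pathstart \<gamma> = p \<and> pathfinish \<gamma> = q)"

definition J_rel ::
  "('a::topological_space, 'e::euclidean_space) lorentz_manifold \<Rightarrow> ('a \<times> 'a) set" where
  "J_rel M = {(p, q). causal M p q}"

definition J_plus ::
  "('a::topological_space, 'e::euclidean_space) lorentz_manifold \<Rightarrow> 'a \<Rightarrow> 'a set" where
  "J_plus M x = {y. causal M x y}"

definition J_minus ::
  "('a::topological_space, 'e::euclidean_space) lorentz_manifold \<Rightarrow> 'a \<Rightarrow> 'a set" where
  "J_minus M x = {y. causal M y x}"

definition I_plus ::
  "('a::topological_space, 'e::euclidean_space) lorentz_manifold \<Rightarrow> 'a \<Rightarrow> 'a set" where
  "I_plus M x = {y. chron M x y}"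

definition I_minus ::
  "('a::topological_space, 'e::euclidean_space) lorentz_manifold \<Rightarrow> 'a \<Rightarrow> 'a set" where
  "I_minus M x = {y. chron M y x}"

definition future_distinguishing ::
  "('a::topological_space, 'e::euclidean_space) lorentz_manifold \<Rightarrow> bool" where
  "future_distinguishing M \<longleftrightarrow> (\<forall>x z. I_plus M x = I_plus M z \<longrightarrow> x = z)"

definition past_distinguishing ::
  "('a::topological_space, 'e::euclidean_space) lorentz_manifold \<Rightarrow> bool" where
  "past_distinguishing M \<longleftrightarrow> (\<forall>x z. I_minus M x = I_minus M z \<longrightarrow> x = z)"

end

theory Submission
  imports Defs "HOL-Complex_Analysis.Great_Picard"
begin

text \<open>If \<open>x \<le> z\<close> and \<open>x\<close> lies in the closure of \<open>J\<^sup>+(z)\<close>, then \<open>I\<^sup>+(x) = I\<^sup>+(z)\<close>, because chronological pasts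
  are open and \<open>p \<le> q\<close>, \<open>q \<lless> y\<close> imply \<open>p \<lless> y\<close>.

  Conversely, suppose \<open>I\<^sup>+(x) = I\<^sup>+(z)\<close> with \<open>x \<noteq> z\<close>, and that only equal points satisfy the closure condition.
  There are timelike curves from \<open>z\<close> to points converging to \<open>x\<close>. Parametrized by a linear time function of a
  chart, their final parts are uniformly Lipschitz and accumulate at a curve \<open>F\<close> that ends at \<open>x\<close>; the
  closure condition makes \<open>F\<close> achronal. No geodesics are needed to see that \<open>F\<close> is \<open>C\<^sup>1\<close>: since the metric is
  Lipschitz, a chord \<open>D\<close> of \<open>F\<close> of duration \<open>h\<close> satisfies \<open>g(D, D) = O(h\<^sup>3)\<close>, where one bound holds because \<open>F\<close> is a
  limit of timelike curves and the other one because straight segments between points of \<open>F\<close> are not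
  timelike. The parallelogram law bounds the second differences of \<open>F\<close> by \<open>O(h\<^bsup>3/2\<^esup>)\<close>, and this makes the dyadic
  difference quotients converge uniformly. Hence an earlier point \<open>w \<noteq> x\<close> of \<open>F\<close> satisfies \<open>w \<le> x\<close>, and \<open>w\<close>
  lies in the closure of \<open>I\<^sup>+(z) = I\<^sup>+(x)\<close>, a contradiction. The past version follows by time reversal.\<close>

section \<open>Calculus\<close>

text \<open>The obstacle is regularity: \<open>causal\<close> asks for piecewise C1 curves, while a
  compactness argument yields only a Lipschitz limit. The exponent 3 measures how far a chord is
  from being causal. A chord D of duration h has length O(h), and evaluating the Lipschitz metric at
  an end of the chord instead of where the velocities live costs O(h) times the square of this
  length. The linear time function matters beyond fixing a parameter. Consecutive chords of equal
  duration have equal height, so their difference lies in the hyperplane of height zero, where g is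
  positive definite; only there does an estimate of the indefinite form g control a Euclidean norm.
  The exponent 3/2 suffices because it exceeds 1: halving the step h changes a difference quotient
  by O(h^(1/2)), which is summable over dyadic steps. Second differences of forward quotients need
  room, so a curve controlled on [0, 2 H] is shown to be C1 on [0, H] only, and the earlier point w
  is taken at parameter H.\<close>

lemma Cn_on_1_lipschitz:
  fixes f :: "'e::euclidean_space \<Rightarrow> real"
  assumes f: "Cn_on 1 S f" and "compact K" "convex K" "K \<subseteq> S"
  obtains L where "\<And>x y. x \<in> K \<Longrightarrow> y \<in> K \<Longrightarrow> \<bar>f x - f y\<bar> \<le> L * norm (x - y)" "0 \<le> L"
proof -
  let ?f' = "\<lambda>x. frechet_derivative f (at x)"
  have diff: "\<forall>x\<in>S. f differentiable (at x)"
    and cont: "\<And>v. continuous_on S (\<lambda>x. ?f' x v)"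
    using f by simp_all
  have "\<forall>b. \<exists>B. \<forall>x\<in>K. \<bar>?f' x b\<bar> \<le> B"
  proof
    fix b
    have "compact ((\<lambda>x. ?f' x b) ` K)"
      using compact_continuous_image continuous_on_subset cont assms by blast
    then have "bounded ((\<lambda>x. ?f' x b) ` K)" by (rule compact_imp_bounded)
    then show "\<exists>B. \<forall>x\<in>K. \<bar>?f' x b\<bar> \<le> B"
      unfolding bounded_iff by auto
  qed
  then obtain B where B: "\<And>b x. x \<in> K \<Longrightarrow> \<bar>?f' x b\<bar> \<le> B b" by metis
  define L where "L = \<bar>\<Sum>b\<in>Basis. B b\<bar>"
  have der: "(f has_derivative ?f' x) (at x)" if "x \<in> K" for x
    using that assms diff frechet_derivative_works by blast
  have on: "onorm (?f' x) \<le> L" if x: "x \<in> K" for x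
  proof (rule onorm_bound)
    show "0 \<le> L" by (simp add: L_def)
    fix h :: 'e
    have lin: "linear (?f' x)" using der[OF x] has_derivative_linear by blast
    have "?f' x h = ?f' x (\<Sum>b\<in>Basis. (h \<bullet> b) *\<^sub>R b)" by (simp add: euclidean_representation)
    also have "\<dots> = (\<Sum>b\<in>Basis. (h \<bullet> b) * ?f' x b)"
      using lin by (simp add: linear_sum linear_cmul)
    finally have "\<bar>?f' x h\<bar> \<le> (\<Sum>b\<in>Basis. \<bar>(h \<bullet> b) * ?f' x b\<bar>)" by (simp add: sum_abs)
    also have "\<dots> \<le> (\<Sum>b\<in>Basis. norm h * B b)"
      unfolding abs_mult using B[OF x] Basis_le_norm
      by (intro sum_mono mult_mono) (auto simp: inner_commute)
    also have "\<dots> = norm h * (\<Sum>b\<in>Basis. B b)" by (simp add: sum_distrib_left)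
    also have "\<dots> \<le> norm h * L" by (intro mult_left_mono) (auto simp: L_def)
    finally show "norm (?f' x h) \<le> L * norm h" by (simp add: mult.commute)
  qed
  show ?thesis
  proof (rule that)
    show "0 \<le> L" by (simp add: L_def)
    fix x y assume "x \<in> K" "y \<in> K"
    then show "\<bar>f x - f y\<bar> \<le> L * norm (x - y)"
      using differentiable_bound[OF \<open>convex K\<close> has_derivative_at_withinI[OF der] on, of x y]
      by simp
  qed
qed

lemma has_vector_derivative_iff_quotient:
  fixes f :: "real \<Rightarrow> 'b::real_normed_vector"
  shows "(f has_vector_derivative D) (at x within S) \<longleftrightarrow>
    ((\<lambda>y. (f y - f x) /\<^sub>R (y - x)) \<longlongrightarrow> D) (at x within S)"
proof -
  have "(f has_vector_derivative D) (at x within S) \<longleftrightarrow>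
      ((\<lambda>y. norm ((f y - f x - (y - x) *\<^sub>R D) /\<^sub>R norm (y - x))) \<longlongrightarrow> 0) (at x within S)"
    unfolding tendsto_norm_zero_iff
    by (simp add: has_vector_derivative_def has_derivative_at_within bounded_linear_scaleR_left)
  also have "\<dots> \<longleftrightarrow> ((\<lambda>y. norm ((f y - f x) /\<^sub>R (y - x) - D)) \<longlongrightarrow> 0) (at x within S)"
  proof (rule filterlim_cong[OF refl refl])
    have "norm ((f y - f x - (y - x) *\<^sub>R D) /\<^sub>R norm (y - x)) = norm ((f y - f x) /\<^sub>R (y - x) - D)"
      if "y \<noteq> x" for y
    proof -
      have "(f y - f x) /\<^sub>R (y - x) - D = (f y - f x - (y - x) *\<^sub>R D) /\<^sub>R (y - x)"
        using that by (simp add: scaleR_diff_right)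
      then show ?thesis by simp
    qed
    then show "\<forall>\<^sub>F y in at x within S. norm ((f y - f x - (y - x) *\<^sub>R D) /\<^sub>R norm (y - x))
        = norm ((f y - f x) /\<^sub>R (y - x) - D)"
      by (auto simp: eventually_at_filter)
  qed
  also have "\<dots> \<longleftrightarrow> ((\<lambda>y. (f y - f x) /\<^sub>R (y - x)) \<longlongrightarrow> D) (at x within S)"
    unfolding tendsto_norm_zero_iff by (rule LIM_zero_iff)
  finally show ?thesis .
qed

text \<open>Forward quotients at the steps H / 2^k and H / 2^(k+1) differ by a second difference
  divided by the step, so by O(sqrt(step)), and converge uniformly. The conclusion covers half of
  the interval because forward quotients with steps up to \<open>H\<close> must stay inside
  \<open>{0..2 * H}\<close>.\<close>

lemma C1_if_small_second_differences:
  fixes F :: "real \<Rightarrow> 'e::euclidean_space"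
  assumes "0 < H" and F: "continuous_on {0..2 * H} F"
    and bound: "\<And>s h. 0 \<le> s \<Longrightarrow> 0 < h \<Longrightarrow> s + 2 * h \<le> 2 * H \<Longrightarrow>
      norm (F s - 2 *\<^sub>R F (s + h) + F (s + 2 * h)) \<le> A * h * sqrt h"
  obtains v where "continuous_on {0..H} v"
    "\<And>s. s \<in> {0..H} \<Longrightarrow> (F has_vector_derivative v s) (at s within {0..H})"
proof -
  define h where "h k = H / 2 ^ k" for k :: nat
  define G where "G k s = (F (s + h k) - F s) /\<^sub>R h k" for k s
  define q where "q = sqrt (1/2)"
  have hpos: "h k > 0" and hle: "h k \<le> H" for k
    using \<open>0 < H\<close> by (auto simp: h_def field_simps)
  have hSuc: "h k = 2 * h (Suc k)" for k by (simp add: h_def)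
  have sqh: "sqrt (h k) = sqrt H * q ^ k" for k
    by (simp add: h_def q_def real_sqrt_divide real_sqrt_power power_divide)
  have q: "0 \<le> q" "q < 1" by (auto simp: q_def)
  have step: "norm (G (Suc k) s - G k s) \<le> \<bar>A\<bar> * sqrt H * q ^ k" if s: "s \<in> {0..H}" for k s
  proof -
    let ?h = "h (Suc k)"
    have "G (Suc k) s - G k s = (- 1 / (2 * ?h)) *\<^sub>R (F s - 2 *\<^sub>R F (s + ?h) + F (s + 2 * ?h))"
    proof -
      define c where "c = 1 / (2 * ?h)"
      have "inverse ?h = c + c" "inverse (2 * ?h) = c" "- 1 / (2 * ?h) = - c"
        using hpos[of "Suc k"] by (auto simp: field_simps c_def)
      moreover have "(c + c) *\<^sub>R (b - a) - c *\<^sub>R (d - a) = (- c) *\<^sub>R (a - 2 *\<^sub>R b + d)" for a b d :: 'e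
        unfolding scaleR_2 scaleR_add_left by (simp add: scaleR_diff_right scaleR_add_right)
      ultimately show ?thesis unfolding G_def hSuc[of k] by simp
    qed
    then have "norm (G (Suc k) s - G k s) = norm (F s - 2 *\<^sub>R F (s + ?h) + F (s + 2 * ?h)) / (2 * ?h)"
      using hpos[of "Suc k"] by simp
    also have "\<dots> \<le> (A * ?h * sqrt ?h) / (2 * ?h)"
      using bound[of s ?h] s hpos[of "Suc k"] hle[of k] hSuc[of k] by (intro divide_right_mono) auto
    also have "\<dots> = A * sqrt ?h / 2" using hpos[of "Suc k"] by simp
    also have "\<dots> \<le> \<bar>A\<bar> * sqrt ?h / 2" using hpos[of "Suc k"] by (simp add: mult_right_mono)
    also have "\<dots> \<le> \<bar>A\<bar> * sqrt (h k)"
    proof -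
      have "sqrt ?h \<le> sqrt (h k)" using hSuc[of k] hpos[of "Suc k"] by simp
      moreover have "sqrt ?h / 2 \<le> sqrt ?h" using hpos[of "Suc k"] by simp
      ultimately have "\<bar>A\<bar> * (sqrt ?h / 2) \<le> \<bar>A\<bar> * sqrt (h k)"
        by (intro mult_left_mono) linarith+
      then show ?thesis by simp
    qed
    finally show ?thesis by (simp add: sqh)
  qed
  \<comment> \<open>The limit of the quotients \<open>G k\<close>, written as a telescoping series
    so that the Weierstrass M-test applies.\<close>
  define v where "v s = G 0 s + suminf (\<lambda>k. G (Suc k) s - G k s)" for s
  have ul: "uniform_limit {0..H} G v sequentially"
  proof -
    have "uniform_limit {0..H} (\<lambda>n s. \<Sum>k<n. G (Suc k) s - G k s) (\<lambda>s. suminf (\<lambda>k. G (Suc k) s - G k s)) sequentially"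
    proof (rule Weierstrass_m_test)
      show "summable (\<lambda>k. \<bar>A\<bar> * sqrt H * q ^ k)"
        using q by (intro summable_mult summable_geometric) auto
    qed (use step in auto)
    then have "uniform_limit {0..H} (\<lambda>n s. G 0 s + (\<Sum>k<n. G (Suc k) s - G k s)) v sequentially"
      unfolding v_def by (intro uniform_limit_intros) auto
    moreover have "G 0 s + (\<Sum>k<n. G (Suc k) s - G k s) = G n s" for n s
      using sum_lessThan_telescope[of "\<lambda>k. G k s" n] by simp
    ultimately show ?thesis by simp
  qed
  have contG: "continuous_on {0..H} (G k)" for k
    unfolding G_def using hpos[of k] hle[of k] \<open>0 < H\<close>
    by (intro continuous_intros continuous_on_compose2[OF F]) auto
  have contv: "continuous_on {0..H} v"
    by (rule uniform_limit_theorem[OF _ ul]) (use contG in auto)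
  \<comment> \<open>A limit along dyadic steps alone is not a derivative. The mean values \<Phi> of
    \<open>F\<close> over intervals of length \<open>h k\<close> are differentiable with derivative
    \<open>G k\<close> and tend to \<open>F\<close>, so the theorem on uniformly convergent
    derivatives can be applied to them.\<close>
  define I where "I s = integral {0..s} F" for s
  have I: "(I has_vector_derivative F s) (at s within {0..2*H})" if "s \<in> {0..2*H}" for s
    unfolding I_def using integral_has_vector_derivative[OF F that] .
  define \<Phi> where "\<Phi> k s = (I (s + h k) - I s) /\<^sub>R h k" for k s
  have d\<Phi>: "(\<Phi> k has_vector_derivative G k s) (at s within {0..H})" if s: "s \<in> {0..H}" for k s
  proof -
    have "((\<lambda>s. I (s + h k)) has_vector_derivative F (s + h k)) (at s within {0..H})"
    proof -
      have 1: "((\<lambda>s. s + h k) has_vector_derivative 1) (at s within {0..H})"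
        by (auto intro!: derivative_eq_intros)
      have 2: "(I has_vector_derivative F (s + h k)) (at (s + h k) within (\<lambda>s. s + h k) ` {0..H})"
        using I[of "s + h k"] hpos[of k] hle[of k] s
        by (rule_tac has_vector_derivative_within_subset[where S = "{0..2*H}"]) auto
      show ?thesis using vector_diff_chain_within[OF 1 2] by (simp add: o_def)
    qed
    moreover have "(I has_vector_derivative F s) (at s within {0..H})"
      using s by (intro has_vector_derivative_within_subset[OF I]) auto
    ultimately show ?thesis
      unfolding \<Phi>_def G_def by (auto intro!: derivative_eq_intros)
  qed
  have lim\<Phi>: "(\<lambda>k. \<Phi> k s) \<longlonglongrightarrow> F s" if s: "s \<in> {0..H}" for s
  proof -
    have I': "(I has_vector_derivative F s) (at s within {0..2*H})" using s by (intro I) auto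
    have "((\<lambda>y. (I y - I s) /\<^sub>R (y - s)) \<longlongrightarrow> F s) (at s within {0..2*H})"
      using I' by (simp add: has_vector_derivative_iff_quotient)
    moreover have "filterlim (\<lambda>k. s + h k) (at s within {0..2*H}) sequentially"
    proof -
      have "(\<lambda>k. s + H * (1/2) ^ k) \<longlonglongrightarrow> s + H * 0"
        by (intro tendsto_intros LIMSEQ_power_zero) auto
      then have "(\<lambda>k. s + h k) \<longlonglongrightarrow> s" by (simp add: h_def power_divide)
      moreover have "\<forall>\<^sub>F k in sequentially. s + h k \<in> {0..2*H} \<and> s + h k \<noteq> s"
      proof (intro always_eventually allI)
        show "s + h k \<in> {0..2*H} \<and> s + h k \<noteq> s" for k
          using hpos[of k] hle[of k] s by auto
      qed
      ultimately show ?thesis by (simp add: filterlim_at)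
    qed
    ultimately have "(\<lambda>k. (I (s + h k) - I s) /\<^sub>R (s + h k - s)) \<longlonglongrightarrow> F s"
      by (rule filterlim_compose)
    then show ?thesis by (simp add: \<Phi>_def)
  qed
  have "\<exists>g. \<forall>x\<in>{0..H}. (\<lambda>n. \<Phi> n x) \<longlonglongrightarrow> g x \<and> (g has_derivative (\<lambda>t. t *\<^sub>R v x)) (at x within {0..H})"
  proof (rule has_derivative_sequence)
    show "convex {0..H}" by simp
    show "(\<Phi> n has_derivative (\<lambda>t. t *\<^sub>R G n x)) (at x within {0..H})" if "x \<in> {0..H}" for n x
      using d\<Phi>[OF that] by (simp add: has_vector_derivative_def)
    show "0 \<in> {0..H}" using \<open>0 < H\<close> by simp
    show "(\<lambda>n. \<Phi> n 0) \<longlonglongrightarrow> F 0" using \<open>0 < H\<close> by (intro lim\<Phi>) simp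
    fix e :: real assume "e > 0"
    then have "\<forall>\<^sub>F n in sequentially. \<forall>x\<in>{0..H}. dist (G n x) (v x) < e"
      using ul by (simp add: uniform_limit_iff)
    then show "\<forall>\<^sub>F n in sequentially. \<forall>x\<in>{0..H}. \<forall>t. norm (t *\<^sub>R G n x - t *\<^sub>R v x) \<le> e * norm t"
    proof eventually_elim
      case (elim n)
      show ?case
      proof (intro ballI allI)
        fix x t assume "x \<in> {0..H}"
        then have "norm (G n x - v x) \<le> e" using elim by (auto simp: dist_norm intro: less_imp_le)
        then have "\<bar>t\<bar> * norm (G n x - v x) \<le> \<bar>t\<bar> * e" by (intro mult_left_mono) auto
        then show "norm (t *\<^sub>R G n x - t *\<^sub>R v x) \<le> e * norm t"
          by (simp add: mult.commute flip: scaleR_diff_right)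
      qed
    qed
  qed
  then obtain g where g: "\<And>x. x \<in> {0..H} \<Longrightarrow> (\<lambda>n. \<Phi> n x) \<longlonglongrightarrow> g x"
    "\<And>x. x \<in> {0..H} \<Longrightarrow> (g has_vector_derivative v x) (at x within {0..H})"
    unfolding has_vector_derivative_def by blast
  have "g x = F x" if "x \<in> {0..H}" for x
    using LIMSEQ_unique[OF g(1) lim\<Phi>] that by blast
  then have "(F has_vector_derivative v x) (at x within {0..H})" if "x \<in> {0..H}" for x
    using has_vector_derivative_transform[OF that _ g(2)[OF that]] by auto
  then show ?thesis using contv that by blast
qed

section \<open>Lorentzian linear algebra\<close>

text \<open>Orthogonality equates the product of the time components of \<open>w\<close> and
  \<open>T\<close> with the inner product of their spatial parts. By Cauchy-Schwarz, and since the
  time component of \<open>T\<close> dominates its spatial part, the spatial part of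
  \<open>w\<close> must dominate its time component.\<close>

lemma lorentz_form_pos_on_orthogonal:
  fixes B :: "'e::euclidean_space \<Rightarrow> 'e \<Rightarrow> real"
  assumes B: "lorentz_form B" and T: "B T T < 0" and w: "B w T = 0" "w \<noteq> 0"
  shows "0 < B w w"
proof -
  from B have bil: "bilinear B" by (simp add: lorentz_form_def)
  from B obtain i0 :: 'e and b where i0: "i0 \<in> Basis" and b: "\<And>i j. i \<in> Basis \<Longrightarrow> j \<in> Basis \<Longrightarrow>
      B (b i) (b j) = (if i \<noteq> j then 0 else if i = i0 then -1 else 1)"
    unfolding lorentz_form_def by metis
  define A where "A x = (\<Sum>i\<in>Basis. (x \<bullet> i) *\<^sub>R b i)" for x
  have linA: "linear A"
    unfolding A_def by (rule linearI) (simp_all add: inner_simps scaleR_add_left sum.distrib scaleR_sum_right)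
  define e :: "'e \<Rightarrow> real" where "e i = (if i = i0 then -1 else 1)" for i
  have BA: "B (A x) (A y) = (\<Sum>i\<in>Basis. e i * ((x \<bullet> i) * (y \<bullet> i)))" for x y
  proof -
    have "B (A x) (A y) = (\<Sum>i\<in>Basis. \<Sum>j\<in>Basis. (x \<bullet> i) * ((y \<bullet> j) * B (b i) (b j)))"
      unfolding A_def using bilinear_sum[OF bil, of "\<lambda>i. (x \<bullet> i) *\<^sub>R b i" Basis "\<lambda>i. (y \<bullet> i) *\<^sub>R b i" Basis]
      by (simp add: sum.cartesian_product mult.left_commute bilinear_lmul[OF bil] bilinear_rmul[OF bil])
    also have "\<dots> = (\<Sum>i\<in>Basis. \<Sum>j\<in>Basis. if j = i then e i * ((x \<bullet> i) * (y \<bullet> i)) else 0)"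
      by (intro sum.cong refl) (auto simp: b e_def)
    finally show ?thesis by simp
  qed
  \<comment> \<open>Pairing \<open>A x\<close> with a frame vector recovers a coordinate of
    \<open>x\<close> up to sign. Hence \<open>A\<close> is injective and, by dimension, surjective:
    the frame is a basis.\<close>
  have "x = 0" if "A x = 0" for x
  proof (rule euclidean_eqI)
    fix i :: 'e assume i: "i \<in> Basis"
    have "B (A x) (A i) = (\<Sum>j\<in>Basis. if j = i then e i * (x \<bullet> i) else 0)"
      unfolding BA using i by (intro sum.cong refl) (auto simp: inner_Basis)
    then have "B (A x) (A i) = e i * (x \<bullet> i)" using i by simp
    moreover have "B (A x) (A i) = 0" using that bilinear_lzero[OF bil] by simp
    ultimately show "x \<bullet> i = 0 \<bullet> i" by (auto simp: e_def split: if_splits)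
  qed
  then have "inj A" using linA by (simp add: linear_injective_0)
  then have "surj A" using linA linear_injective_imp_surjective by blast
  then obtain t x where t: "T = A t" and x: "w = A x" by (metis surjD)
  let ?S = "Basis - {i0}"
  have BA': "B (A x) (A y) = (\<Sum>i\<in>?S. (x \<bullet> i) * (y \<bullet> i)) - (x \<bullet> i0) * (y \<bullet> i0)" for x y
  proof -
    have "(\<Sum>i\<in>?S. e i * ((x \<bullet> i) * (y \<bullet> i))) = (\<Sum>i\<in>?S. (x \<bullet> i) * (y \<bullet> i))"
      by (intro sum.cong) (auto simp: e_def)
    then show ?thesis unfolding BA using i0 by (simp add: sum.remove[of _ i0] e_def)
  qed
  define X Y where "X = (\<Sum>i\<in>?S. (x \<bullet> i)\<^sup>2)" and "Y = (\<Sum>i\<in>?S. (t \<bullet> i)\<^sup>2)"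
  have XY: "0 \<le> X" "0 \<le> Y" by (auto simp: X_def Y_def intro: sum_nonneg)
  have Y: "Y < (t \<bullet> i0)\<^sup>2" using T BA'[of t t] by (simp add: t Y_def power2_eq_square)
  have "(x \<bullet> i0) * (t \<bullet> i0) = (\<Sum>i\<in>?S. (x \<bullet> i) * (t \<bullet> i))"
    using w(1) BA'[of x t] unfolding t x by linarith
  then have CS: "(x \<bullet> i0)\<^sup>2 * (t \<bullet> i0)\<^sup>2 \<le> X * Y"
    using Cauchy_Schwarz_ineq_sum[of "\<lambda>i. x \<bullet> i" "\<lambda>i. t \<bullet> i" ?S]
    by (simp add: X_def Y_def flip: power_mult_distrib)
  have "X \<noteq> 0"
  proof
    assume X0: "X = 0"
    then have "(x \<bullet> i0)\<^sup>2 * (t \<bullet> i0)\<^sup>2 \<le> 0" using CS by simp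
    then have "x \<bullet> i0 = 0" using Y XY by (auto simp: mult_le_0_iff)
    moreover have "x \<bullet> i = 0" if "i \<in> ?S" for i
      using X0 that sum_nonneg_eq_0_iff[of ?S "\<lambda>i. (x \<bullet> i)\<^sup>2"] by (auto simp: X_def)
    ultimately have "x \<bullet> i = 0 \<bullet> i" if "i \<in> Basis" for i using that by (cases "i = i0") auto
    then have "x = 0" by (rule euclidean_eqI)
    then show False using x w(2) linear_0[OF linA] by simp
  qed
  then have "X * Y < X * (t \<bullet> i0)\<^sup>2" using XY Y by simp
  then have "(x \<bullet> i0)\<^sup>2 * (t \<bullet> i0)\<^sup>2 < X * (t \<bullet> i0)\<^sup>2" using CS by linarith
  then have "(x \<bullet> i0)\<^sup>2 < X" by (rule mult_right_less_imp_less) simp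
  then show ?thesis using BA'[of x x] by (simp add: x X_def power2_eq_square)
qed

text \<open>The combination \<open>(a \<bullet> v) u - (a \<bullet> u) v\<close> is orthogonal to \<open>a\<close>.\<close>

lemma reverse_Cauchy_Schwarz:
  fixes a :: "'e::euclidean_space"
  assumes bil: "bilinear Q" and sym: "\<And>u v. Q u v = Q v u"
    and pos: "\<And>w. a \<bullet> w = 0 \<Longrightarrow> 0 \<le> Q w w"
  shows "2 * (a \<bullet> u) * (a \<bullet> v) * Q u v \<le> (a \<bullet> v)\<^sup>2 * Q u u + (a \<bullet> u)\<^sup>2 * Q v v"
proof -
  define w where "w = (a \<bullet> v) *\<^sub>R u - (a \<bullet> u) *\<^sub>R v"
  have "a \<bullet> w = 0" by (simp add: w_def inner_simps)
  then have "0 \<le> Q w w" by (rule pos)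
  also have "Q w w = (a \<bullet> v)\<^sup>2 * Q u u + (a \<bullet> u)\<^sup>2 * Q v v - 2 * (a \<bullet> u) * (a \<bullet> v) * Q u v"
    unfolding w_def
    by (simp add: bilinear_lsub[OF bil] bilinear_rsub[OF bil] bilinear_lmul[OF bil] bilinear_rmul[OF bil]
        sym[of v u] power2_eq_square algebra_simps)
  finally show ?thesis by simp
qed

text \<open>The future half of the cone is selected by a linear form instead of a time field, and
  the apex is included. For \<open>Q\<close> positive definite at height zero this is a closed
  convex cone.\<close>

definition solid_cone :: "('e::euclidean_space \<Rightarrow> 'e \<Rightarrow> real) \<Rightarrow> 'e \<Rightarrow> 'e set" where
  "solid_cone Q a = {v. 0 \<le> a \<bullet> v \<and> Q v v \<le> 0}"

lemma solid_cone_scaleR: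
  assumes "bilinear Q" "v \<in> solid_cone Q a" "0 \<le> k"
  shows "k *\<^sub>R v \<in> solid_cone Q a"
  using assms by (auto simp: solid_cone_def bilinear_lmul bilinear_rmul mult_le_0_iff)

text \<open>Everything reduces to \<open>Q u v \<le> 0\<close>. For positive heights this follows
  from \<open>reverse_Cauchy_Schwarz\<close>; a vector of height zero in the cone vanishes by
  \<open>pos\<close>.\<close>

lemma solid_cone_add:
  assumes bil: "bilinear Q" and sym: "\<And>u v. Q u v = Q v u"
    and pos: "\<And>w. a \<bullet> w = 0 \<Longrightarrow> w \<noteq> 0 \<Longrightarrow> 0 < Q w w"
    and u: "u \<in> solid_cone Q a" and v: "v \<in> solid_cone Q a"
  shows "u + v \<in> solid_cone Q a"
proof -
  have pos': "0 \<le> Q w w" if "a \<bullet> w = 0" for w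
    using pos[OF that] bilinear_lzero[OF bil] by (cases "w = 0") auto
  have *: "Q u v \<le> 0"
  proof (cases "a \<bullet> u = 0 \<or> a \<bullet> v = 0")
    case True
    then have "u = 0 \<or> v = 0" using pos[of u] pos[of v] u v by (auto simp: solid_cone_def)
    then show ?thesis using bilinear_lzero[OF bil] bilinear_rzero[OF bil] by auto
  next
    case False
    then have p: "0 < (a \<bullet> u) * (a \<bullet> v)" using u v by (auto simp: solid_cone_def)
    have "(a \<bullet> v)\<^sup>2 * Q u u + (a \<bullet> u)\<^sup>2 * Q v v \<le> 0"
      using u v by (auto simp: solid_cone_def intro!: add_nonpos_nonpos mult_nonneg_nonpos)
    then have "(a \<bullet> u) * (a \<bullet> v) * Q u v \<le> 0"
      using reverse_Cauchy_Schwarz[where Q = Q and a = a and u = u and v = v, OF bil sym pos'] by (simp add: mult.assoc)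
    then show ?thesis using p by (meson linorder_not_less mult_pos_pos)
  qed
  then show ?thesis using u v
    by (auto simp: solid_cone_def bilinear_ladd[OF bil] bilinear_radd[OF bil] sym[of v u] inner_add_right)
qed

lemma solid_cone_convex:
  assumes bil: "bilinear Q" and sym: "\<And>u v. Q u v = Q v u"
    and pos: "\<And>w. a \<bullet> w = 0 \<Longrightarrow> w \<noteq> 0 \<Longrightarrow> 0 < Q w w"
  shows "convex (solid_cone Q a)"
  using solid_cone_add[OF assms] solid_cone_scaleR[OF bil] by (auto simp: convex_def)

lemma solid_cone_closed:
  assumes "bilinear Q"
  shows "closed (solid_cone Q a)"
proof -
  have "continuous_on UNIV (\<lambda>v. Q v v)"
    using bilinear_continuous_on_compose[OF continuous_on_id continuous_on_id assms] by simp
  then show ?thesis unfolding solid_cone_def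
    by (intro closed_Collect_conj closed_Collect_le continuous_intros) auto
qed

text \<open>Otherwise a hyperplane separates the increment from \<open>K\<close>. On a cone the
  separating functional is nonnegative, and the scalar mean value theorem for its composition with
  \<open>f\<close> contradicts the separation.\<close>

lemma increment_in_closed_convex_cone:
  fixes f :: "real \<Rightarrow> 'e::euclidean_space"
  assumes K: "convex K" "closed K" "\<And>k v. v \<in> K \<Longrightarrow> 0 \<le> k \<Longrightarrow> k *\<^sub>R v \<in> K" and "s < t"
    and f: "\<And>u. u \<in> {s..t} \<Longrightarrow> (f has_vector_derivative v u) (at u within {s..t})"
    and v: "\<And>u. u \<in> {s..t} \<Longrightarrow> v u \<in> K"
  shows "f t - f s \<in> K"
proof (rule ccontr)
  assume "f t - f s \<notin> K"
  then obtain a b where a: "a \<bullet> (f t - f s) < b" "\<And>x. x \<in> K \<Longrightarrow> a \<bullet> x > b"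
    using separating_hyperplane_closed_point[OF K(1,2)] by blast
  have "0 \<in> K" using K(3)[OF v[of s], of 0] \<open>s < t\<close> by simp
  then have b: "b < 0" using a(2) by force
  have nonneg: "0 \<le> a \<bullet> x" if "x \<in> K" for x
  proof (rule ccontr)
    assume "\<not> 0 \<le> a \<bullet> x"
    then have "(b / (a \<bullet> x)) *\<^sub>R x \<in> K" using b by (intro K(3) that) (simp add: divide_nonpos_neg)
    then show False using a(2)[of "(b / (a \<bullet> x)) *\<^sub>R x"] \<open>\<not> 0 \<le> a \<bullet> x\<close> by simp
  qed
  have "\<exists>\<xi>\<in>{s<..<t}. (a \<bullet> f t) - (a \<bullet> f s) = (a \<bullet> v \<xi>) * (t - s)"
  proof -
    have d: "((\<lambda>u. a \<bullet> f u) has_derivative (\<lambda>x. x * (a \<bullet> v u))) (at u within {s..t})" if "u \<in> {s..t}" for u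
      using f[OF that] unfolding has_vector_derivative_def
      by (auto intro!: derivative_eq_intros)
    show ?thesis using mvt_simple[OF \<open>s < t\<close> d] by (auto simp: mult.commute)
  qed
  then obtain \<xi> where "\<xi> \<in> {s<..<t}" "(a \<bullet> f t) - (a \<bullet> f s) = (a \<bullet> v \<xi>) * (t - s)" by blast
  then have "0 \<le> a \<bullet> (f t - f s)" using nonneg[OF v[of \<xi>]] \<open>s < t\<close> by (simp add: inner_diff_right)
  then show False using a(1) b by linarith
qed

section \<open>Piecewise curves\<close>

text \<open>Separate conditions \<open>K\<close> and \<open>K'\<close> let one statement serve
  several purposes: \<open>a > 0\<close> reparametrizes, \<open>a = -1\<close> reverses time, and
  \<open>a = 1\<close> restricts to a subinterval or passes to a larger cone.\<close>

lemma C1_arc_affine: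
  assumes arc: "C1_arc M K \<gamma> s' t'" and st: "\<And>u. u \<in> {s..t} \<Longrightarrow> a * u + b \<in> {s'..t'}"
    and K: "\<And>c p v. c \<in> charts M \<Longrightarrow> p \<in> fst c \<Longrightarrow> K c p v \<Longrightarrow> K' c p (a *\<^sub>R v)"
  shows "C1_arc M K' (\<lambda>u. \<gamma> (a * u + b)) s t"
proof -
  from arc obtain v where cont: "continuous_on {s'..t'} \<gamma>" and v: "\<And>c. c \<in> charts M \<Longrightarrow>
        continuous_on {u \<in> {s'..t'}. \<gamma> u \<in> fst c} (v c) \<and>
        (\<forall>u\<in>{s'..t'}. \<gamma> u \<in> fst c \<longrightarrow>
           ((snd c \<circ> \<gamma>) has_vector_derivative v c u) (at u within {s'..t'}) \<and> K c (\<gamma> u) (v c u))"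
    unfolding C1_arc_def by blast
  have "continuous_on {s..t} (\<lambda>u. \<gamma> (a * u + b))"
    by (rule continuous_on_compose2[OF cont]) (use st in \<open>auto intro!: continuous_intros\<close>)
  moreover have "continuous_on {u \<in> {s..t}. \<gamma> (a * u + b) \<in> fst c} (\<lambda>u. a *\<^sub>R v c (a * u + b))"
    if "c \<in> charts M" for c
    by (intro continuous_intros continuous_on_compose2[OF conjunct1[OF v[OF that]]]) (use st in auto)
  moreover have "((snd c \<circ> (\<lambda>u. \<gamma> (a * u + b))) has_vector_derivative a *\<^sub>R v c (a * u + b)) (at u within {s..t})
      \<and> K' c (\<gamma> (a * u + b)) (a *\<^sub>R v c (a * u + b))"
    if c: "c \<in> charts M" and u: "u \<in> {s..t}" "\<gamma> (a * u + b) \<in> fst c" for c u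
  proof
    have 1: "((\<lambda>u. a * u + b) has_vector_derivative a) (at u within {s..t})"
      by (auto intro!: derivative_eq_intros)
    have "((snd c \<circ> \<gamma>) has_vector_derivative v c (a * u + b)) (at (a * u + b) within {s'..t'})"
      using v[OF c] st[OF u(1)] u(2) by blast
    then have 2: "((snd c \<circ> \<gamma>) has_vector_derivative v c (a * u + b))
        (at (a * u + b) within (\<lambda>u. a * u + b) ` {s..t})"
      by (rule has_vector_derivative_within_subset) (use st in blast)
    show "((snd c \<circ> (\<lambda>u. \<gamma> (a * u + b))) has_vector_derivative a *\<^sub>R v c (a * u + b)) (at u within {s..t})"
      using vector_diff_chain_within[OF 1 2] by (simp add: o_def)
    show "K' c (\<gamma> (a * u + b)) (a *\<^sub>R v c (a * u + b))"
      using v[OF c] st[OF u(1)] u(2) by (intro K c) auto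
  qed
  ultimately show ?thesis
    unfolding C1_arc_def by (intro conjI exI[of _ "\<lambda>c u. a *\<^sub>R v c (a * u + b)"]) auto
qed

lemma C1_arc_cong:
  assumes "C1_arc M K \<gamma> s t" "\<And>u. u \<in> {s..t} \<Longrightarrow> \<gamma>' u = \<gamma> u"
  shows "C1_arc M K \<gamma>' s t"
proof -
  from assms(1) obtain v where cont: "continuous_on {s..t} \<gamma>" and v: "\<And>c. c \<in> charts M \<Longrightarrow>
        continuous_on {u \<in> {s..t}. \<gamma> u \<in> fst c} (v c) \<and>
        (\<forall>u\<in>{s..t}. \<gamma> u \<in> fst c \<longrightarrow>
           ((snd c \<circ> \<gamma>) has_vector_derivative v c u) (at u within {s..t}) \<and> K c (\<gamma> u) (v c u))"
    unfolding C1_arc_def by blast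
  have "continuous_on {s..t} \<gamma>'"
    using continuous_on_cong[OF refl assms(2), of "{s..t}" "\<lambda>u. u"] cont assms(2) continuous_on_cong by metis
  moreover have "{u \<in> {s..t}. \<gamma>' u \<in> fst c} = {u \<in> {s..t}. \<gamma> u \<in> fst c}" for c :: "('a, 'b) chart"
    using assms(2) by auto
  moreover have "((snd c \<circ> \<gamma>') has_vector_derivative v c u) (at u within {s..t}) \<and> K c (\<gamma>' u) (v c u)"
    if "c \<in> charts M" "u \<in> {s..t}" "\<gamma>' u \<in> fst c" for c u
    using v[OF that(1)] that(2,3) assms(2)
    by (auto intro: has_vector_derivative_transform[of u "{s..t}" "snd c \<circ> \<gamma>'" "snd c \<circ> \<gamma>"])
  ultimately show ?thesis
    unfolding C1_arc_def using v by (intro conjI exI[of _ v]) auto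
qed

lemma C1_arc_subinterval:
  assumes "C1_arc M K \<gamma> s' t'" "s' \<le> s" "t \<le> t'"
  shows "C1_arc M K \<gamma> s t"
  using C1_arc_affine[OF assms(1), of s t 1 0 K] assms(2,3) by auto

lemma unit_interval_affine:
  fixes u s t :: real
  assumes "u \<in> {0..1}" "s \<le> t"
  shows "(t - s) * u + s \<in> {s..t}"
  using assms mult_left_le[of u "t - s"] by simp

lemma piecewise_curve_affine:
  assumes pw: "piecewise_curve M K \<gamma>" and a: "a \<noteq> 0"
    and ab: "\<And>u. u \<in> {0..1} \<Longrightarrow> a * u + b \<in> {0..1}"
    and K: "\<And>c p v. c \<in> charts M \<Longrightarrow> p \<in> fst c \<Longrightarrow> K c p v \<Longrightarrow> K' c p (a *\<^sub>R v)"
  shows "piecewise_curve M K' (\<lambda>u. \<gamma> (a * u + b))"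
proof -
  from pw obtain S where path: "path \<gamma>" and S: "finite S"
    "\<And>s t. 0 \<le> s \<Longrightarrow> s < t \<Longrightarrow> t \<le> 1 \<Longrightarrow> {s<..<t} \<inter> S = {} \<Longrightarrow> C1_arc M K \<gamma> s t"
    unfolding piecewise_curve_def by blast
  have "path (\<lambda>u. \<gamma> (a * u + b))"
    unfolding path_def
  proof (rule continuous_on_compose2[of "{0..1}" \<gamma> "{0..1}" "\<lambda>u. a * u + b"])
    show "continuous_on {0..1} \<gamma>" using path by (simp add: path_def)
    show "(\<lambda>u. a * u + b) ` {0..1} \<subseteq> {0..1}" using ab by blast
  qed (intro continuous_intros)
  moreover have "finite ((\<lambda>y. (y - b) / a) ` S)" using S by simp
  moreover have "C1_arc M K' (\<lambda>u. \<gamma> (a * u + b)) s t"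
    if st: "0 \<le> s" "s < t" "t \<le> 1" and no: "{s<..<t} \<inter> (\<lambda>y. (y - b) / a) ` S = {}" for s t
  proof -
    \<comment> \<open>A negative \<open>a\<close> exchanges the end points, hence \<open>min\<close>
      and \<open>max\<close>.\<close>
    define s' t' where "s' = min (a * s + b) (a * t + b)" and "t' = max (a * s + b) (a * t + b)"
    have "y \<notin> S" if "s' < y" "y < t'" for y
    proof
      assume "y \<in> S"
      define w where "w = (y - b) / a"
      have "y = a * w + b" using a by (simp add: w_def)
      then have "a * s < a * w \<and> a * w < a * t \<or> a * t < a * w \<and> a * w < a * s"
        using that by (auto simp: s'_def t'_def min_def max_def split: if_splits)
      then have "w \<in> {s<..<t}" using st a by (auto simp: mult_less_cancel_left)
      then have "(y - b) / a \<in> {s<..<t}" by (simp add: w_def)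
      then show False using no \<open>y \<in> S\<close> by blast
    qed
    moreover have "a * s \<noteq> a * t" using a st by simp
    then have "s' < t'" unfolding s'_def t'_def by linarith
    moreover have "0 \<le> s'" "t' \<le> 1" using ab[of s] ab[of t] st by (auto simp: s'_def t'_def)
    ultimately have "C1_arc M K \<gamma> s' t'" by (intro S) auto
    then show ?thesis
    proof (rule C1_arc_affine)
      fix u assume u: "u \<in> {s..t}"
      then have "a * s \<le> a * u \<and> a * u \<le> a * t \<or> a * t \<le> a * u \<and> a * u \<le> a * s"
        by (cases "a > 0") (auto simp: mult_left_mono mult_left_mono_neg)
      then show "a * u + b \<in> {s'..t'}" by (auto simp: s'_def t'_def)
    qed (rule K)
  qed
  ultimately show ?thesis unfolding piecewise_curve_def by blast
qed

lemma piecewise_curve_join: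
  assumes pw: "piecewise_curve M K \<gamma>1" "piecewise_curve M K \<gamma>2" and fs: "pathfinish \<gamma>1 = pathstart \<gamma>2"
    and K: "\<And>c p v k. c \<in> charts M \<Longrightarrow> p \<in> fst c \<Longrightarrow> K c p v \<Longrightarrow> 0 < k \<Longrightarrow> K c p (k *\<^sub>R v)"
  shows "piecewise_curve M K (\<gamma>1 +++ \<gamma>2)"
proof -
  from pw(1) obtain S1 where S1: "path \<gamma>1" "finite S1"
    "\<And>s t. 0 \<le> s \<Longrightarrow> s < t \<Longrightarrow> t \<le> 1 \<Longrightarrow> {s<..<t} \<inter> S1 = {} \<Longrightarrow> C1_arc M K \<gamma>1 s t"
    unfolding piecewise_curve_def by blast
  from pw(2) obtain S2 where S2: "path \<gamma>2" "finite S2"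
    "\<And>s t. 0 \<le> s \<Longrightarrow> s < t \<Longrightarrow> t \<le> 1 \<Longrightarrow> {s<..<t} \<inter> S2 = {} \<Longrightarrow> C1_arc M K \<gamma>2 s t"
    unfolding piecewise_curve_def by blast
  \<comment> \<open>The junction 1/2 becomes a break point, since the one-sided velocities there
    need not agree.\<close>
  let ?S = "insert (1/2) ((\<lambda>y. y / 2) ` S1 \<union> (\<lambda>y. (y + 1) / 2) ` S2)"
  have "C1_arc M K (\<gamma>1 +++ \<gamma>2) s t"
    if st: "0 \<le> s" "s < t" "t \<le> 1" and no: "{s<..<t} \<inter> ?S = {}" for s t
  proof (cases "t \<le> 1/2")
    case True
    have "y \<notin> S1" if "2 * s < y" "y < 2 * t" for y
    proof
      assume "y \<in> S1"
      then have "y / 2 \<notin> {s<..<t}" using no by blast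
      then show False using that by auto
    qed
    then have "C1_arc M K \<gamma>1 (2 * s) (2 * t)" using st True by (intro S1) auto
    then have "C1_arc M K (\<lambda>u. \<gamma>1 (2 * u + 0)) s t"
      by (rule C1_arc_affine) (use K in auto)
    then show ?thesis
      by (rule C1_arc_cong) (use True in \<open>auto simp: joinpaths_def\<close>)
  next
    case False
    then have s: "1/2 \<le> s" using no st by (auto simp: not_le)
    have "y \<notin> S2" if "2 * s - 1 < y" "y < 2 * t - 1" for y
    proof
      assume "y \<in> S2"
      then have "(y + 1) / 2 \<notin> {s<..<t}" using no by blast
      then show False using that by auto
    qed
    then have "C1_arc M K \<gamma>2 (2 * s - 1) (2 * t - 1)" using st s by (intro S2) auto
    then have "C1_arc M K (\<lambda>u. \<gamma>2 (2 * u + -1)) s t"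
      by (rule C1_arc_affine) (use K in auto)
    then show ?thesis
    proof (rule C1_arc_cong)
      fix u assume u: "u \<in> {s..t}"
      show "(\<gamma>1 +++ \<gamma>2) u = \<gamma>2 (2 * u + -1)"
      proof (cases "u = 1/2")
        case True
        show ?thesis using fs unfolding True by (simp add: joinpaths_def pathfinish_def pathstart_def)
      next
        case False
        then show ?thesis using s u by (auto simp: joinpaths_def)
      qed
    qed
  qed
  moreover have "finite ?S" using S1 S2 by simp
  moreover have "path (\<gamma>1 +++ \<gamma>2)" using S1 S2 fs by simp
  ultimately show ?thesis unfolding piecewise_curve_def by blast
qed

text \<open>The common core of \<open>chron\<close> and of the nontrivial case of
  \<open>causal\<close>, with the cone field as a parameter, so that concatenation, restriction and
  reversal are proved once.\<close>

definition curve_rel ::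
  "('a::topological_space, 'e::euclidean_space) lorentz_manifold \<Rightarrow>
   (('a, 'e) chart \<Rightarrow> 'a \<Rightarrow> 'e \<Rightarrow> bool) \<Rightarrow> 'a \<Rightarrow> 'a \<Rightarrow> bool" where
  "curve_rel M K p q \<longleftrightarrow> (\<exists>\<gamma>. piecewise_curve M K \<gamma> \<and> pathstart \<gamma> = p \<and> pathfinish \<gamma> = q)"

text \<open>Curves are parametrized over the fixed interval [0, 1], so joining and restricting them
  rescales velocities by positive factors.\<close>

locale homogeneous =
  fixes M :: "('a::topological_space, 'e::euclidean_space) lorentz_manifold"
    and K :: "('a, 'e) chart \<Rightarrow> 'a \<Rightarrow> 'e \<Rightarrow> bool"
  assumes scale: "c \<in> charts M \<Longrightarrow> p \<in> fst c \<Longrightarrow> K c p v \<Longrightarrow> 0 < k \<Longrightarrow> K c p (k *\<^sub>R v)"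
begin

lemma curve_rel_trans:
  assumes "curve_rel M K p q" "curve_rel M K q w"
  shows "curve_rel M K p w"
proof -
  obtain \<gamma>1 \<gamma>2 where "piecewise_curve M K \<gamma>1" "pathstart \<gamma>1 = p" "pathfinish \<gamma>1 = q"
    "piecewise_curve M K \<gamma>2" "pathstart \<gamma>2 = q" "pathfinish \<gamma>2 = w"
    using assms unfolding curve_rel_def by blast
  then show ?thesis
    unfolding curve_rel_def using scale
    by (intro exI[of _ "\<gamma>1 +++ \<gamma>2"] conjI piecewise_curve_join) auto
qed

lemma curve_rel_subcurve:
  assumes "piecewise_curve M K \<gamma>" "0 \<le> s" "s < t" "t \<le> 1"
  shows "curve_rel M K (\<gamma> s) (\<gamma> t)"
proof -
  have "piecewise_curve M K (\<lambda>u. \<gamma> ((t - s) * u + s))"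
  proof (rule piecewise_curve_affine[OF assms(1)])
    fix u :: real assume "u \<in> {0..1}"
    then show "(t - s) * u + s \<in> {0..1}" using unit_interval_affine[of u s t] assms by auto
  qed (use assms scale in auto)
  then show ?thesis
    unfolding curve_rel_def
    by (intro exI[of _ "\<lambda>u. \<gamma> ((t - s) * u + s)"]) (auto simp: pathstart_def pathfinish_def)
qed

lemma curve_rel_C1_arc:
  assumes arc: "C1_arc M K \<gamma> s t" and "s < t"
  shows "curve_rel M K (\<gamma> s) (\<gamma> t)"
proof -
  let ?\<gamma> = "\<lambda>u. \<gamma> ((t - s) * u + s)"
  have "C1_arc M K ?\<gamma> 0 1"
  proof (rule C1_arc_affine[OF arc])
    fix u :: real assume "u \<in> {0..1}"
    then show "(t - s) * u + s \<in> {s..t}" using unit_interval_affine[of u s t] assms by auto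
  qed (use assms scale in auto)
  moreover then have "path ?\<gamma>" by (simp add: C1_arc_def path_def)
  ultimately have "piecewise_curve M K ?\<gamma>"
    unfolding piecewise_curve_def by (intro conjI exI[of _ "{}"]) (auto intro: C1_arc_subinterval)
  then show ?thesis
    unfolding curve_rel_def
    by (intro exI[of _ ?\<gamma>]) (auto simp: pathstart_def pathfinish_def)
qed

end

lemma curve_rel_reverse:
  assumes "curve_rel M K p q"
    and K: "\<And>c p v. c \<in> charts M \<Longrightarrow> p \<in> fst c \<Longrightarrow> K c p v \<Longrightarrow> K' c p (- v)"
  shows "curve_rel M K' q p"
proof -
  obtain \<gamma> where \<gamma>: "piecewise_curve M K \<gamma>" "pathstart \<gamma> = p" "pathfinish \<gamma> = q"
    using assms unfolding curve_rel_def by blast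
  have "piecewise_curve M K' (\<lambda>u. \<gamma> (- 1 * u + 1))"
    by (rule piecewise_curve_affine[OF \<gamma>(1)]) (use K in auto)
  then show ?thesis
    unfolding curve_rel_def using \<gamma>(2,3)
    by (intro exI[of _ "\<lambda>u. \<gamma> (- 1 * u + 1)"]) (auto simp: pathstart_def pathfinish_def)
qed

section \<open>Charts of a spacetime\<close>

locale spacetime_manifold =
  fixes M :: "('a::{t2_space, second_countable_topology}, 'e::euclidean_space) lorentz_manifold"
    and r :: enat
  assumes spacetime: "spacetime r M"
begin

abbreviation \<psi> :: "('a, 'e) chart \<Rightarrow> 'e \<Rightarrow> 'a" where
  "\<psi> c \<equiv> inv_into (fst c) (snd c)"

lemma chart:
  assumes "c \<in> charts M"
  shows chart_open: "open (fst c)" and chart_image_open: "open (snd c ` fst c)"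
    and chart_homeomorphism: "homeomorphism (fst c) (snd c ` fst c) (snd c) (\<psi> c)"
  using spacetime assms unfolding spacetime_def C_atlas_def is_chart_def by blast+

lemma
  assumes "c \<in> charts M"
  shows chart_continuous: "continuous_on (fst c) (snd c)"
    and \<psi>_continuous: "continuous_on (snd c ` fst c) (\<psi> c)"
    and \<psi>_chart: "p \<in> fst c \<Longrightarrow> \<psi> c (snd c p) = p"
    and chart_\<psi>: "y \<in> snd c ` fst c \<Longrightarrow> snd c (\<psi> c y) = y"
    and \<psi>_mem: "y \<in> snd c ` fst c \<Longrightarrow> \<psi> c y \<in> fst c"
  using chart_homeomorphism[OF assms] by (auto simp: homeomorphism_def)

lemma chart_cover: obtains c where "c \<in> charts M" "p \<in> fst c"
  using spacetime unfolding spacetime_def C_atlas_def by blast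

lemma transition_C1:
  assumes "c \<in> charts M" "d \<in> charts M"
  shows "Cn_on 1 (snd c ` (fst c \<inter> fst d)) (transition c d)"
proof -
  have "C_on r (snd c ` (fst c \<inter> fst d)) (transition c d)" "3 \<le> r"
    using spacetime assms unfolding spacetime_def C_atlas_def by auto
  moreover have "enat 1 \<le> 3" by (simp add: numeral_eq_enat)
  ultimately show ?thesis unfolding C_on_def using order_trans by blast
qed

lemma transition_has_derivative_jacobian:
  assumes "c \<in> charts M" "d \<in> charts M" "p \<in> fst c" "p \<in> fst d"
  shows "(transition c d has_derivative jacobian c d p) (at (snd c p))"
  using transition_C1[OF assms(1,2)] assms(3,4)
  by (auto simp: jacobian_def frechet_derivative_works[symmetric])

lemma metric_bilinear: "c \<in> charts M \<Longrightarrow> p \<in> fst c \<Longrightarrow> bilinear (metric M c p)"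
  and metric_sym: "c \<in> charts M \<Longrightarrow> p \<in> fst c \<Longrightarrow> metric M c p u v = metric M c p v u"
  and metric_lorentz: "c \<in> charts M \<Longrightarrow> p \<in> fst c \<Longrightarrow> lorentz_form (metric M c p)"
  using spacetime unfolding spacetime_def lorentz_metric_def lorentz_form_def by blast+

lemma metric_jacobian:
  assumes "c \<in> charts M" "d \<in> charts M" "p \<in> fst c" "p \<in> fst d"
  shows "metric M d p (jacobian c d p u) (jacobian c d p v) = metric M c p u v"
  using spacetime assms unfolding spacetime_def lorentz_metric_def by blast

lemma tfield_jacobian:
  assumes "c \<in> charts M" "d \<in> charts M" "p \<in> fst c" "p \<in> fst d"
  shows "tfield M d p = jacobian c d p (tfield M c p)"
  using spacetime assms unfolding spacetime_def time_oriented_def by blast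

lemma tfield_timelike: "c \<in> charts M \<Longrightarrow> p \<in> fst c \<Longrightarrow> metric M c p (tfield M c p) (tfield M c p) < 0"
  and tfield_continuous: "c \<in> charts M \<Longrightarrow> continuous_on (fst c) (tfield M c)"
  using spacetime unfolding spacetime_def time_oriented_def by blast+

lemma metric_C1:
  assumes "c \<in> charts M"
  shows "Cn_on 1 (snd c ` fst c) (\<lambda>y. metric M c (\<psi> c y) u v)"
proof -
  have "C_on (r - 1) (snd c ` fst c) (\<lambda>y. metric M c (\<psi> c y) u v)" "3 \<le> r"
    using spacetime assms unfolding spacetime_def lorentz_metric_def by auto
  moreover have "enat 1 \<le> r - 1" using \<open>3 \<le> r\<close>
    by (cases r) (auto simp: numeral_eq_enat one_enat_def)
  ultimately show ?thesis unfolding C_on_def by blast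
qed

section \<open>Cone fields and curves under change of charts\<close>

lemma future_timelike_jacobian:
  assumes "c \<in> charts M" "d \<in> charts M" "p \<in> fst c" "p \<in> fst d" "future_timelike M c p v"
  shows "future_timelike M d p (jacobian c d p v)"
  using assms by (simp add: future_timelike_def metric_jacobian tfield_jacobian[of c d])

text \<open>That the transformed vector is nonzero is read off its negative product with the time
  field, rather than from invertibility of the Jacobian.\<close>

lemma future_causal_jacobian:
  assumes "c \<in> charts M" "d \<in> charts M" "p \<in> fst c" "p \<in> fst d" "future_causal M c p v"
  shows "future_causal M d p (jacobian c d p v)"
proof -
  have "metric M d p (jacobian c d p v) (tfield M d p) < 0"
    using assms by (simp add: future_causal_def metric_jacobian tfield_jacobian[of c d])
  moreover from this have "jacobian c d p v \<noteq> 0"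
    using bilinear_lzero[OF metric_bilinear[of d p]] assms by auto
  ultimately show ?thesis using assms by (simp add: future_causal_def metric_jacobian)
qed

sublocale timelike: homogeneous M "future_timelike M"
  by unfold_locales (auto simp: future_timelike_def bilinear_lmul[OF metric_bilinear]
      bilinear_rmul[OF metric_bilinear] mult_less_0_iff zero_less_mult_iff)

sublocale causal: homogeneous M "future_causal M"
  by unfold_locales (auto simp: future_causal_def bilinear_lmul[OF metric_bilinear]
      bilinear_rmul[OF metric_bilinear] mult_less_0_iff zero_less_mult_iff mult_le_0_iff zero_le_mult_iff)

lemma chron_eq: "chron M = curve_rel M (future_timelike M)"
  by (intro ext) (simp add: chron_def curve_rel_def)

lemma causal_eq: "causal M p q \<longleftrightarrow> p = q \<or> curve_rel M (future_causal M) p q"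
  by (simp add: causal_def curve_rel_def)

lemma chron_trans: "chron M p q \<Longrightarrow> chron M q w \<Longrightarrow> chron M p w"
  unfolding chron_eq by (rule timelike.curve_rel_trans)

lemma chron_imp_causal:
  assumes "chron M p q" shows "causal M p q"
proof -
  obtain \<gamma> where \<gamma>: "piecewise_curve M (future_timelike M) \<gamma>" "pathstart \<gamma> = p" "pathfinish \<gamma> = q"
    using assms unfolding chron_def by blast
  have "piecewise_curve M (future_causal M) (\<lambda>u. \<gamma> (1 * u + 0))"
  proof (rule piecewise_curve_affine[OF \<gamma>(1)])
    fix c p v assume "c \<in> charts M" "p \<in> fst c" "future_timelike M c p v"
    then show "future_causal M c p (1 *\<^sub>R v)"
      using bilinear_lzero[OF metric_bilinear[of c p]] by (auto simp: future_timelike_def future_causal_def)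
  qed auto
  then show ?thesis using \<gamma> by (auto simp: causal_def)
qed

text \<open>\<open>C1_arc\<close> demands velocities in every chart, although the curve is drawn in
  the single chart \<open>c\<close>. In a chart \<open>d\<close> the velocity is the image of
  \<open>w u\<close> under \<open>jacobian c d\<close>, by the chain rule for
  \<open>transition c d\<close>.\<close>

lemma C1_arc_in_chart:
  assumes c: "c \<in> charts M" and f: "f ` {s..t} \<subseteq> snd c ` fst c" and w: "continuous_on {s..t} w"
    and der: "\<And>u. u \<in> {s..t} \<Longrightarrow> (f has_vector_derivative w u) (at u within {s..t})"
    and Kw: "\<And>u. u \<in> {s..t} \<Longrightarrow> K c (\<psi> c (f u)) (w u)"
    and K: "\<And>d p v. d \<in> charts M \<Longrightarrow> p \<in> fst c \<Longrightarrow> p \<in> fst d \<Longrightarrow> K c p v \<Longrightarrow> K d p (jacobian c d p v)"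
  shows "C1_arc M K (\<lambda>u. \<psi> c (f u)) s t"
proof -
  have contf: "continuous_on {s..t} f"
    using has_vector_derivative_continuous[OF der] by (simp add: continuous_on_eq_continuous_within)
  have mem: "\<psi> c (f u) \<in> fst c" "snd c (\<psi> c (f u)) = f u" if "u \<in> {s..t}" for u
  proof -
    have "f u \<in> snd c ` fst c" using f that by blast
    then show "\<psi> c (f u) \<in> fst c" "snd c (\<psi> c (f u)) = f u"
      using \<psi>_mem[OF c] chart_\<psi>[OF c] by blast+
  qed
  let ?v = "\<lambda>d u. jacobian c d (\<psi> c (f u)) (w u)"
  have "continuous_on {s..t} (\<lambda>u. \<psi> c (f u))"
    by (rule continuous_on_compose2[OF \<psi>_continuous[OF c] contf f])
  moreover have "continuous_on {u \<in> {s..t}. \<psi> c (f u) \<in> fst d} (?v d)" if d: "d \<in> charts M" for d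
  proof -
    let ?U = "{u \<in> {s..t}. \<psi> c (f u) \<in> fst d}"
    let ?F = "\<lambda>y. frechet_derivative (transition c d) (at y)"
    have fU: "f ` ?U \<subseteq> snd c ` (fst c \<inter> fst d)"
    proof clarify
      fix u assume "u \<in> {s..t}" "\<psi> c (f u) \<in> fst d"
      then show "f u \<in> snd c ` (fst c \<inter> fst d)" using mem[of u] by (metis IntI image_eqI)
    qed
    have "continuous_on (snd c ` (fst c \<inter> fst d)) (\<lambda>y. ?F y b)" for b
      using transition_C1[OF c d] by simp
    then have "continuous_on ?U (\<lambda>u. ?F (f u) b)" for b
      by (rule continuous_on_compose2) (use fU in \<open>auto intro: continuous_on_subset[OF contf]\<close>)
    \<comment> \<open>Continuity of the derivative is known for fixed directions only, so the moving
      direction \<open>w u\<close> is expanded in the basis.\<close>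
    then have "continuous_on ?U (\<lambda>u. \<Sum>b\<in>Basis. (w u \<bullet> b) *\<^sub>R ?F (f u) b)"
      by (intro continuous_intros) (auto intro: continuous_on_subset[OF w])
    moreover have "?v d u = (\<Sum>b\<in>Basis. (w u \<bullet> b) *\<^sub>R ?F (f u) b)" if u: "u \<in> ?U" for u
    proof -
      have "linear (?F (f u))"
        using transition_has_derivative_jacobian[OF c d, of "\<psi> c (f u)"] mem[of u] u has_derivative_linear
        by (auto simp: jacobian_def)
      then have "?F (f u) (\<Sum>b\<in>Basis. (w u \<bullet> b) *\<^sub>R b) = (\<Sum>b\<in>Basis. (w u \<bullet> b) *\<^sub>R ?F (f u) b)"
        by (simp add: linear_sum linear_cmul)
      then show ?thesis using mem[of u] u by (simp add: jacobian_def euclidean_representation)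
    qed
    ultimately show ?thesis by (rule continuous_on_eq[OF _ sym])
  qed
  moreover have "((snd d \<circ> (\<lambda>u. \<psi> c (f u))) has_vector_derivative ?v d u) (at u within {s..t})
      \<and> K d (\<psi> c (f u)) (?v d u)"
    if d: "d \<in> charts M" and u: "u \<in> {s..t}" "\<psi> c (f u) \<in> fst d" for d u
  proof
    have "(transition c d has_derivative jacobian c d (\<psi> c (f u))) (at (f u) within f ` {s..t})"
      using transition_has_derivative_jacobian[OF c d mem(1)[OF u(1)] u(2)] mem(2)[OF u(1)]
      by (simp add: has_derivative_at_withinI)
    then have "((transition c d \<circ> f) has_vector_derivative ?v d u) (at u within {s..t})"
      by (rule vector_derivative_diff_chain_within[OF der[OF u(1)]])
    then show "((snd d \<circ> (\<lambda>u. \<psi> c (f u))) has_vector_derivative ?v d u) (at u within {s..t})"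
      by (simp add: transition_def o_def)
    show "K d (\<psi> c (f u)) (?v d u)" using K[OF d mem(1)[OF u(1)] u(2) Kw[OF u(1)]] .
  qed
  ultimately show ?thesis
    unfolding C1_arc_def by (intro conjI exI[of _ ?v]) auto
qed

lemma C1_arc_chartD:
  assumes "C1_arc M K \<gamma> s t" "c \<in> charts M" "\<gamma> ` {s..t} \<subseteq> fst c"
  obtains w where "continuous_on {s..t} w"
    "\<And>u. u \<in> {s..t} \<Longrightarrow> ((\<lambda>u. snd c (\<gamma> u)) has_vector_derivative w u) (at u within {s..t})"
    "\<And>u. u \<in> {s..t} \<Longrightarrow> K c (\<gamma> u) (w u)"
proof -
  from assms(1,2) obtain v where v: "continuous_on {u \<in> {s..t}. \<gamma> u \<in> fst c} (v c)"
    "\<forall>u\<in>{s..t}. \<gamma> u \<in> fst c \<longrightarrow>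
           ((snd c \<circ> \<gamma>) has_vector_derivative v c u) (at u within {s..t}) \<and> K c (\<gamma> u) (v c u)"
    unfolding C1_arc_def by blast
  moreover have "{u \<in> {s..t}. \<gamma> u \<in> fst c} = {s..t}" using assms(3) by auto
  ultimately show ?thesis using assms(3) by (intro that[of "v c"]) (auto simp: o_def)
qed

lemma chron_in_chart:
  assumes "c \<in> charts M" "f ` {s..t} \<subseteq> snd c ` fst c" "continuous_on {s..t} w" "s < t"
    and "\<And>u. u \<in> {s..t} \<Longrightarrow> (f has_vector_derivative w u) (at u within {s..t})"
    and "\<And>u. u \<in> {s..t} \<Longrightarrow> future_timelike M c (\<psi> c (f u)) (w u)"
  shows "chron M (\<psi> c (f s)) (\<psi> c (f t))"
  unfolding chron_eq using assms future_timelike_jacobian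
  by (intro timelike.curve_rel_C1_arc[of "\<lambda>u. \<psi> c (f u)"] C1_arc_in_chart) auto

lemma causal_in_chart:
  assumes "c \<in> charts M" "f ` {s..t} \<subseteq> snd c ` fst c" "continuous_on {s..t} w" "s < t"
    and "\<And>u. u \<in> {s..t} \<Longrightarrow> (f has_vector_derivative w u) (at u within {s..t})"
    and "\<And>u. u \<in> {s..t} \<Longrightarrow> future_causal M c (\<psi> c (f u)) (w u)"
  shows "causal M (\<psi> c (f s)) (\<psi> c (f t))"
  unfolding causal_eq using assms future_causal_jacobian
  by (intro disjI2 causal.curve_rel_C1_arc[of "\<lambda>u. \<psi> c (f u)"] C1_arc_in_chart) auto

end

section \<open>Small coordinate balls\<close>

lemma bilinear_bounded_by:
  fixes B :: "'e::euclidean_space \<Rightarrow> 'e \<Rightarrow> real"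
  assumes "bilinear B" and M: "\<And>b b'. b \<in> Basis \<Longrightarrow> b' \<in> Basis \<Longrightarrow> \<bar>B b b'\<bar> \<le> M b b'"
  shows "\<bar>B u v\<bar> \<le> (\<Sum>b\<in>Basis. \<Sum>b'\<in>Basis. M b b') * norm u * norm v"
proof -
  have "B u v = B (\<Sum>b\<in>Basis. (u \<bullet> b) *\<^sub>R b) (\<Sum>b\<in>Basis. (v \<bullet> b) *\<^sub>R b)"
    by (simp add: euclidean_representation)
  also have "\<dots> = (\<Sum>(b,b')\<in>Basis \<times> Basis. B ((u \<bullet> b) *\<^sub>R b) ((v \<bullet> b') *\<^sub>R b'))"
    by (rule bilinear_sum[OF assms(1)])
  also have "\<dots> = (\<Sum>b\<in>Basis. \<Sum>b'\<in>Basis. B ((u \<bullet> b) *\<^sub>R b) ((v \<bullet> b') *\<^sub>R b'))"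
    by (simp add: sum.cartesian_product)
  also have "\<bar>\<dots>\<bar> \<le> (\<Sum>b\<in>Basis. \<Sum>b'\<in>Basis. \<bar>B ((u \<bullet> b) *\<^sub>R b) ((v \<bullet> b') *\<^sub>R b')\<bar>)"
    by (intro order_trans[OF sum_abs] sum_mono sum_abs)
  also have "\<dots> \<le> (\<Sum>b\<in>Basis. \<Sum>b'\<in>Basis. M b b' * (norm u * norm v))"
  proof (intro sum_mono)
    fix b b' :: 'e assume b: "b \<in> Basis" "b' \<in> Basis"
    have "\<bar>B ((u \<bullet> b) *\<^sub>R b) ((v \<bullet> b') *\<^sub>R b')\<bar> = \<bar>B b b'\<bar> * (\<bar>u \<bullet> b\<bar> * \<bar>v \<bullet> b'\<bar>)"
      by (simp add: bilinear_lmul[OF assms(1)] bilinear_rmul[OF assms(1)] abs_mult)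
    also have "\<dots> \<le> M b b' * (norm u * norm v)"
      using b by (intro mult_mono M Basis_le_norm) (auto intro: order_trans[OF abs_ge_zero M])
    finally show "\<bar>B ((u \<bullet> b) *\<^sub>R b) ((v \<bullet> b') *\<^sub>R b')\<bar> \<le> M b b' * (norm u * norm v)" .
  qed
  also have "\<dots> = (\<Sum>b\<in>Basis. \<Sum>b'\<in>Basis. M b b') * norm u * norm v"
    by (simp add: sum_distrib_right mult.assoc)
  finally show ?thesis .
qed

text \<open>If \<open>X\<close> exceeded the bound it would also exceed \<alpha>, so one factor
  \<alpha> of the last term can be traded for \<open>X\<close>; cancelling \<open>X\<close> leaves a
  contradictory linear inequality. What matters is that the bound is linear in \<alpha>: for causal
  vectors it will be proportional to the height.\<close>

lemma quadratic_bound: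
  fixes k X D E \<alpha> :: real
  assumes "0 < k" "0 \<le> X" "0 \<le> D" "0 \<le> E" "0 \<le> \<alpha>" and q: "k * X\<^sup>2 \<le> 2 * \<alpha> * D * X + \<alpha>\<^sup>2 * E"
  shows "X \<le> \<alpha> * ((2 * D + E) / k + 1)"
proof (rule ccontr)
  define R where "R = (2 * D + E) / k + 1"
  assume "\<not> X \<le> \<alpha> * ((2 * D + E) / k + 1)"
  then have X: "\<alpha> * R < X" by (simp add: R_def)
  have R: "1 \<le> R" "k * R = 2 * D + E + k" using assms by (auto simp: R_def field_simps)
  have "\<alpha> \<le> X" using X R(1) \<open>0 \<le> \<alpha>\<close> mult_left_mono[of 1 R \<alpha>] by simp
  then have "\<alpha> * \<alpha> * E \<le> \<alpha> * X * E" using assms by (intro mult_right_mono mult_left_mono) auto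
  then have "k * X * X \<le> \<alpha> * (2 * D + E) * X" using q by (simp add: power2_eq_square algebra_simps)
  moreover have "0 < X" using X R(1) \<open>0 \<le> \<alpha>\<close> by (smt (verit) mult_nonneg_nonneg)
  ultimately have "k * X \<le> \<alpha> * (2 * D + E)" by (simp add: mult_le_cancel_right)
  also have "\<dots> \<le> \<alpha> * (k * R)" using R(2) assms by (intro mult_left_mono) auto
  also have "\<dots> < k * X" using X \<open>0 < k\<close> by (simp add: mult.left_commute)
  finally show False by simp
qed

text \<open>In a small ball around \<open>x\<close> the linear form \<open>inner a\<close>, obtained from \<open>- g\<^sub>x(T, _)\<close>, is a time function:
  a causal vector is future directed iff its \<open>inner a\<close>-height is positive, and its Euclidean norm is
  controlled by this height.\<close>

locale lorentz_ball = spacetime_manifold M r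
  for M :: "('a::{t2_space, second_countable_topology}, 'e::euclidean_space) lorentz_manifold" and r +
  fixes c :: "('a, 'e) chart" and x :: 'a and a T :: 'e and \<rho> L k C m :: real
  assumes c: "c \<in> charts M" and x: "x \<in> fst c" and \<rho>: "0 < \<rho>"
    and ball_subset: "cball (snd c x) \<rho> \<subseteq> snd c ` fst c"
    and lipschitz: "\<And>q q' u v. q \<in> cball (snd c x) \<rho> \<Longrightarrow> q' \<in> cball (snd c x) \<rho> \<Longrightarrow>
      \<bar>metric M c (\<psi> c q) u v - metric M c (\<psi> c q') u v\<bar>
        \<le> L * norm (q - q') * norm u * norm v" and L: "0 \<le> L"
    and pos: "\<And>q w. q \<in> cball (snd c x) \<rho> \<Longrightarrow> a \<bullet> w = 0 \<Longrightarrow>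
      k * (norm w)\<^sup>2 \<le> metric M c (\<psi> c q) w w" and k: "0 < k"
    and causal_bound: "\<And>q v. q \<in> cball (snd c x) \<rho> \<Longrightarrow> 0 \<le> a \<bullet> v \<Longrightarrow>
      metric M c (\<psi> c q) v v \<le> 0 \<Longrightarrow> norm v \<le> C * (a \<bullet> v)" and C: "0 < C"
    and future_iff: "\<And>q v. q \<in> cball (snd c x) \<rho> \<Longrightarrow> v \<noteq> 0 \<Longrightarrow> metric M c (\<psi> c q) v v \<le> 0 \<Longrightarrow>
      metric M c (\<psi> c q) v (tfield M c (\<psi> c q)) < 0 \<longleftrightarrow> 0 < a \<bullet> v"
    and T: "\<And>q. q \<in> cball (snd c x) \<rho> \<Longrightarrow> metric M c (\<psi> c q) T T \<le> - m"
    and m: "0 < m" and aT: "0 < a \<bullet> T"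

lemma (in spacetime_manifold) ex_lorentz_ball:
  fixes x :: 'a
  obtains c a T \<rho> L k C m where "lorentz_ball M r c x a T \<rho> L k C m"
proof -
  obtain c where c: "c \<in> charts M" and x: "x \<in> fst c" by (rule chart_cover)
  define x0 where "x0 = snd c x"
  define g where "g q = metric M c (\<psi> c q)" for q
  let ?O = "snd c ` fst c"
  have x0: "x0 \<in> ?O" "\<psi> c x0 = x" using x \<psi>_chart[OF c] by (auto simp: x0_def)
  have bil: "bilinear (g q)" and sym: "g q u v = g q v u" if "q \<in> ?O" for q u v
    using metric_bilinear[OF c] metric_sym[OF c] \<psi>_mem[OF c that] by (auto simp: g_def)
  obtain \<rho>1 where \<rho>1: "0 < \<rho>1" "cball x0 \<rho>1 \<subseteq> ?O"
    using chart_image_open[OF c] x0 open_contains_cball by blast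
  define T where "T = tfield M c x"
  have gT: "g x0 T T < 0" using tfield_timelike[OF c x] by (simp add: g_def x0 T_def)
  define m0 where "m0 = - g x0 T T"
  have m0: "0 < m0" using gT by (simp add: m0_def)
  \<comment> \<open>The vector representing the linear form \<open>- g x0 _ T\<close> through the
    inner product.\<close>
  define a where "a = - (\<Sum>b\<in>Basis. g x0 b T *\<^sub>R b)"
  have a: "a \<bullet> v = - g x0 v T" for v
  proof -
    have "g x0 v T = g x0 (\<Sum>b\<in>Basis. (v \<bullet> b) *\<^sub>R b) T" by (simp add: euclidean_representation)
    also have "\<dots> = (\<Sum>b\<in>Basis. (v \<bullet> b) * g x0 b T)"
      using bil[OF x0(1)] by (simp add: bilinear_def linear_sum[of "\<lambda>u. g x0 u T"] linear_cmul[of "\<lambda>u. g x0 u T"])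
    finally show ?thesis by (simp add: a_def inner_sum_left) (simp add: inner_commute mult.commute)
  qed
  have aT: "a \<bullet> T = m0" by (simp add: a m0_def)
  \<comment> \<open>For fixed vectors the component of the metric is C1, hence Lipschitz on the
    ball; \<open>bilinear_bounded_by\<close> will turn the constants for basis vectors into one for
    all vectors.\<close>
  have "\<exists>L. 0 \<le> L \<and> (\<forall>q q'. q \<in> cball x0 \<rho>1 \<longrightarrow> q' \<in> cball x0 \<rho>1 \<longrightarrow> \<bar>g q u v - g q' u v\<bar> \<le> L * norm (q - q'))" for u v
  proof -
    have "Cn_on 1 ?O (\<lambda>q. g q u v)" unfolding g_def by (rule metric_C1[OF c])
    then show ?thesis
      by (rule Cn_on_1_lipschitz[OF _ compact_cball convex_cball \<rho>1(2)]) (intro exI[of _ "_::real"] conjI allI impI; assumption)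
  qed
  then obtain Lb where Lb: "\<And>u v q q'. q \<in> cball x0 \<rho>1 \<Longrightarrow> q' \<in> cball x0 \<rho>1 \<Longrightarrow>
      \<bar>g q u v - g q' u v\<bar> \<le> Lb u v * norm (q - q')" and Lb0: "\<And>u v. 0 \<le> Lb u v" by metis
  define L where "L = (\<Sum>b\<in>Basis. \<Sum>b'\<in>Basis. Lb b b')"
  have L: "0 \<le> L" unfolding L_def using Lb0 by (intro sum_nonneg) auto
  have lip: "\<bar>g q u v - g q' u v\<bar> \<le> L * norm (q - q') * norm u * norm v"
    if q: "q \<in> cball x0 \<rho>1" "q' \<in> cball x0 \<rho>1" for q q' u v
  proof -
    have "bilinear (\<lambda>u v. g q u v - g q' u v)"
      using bil[of q] bil[of q'] q \<rho>1(2) unfolding bilinear_def by (auto intro!: linear_compose_sub)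
    then have "\<bar>g q u v - g q' u v\<bar> \<le> (\<Sum>b\<in>Basis. \<Sum>b'\<in>Basis. Lb b b' * norm (q - q')) * norm u * norm v"
      by (rule bilinear_bounded_by) (rule Lb[OF q])
    then show ?thesis by (simp add: L_def sum_distrib_right)
  qed
  have cont: "continuous_on UNIV (\<lambda>w. g x0 w w)"
    using bilinear_continuous_on_compose[OF continuous_on_id continuous_on_id bil[OF x0(1)]] by simp
  \<comment> \<open>Positivity at height zero becomes uniform by compactness of the unit sphere of
    the hyperplane and by homogeneity. The value 1 is a default for an empty sphere.\<close>
  have "\<exists>k0>0. \<forall>w. a \<bullet> w = 0 \<longrightarrow> k0 * (norm w)\<^sup>2 \<le> g x0 w w"
  proof -
    let ?S = "sphere 0 1 \<inter> {w. a \<bullet> w = 0}"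
    have S: "compact ?S" by (intro compact_Int_closed compact_sphere closed_hyperplane)
    have "\<exists>k0>0. \<forall>w\<in>?S. k0 \<le> g x0 w w"
    proof (cases "?S = {}")
      case True
      then show ?thesis by (auto intro: exI[of _ 1])
    next
      case False
      then obtain w0 where w0: "w0 \<in> ?S" "\<forall>w\<in>?S. g x0 w0 w0 \<le> g x0 w w"
        using continuous_attains_inf[OF S False] continuous_on_subset[OF cont] by blast
      have "lorentz_form (g x0)" unfolding g_def x0(2) by (rule metric_lorentz[OF c x])
      then have "0 < g x0 w0 w0"
        by (rule lorentz_form_pos_on_orthogonal[where T = T]) (use w0 a[of w0] gT in auto)
      then show ?thesis using w0 by blast
    qed
    then obtain k0 where k0: "0 < k0" "\<And>w. w \<in> ?S \<Longrightarrow> k0 \<le> g x0 w w" by blast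
    have "k0 * (norm w)\<^sup>2 \<le> g x0 w w" if w: "a \<bullet> w = 0" for w
    proof (cases "w = 0")
      case True
      then show ?thesis using bilinear_lzero[OF bil[OF x0(1)]] by simp
    next
      case False
      have "k0 \<le> g x0 (w /\<^sub>R norm w) (w /\<^sub>R norm w)" using w False by (intro k0) auto
      also have "\<dots> = g x0 w w / (norm w)\<^sup>2"
        using bil[OF x0(1)] by (simp add: bilinear_lmul bilinear_rmul power2_eq_square divide_inverse)
      finally show ?thesis using False by (simp add: field_simps)
    qed
    then show ?thesis using k0(1) by blast
  qed
  then obtain k0 where k0: "0 < k0" "\<And>w. a \<bullet> w = 0 \<Longrightarrow> k0 * (norm w)\<^sup>2 \<le> g x0 w w" by blast
  have "isCont (\<lambda>q. a \<bullet> tfield M c (\<psi> c q)) x0"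
  proof -
    have "continuous_on ?O (\<lambda>q. a \<bullet> tfield M c (\<psi> c q))"
      by (intro continuous_intros continuous_on_compose2[OF tfield_continuous[OF c] \<psi>_continuous[OF c]])
        (use \<psi>_mem[OF c] in auto)
    then show ?thesis using continuous_on_eq_continuous_at[OF chart_image_open[OF c]] x0 by blast
  qed
  moreover have "0 < a \<bullet> tfield M c (\<psi> c x0)" using aT m0 by (simp add: x0 T_def)
  ultimately have "\<forall>\<^sub>F q in nhds x0. 0 < a \<bullet> tfield M c (\<psi> c q)"
    unfolding isCont_def
    using tendsto_at_iff_tendsto_nhds[of "\<lambda>q. a \<bullet> tfield M c (\<psi> c q)" x0, THEN iffD1]
    by (intro order_tendstoD(1)) auto
  then obtain \<delta> where \<delta>: "0 < \<delta>" "\<And>q. dist q x0 < \<delta> \<Longrightarrow> 0 < a \<bullet> tfield M c (\<psi> c q)"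
    unfolding eventually_nhds_metric by blast
  \<comment> \<open>Within \<rho>2 the metric changes by at most half of \<open>k0\<close>, and
    within \<rho>3 the value \<open>g q T T\<close> changes by at most half of \<open>m0\<close>.
    The other entries of the minimum below keep the ball in the Lipschitz region, give
    \<open>L * \<rho> \<le> L\<close>, and keep the time field at positive height.\<close>
  define \<rho>2 \<rho>3 where "\<rho>2 = k0 / (2 * (L + 1))" and "\<rho>3 = m0 / (2 * (L + 1) * ((norm T)\<^sup>2 + 1))"
  define \<rho> where "\<rho> = Min {\<rho>1, 1, \<delta> / 2, \<rho>2, \<rho>3}"
  have T1: "0 < (norm T)\<^sup>2 + 1" by (simp add: add_nonneg_pos)
  have pos23: "0 < \<rho>2" "0 < \<rho>3" using k0 m0 L T1 by (auto simp: \<rho>2_def \<rho>3_def)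
  then have \<rho>: "0 < \<rho>" using \<rho>1 \<delta> by (simp add: \<rho>_def)
  have \<rho>_le: "\<rho> \<le> \<rho>1" "\<rho> \<le> 1" "\<rho> \<le> \<delta> / 2" "\<rho> \<le> \<rho>2" "\<rho> \<le> \<rho>3" by (simp_all add: \<rho>_def)
  have "L * \<rho> \<le> (L + 1) * \<rho>2" using \<rho>_le L \<rho> by (intro mult_mono) auto
  also have "\<dots> = k0 / 2" using L by (simp add: \<rho>2_def field_simps)
  finally have L\<rho>2: "L * \<rho> \<le> k0 / 2" .
  have "L * \<rho> * (norm T)\<^sup>2 \<le> (L + 1) * \<rho>3 * ((norm T)\<^sup>2 + 1)"
    using \<rho>_le L \<rho> pos23 by (intro mult_mono) auto
  also have "\<dots> = m0 / 2"
  proof -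
    have "V * (m0 / (2 * V * W)) * W = m0 / 2" if "0 < V" "0 < W" for V W :: real
      using that by (simp add: field_simps)
    from this[of "L + 1" "(norm T)\<^sup>2 + 1"] show ?thesis using L T1 by (simp only: \<rho>3_def)
  qed
  finally have L\<rho>3: "L * \<rho> * (norm T)\<^sup>2 \<le> m0 / 2" .
  have sub: "cball x0 \<rho> \<subseteq> cball x0 \<rho>1" using \<rho>_le by (simp add: subset_cball)
  have near: "\<bar>g q u v - g x0 u v\<bar> \<le> L * \<rho> * norm u * norm v" if q: "q \<in> cball x0 \<rho>" for q u v
  proof -
    have "norm (q - x0) \<le> \<rho>" using q by (simp add: dist_norm norm_minus_commute)
    then have "L * norm (q - x0) * norm u * norm v \<le> L * \<rho> * norm u * norm v"
      using L by (intro mult_right_mono mult_left_mono) auto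
    moreover have "x0 \<in> cball x0 \<rho>1" "q \<in> cball x0 \<rho>1" using \<rho>1 q sub by auto
    ultimately show ?thesis using lip[of q x0 u v] by linarith
  qed
  define k where "k = k0 / 2"
  have k: "0 < k" using k0 by (simp add: k_def)
  have pos: "k * (norm w)\<^sup>2 \<le> g q w w" if q: "q \<in> cball x0 \<rho>" and w: "a \<bullet> w = 0" for q w
  proof -
    have "L * \<rho> * norm w * norm w \<le> k0 / 2 * norm w * norm w"
      using L\<rho>2 by (intro mult_right_mono) auto
    then show ?thesis using near[OF q, of w w] k0(2)[OF w] by (simp add: k_def power2_eq_square)
  qed
  have T': "g q T T \<le> - (m0 / 2)" if q: "q \<in> cball x0 \<rho>" for q
    using near[OF q, of T T] L\<rho>3 by (simp add: m0_def power2_eq_square mult.assoc)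
  define N where "N = (\<Sum>b\<in>Basis. \<Sum>b'\<in>(Basis::'e set). \<bar>g x0 b b'\<bar>) + L"
  have N: "0 \<le> N" unfolding N_def using L by (intro add_nonneg_nonneg sum_nonneg) auto
  have bounded: "\<bar>g q u v\<bar> \<le> N * norm u * norm v" if q: "q \<in> cball x0 \<rho>" for q u v
  proof -
    have "L * \<rho> * norm u * norm v \<le> L * 1 * norm u * norm v"
      using \<rho>_le L by (intro mult_right_mono mult_left_mono) auto
    then show ?thesis
      using near[OF q, of u v] bilinear_bounded_by[OF bil[OF x0(1)] order_refl, of u v]
      by (simp add: N_def algebra_simps)
  qed
  \<comment> \<open>The bound supplied by \<open>quadratic_bound\<close> when the mixed term is
    controlled by \<open>N * norm T\<close> and the square of \<open>T\<close> by
    \<open>N * (norm T)\<^sup>2\<close>.\<close>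
  define R where "R = (2 * (N * norm T) + N * (norm T)\<^sup>2) / k + 1"
  have R: "1 \<le> R" using N k by (simp add: R_def)
  define C where "C = (norm T + R) / m0"
  have C: "0 < C" using R m0 by (auto simp: C_def intro!: divide_pos_pos add_nonneg_pos)
  have bil': "bilinear (g q)" and sym': "g q u v = g q v u" if "q \<in> cball x0 \<rho>" for q u v
    using that sub \<rho>1(2) by (intro bil sym; blast)+
  have causal_bound: "norm v \<le> C * (a \<bullet> v)"
    if q: "q \<in> cball x0 \<rho>" and v: "0 \<le> a \<bullet> v" "g q v v \<le> 0" for q v
  proof -
    \<comment> \<open>The vector is split into a multiple of \<open>T\<close> carrying all its
      height and a part \<open>w\<close> of height zero. There \<open>g q\<close> is definite, so
      \<open>g q v v \<le> 0\<close> bounds \<open>w\<close> by the coefficient \<alpha>.\<close>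
    define \<alpha> where "\<alpha> = (a \<bullet> v) / m0"
    define w where "w = v - \<alpha> *\<^sub>R T"
    have \<alpha>: "0 \<le> \<alpha>" using v m0 by (simp add: \<alpha>_def)
    have w: "a \<bullet> w = 0" using m0 by (simp add: w_def inner_diff_right aT \<alpha>_def)
    have vw: "v = \<alpha> *\<^sub>R T + w" by (simp add: w_def)
    have "g q v v = \<alpha>\<^sup>2 * g q T T + 2 * \<alpha> * g q T w + g q w w"
      unfolding vw using bil'[OF q] sym'[OF q, of w T]
      by (simp add: bilinear_ladd bilinear_radd bilinear_lmul bilinear_rmul power2_eq_square algebra_simps)
    then have "k * (norm w)\<^sup>2 \<le> - (\<alpha>\<^sup>2 * g q T T) - 2 * \<alpha> * g q T w" using pos[OF q w] v by linarith
    also have "\<dots> \<le> \<alpha>\<^sup>2 * \<bar>g q T T\<bar> + 2 * \<alpha> * \<bar>g q T w\<bar>"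
    proof -
      have "- (\<alpha>\<^sup>2 * g q T T) \<le> \<alpha>\<^sup>2 * \<bar>g q T T\<bar>" "- (2 * \<alpha> * g q T w) \<le> 2 * \<alpha> * \<bar>g q T w\<bar>"
        using \<alpha> mult_left_mono[of "- g q T T" "\<bar>g q T T\<bar>" "\<alpha>\<^sup>2"]
          mult_left_mono[of "- g q T w" "\<bar>g q T w\<bar>" "2 * \<alpha>"] by auto
      then show ?thesis by linarith
    qed
    also have "\<dots> \<le> \<alpha>\<^sup>2 * (N * norm T * norm T) + 2 * \<alpha> * (N * norm T * norm w)"
      using \<alpha> by (intro add_mono mult_left_mono bounded q) auto
    finally have "k * (norm w)\<^sup>2 \<le> 2 * \<alpha> * (N * norm T) * norm w + \<alpha>\<^sup>2 * (N * (norm T)\<^sup>2)"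
      by (simp add: power2_eq_square algebra_simps)
    then have "norm w \<le> \<alpha> * R"
      unfolding R_def using k N \<alpha> by (intro quadratic_bound) auto
    then have "norm v \<le> \<alpha> * norm T + \<alpha> * R"
      unfolding vw using \<alpha> by (intro order_trans[OF norm_triangle_ineq]) auto
    then show ?thesis by (simp add: C_def \<alpha>_def algebra_simps add_divide_distrib)
  qed
  have Tq: "0 < a \<bullet> tfield M c (\<psi> c q)" "g q (tfield M c (\<psi> c q)) (tfield M c (\<psi> c q)) < 0"
    if q: "q \<in> cball x0 \<rho>" for q
  proof -
    show "0 < a \<bullet> tfield M c (\<psi> c q)"
      using q \<rho>_le(3) \<rho> by (intro \<delta>(2)) (auto simp: dist_commute)
    have "q \<in> ?O" using q sub \<rho>1 by blast
    then show "g q (tfield M c (\<psi> c q)) (tfield M c (\<psi> c q)) < 0"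
      unfolding g_def by (intro tfield_timelike c \<psi>_mem)
  qed
  have future: "g q v (tfield M c (\<psi> c q)) < 0"
    if q: "q \<in> cball x0 \<rho>" and v: "g q v v \<le> 0" "0 < a \<bullet> v" for q v
  proof -
    let ?T = "tfield M c (\<psi> c q)"
    \<comment> \<open>Both heights are positive, so the inequality passes the sign of the two
      squares on to the mixed product.\<close>
    have "2 * (a \<bullet> v) * (a \<bullet> ?T) * g q v ?T \<le> (a \<bullet> ?T)\<^sup>2 * g q v v + (a \<bullet> v)\<^sup>2 * g q ?T ?T"
    proof (rule reverse_Cauchy_Schwarz[OF bil'[OF q] sym'[OF q]])
      show "0 \<le> g q w w" if "a \<bullet> w = 0" for w
        by (rule order_trans[OF _ pos[OF q that]]) (use k in simp)
    qed
    also have "\<dots> < 0" using v Tq[OF q] by (intro add_nonpos_neg) (auto simp: mult_nonneg_nonpos mult_pos_neg)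
    finally have "((a \<bullet> v) * (a \<bullet> ?T)) * g q v ?T < 0" by (simp add: mult.assoc)
    moreover have "0 < (a \<bullet> v) * (a \<bullet> ?T)" using v Tq[OF q] by simp
    ultimately show ?thesis by (meson linorder_not_less mult_nonneg_nonneg less_imp_le)
  qed
  have future_iff: "g q v (tfield M c (\<psi> c q)) < 0 \<longleftrightarrow> 0 < a \<bullet> v"
    if q: "q \<in> cball x0 \<rho>" and v: "v \<noteq> 0" "g q v v \<le> 0" for q v
  proof
    assume neg: "g q v (tfield M c (\<psi> c q)) < 0"
    have "a \<bullet> v \<noteq> 0"
    proof
      assume "a \<bullet> v = 0"
      then have "k * (norm v)\<^sup>2 \<le> 0" using pos[OF q] v by force
      then show False using k v by (simp add: mult_le_0_iff)
    qed
    moreover have "\<not> a \<bullet> v < 0"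
    proof
      assume "a \<bullet> v < 0"
      then have "g q (- v) (tfield M c (\<psi> c q)) < 0"
        using v bil'[OF q] by (intro future q) (auto simp: bilinear_lneg bilinear_rneg)
      then show False using neg bil'[OF q] by (simp add: bilinear_lneg)
    qed
    ultimately show "0 < a \<bullet> v" by linarith
  qed (use future[OF q] v in blast)
  have "lorentz_ball M r c x a T \<rho> L k C (m0 / 2)"
    apply unfold_locales
    unfolding x0_def[symmetric] g_def[symmetric]
    subgoal by (rule c)
    subgoal by (rule x)
    subgoal by (rule \<rho>)
    subgoal using sub \<rho>1 by blast
    subgoal using lip sub by blast
    subgoal by (rule L)
    subgoal by (rule pos)
    subgoal by (rule k)
    subgoal by (rule causal_bound)
    subgoal by (rule C)
    subgoal by (rule future_iff)
    subgoal by (rule T')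
    subgoal using m0 by simp
    subgoal using aT m0 by simp
    done
  then show ?thesis using that by blast
qed

section \<open>Openness of chronological pasts and the push-up property\<close>

text \<open>The intervals lie on one side of \<open>u\<close> because \<open>u\<close> itself may be
  a break point; \<open>d\<close> is small enough to exclude all the others.\<close>

lemma piecewise_curve_local:
  assumes pw: "piecewise_curve M K \<gamma>" and u: "u \<in> {0..1}" and U: "open U" "\<gamma> u \<in> U"
  obtains d where "0 < d" "\<And>s t. 0 \<le> s \<Longrightarrow> s < t \<Longrightarrow> t \<le> 1 \<Longrightarrow> u - d < s \<Longrightarrow> t < u + d \<Longrightarrow> t \<le> u \<or> u \<le> s \<Longrightarrow>
      C1_arc M K \<gamma> s t \<and> \<gamma> ` {s..t} \<subseteq> U"
proof -
  from pw obtain S where S: "path \<gamma>" "finite S"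
    "\<And>s t. 0 \<le> s \<Longrightarrow> s < t \<Longrightarrow> t \<le> 1 \<Longrightarrow> {s<..<t} \<inter> S = {} \<Longrightarrow> C1_arc M K \<gamma> s t"
    unfolding piecewise_curve_def by blast
  obtain d1 where d1: "0 < d1" "\<And>y. y \<in> S \<Longrightarrow> y \<noteq> u \<Longrightarrow> d1 \<le> dist u y"
    using finite_set_avoid[OF S(2)] by metis
  obtain A where A: "open A" "u \<in> A" "\<And>y. y \<in> {0..1} \<Longrightarrow> y \<in> A \<Longrightarrow> \<gamma> y \<in> U"
    using S(1) u U unfolding path_def continuous_on_topological by metis
  obtain d2 where d2: "0 < d2" "ball u d2 \<subseteq> A" using A open_contains_ball by blast
  show ?thesis
  proof (rule that[of "min d1 d2"])
    show "0 < min d1 d2" using d1 d2 by simp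
    fix s t assume st: "0 \<le> s" "s < t" "t \<le> 1" "u - min d1 d2 < s" "t < u + min d1 d2" "t \<le> u \<or> u \<le> s"
    have "y \<notin> S" if "s < y" "y < t" for y
      using d1(2)[of y] that st by (auto simp: dist_real_def)
    then have "C1_arc M K \<gamma> s t" using st by (intro S) auto
    moreover have "\<gamma> ` {s..t} \<subseteq> U"
    proof clarify
      fix y assume "y \<in> {s..t}"
      then show "\<gamma> y \<in> U" using d2 st by (intro A subsetD[OF d2(2)]) (auto simp: dist_real_def)
    qed
    ultimately show "C1_arc M K \<gamma> s t \<and> \<gamma> ` {s..t} \<subseteq> U" by blast
  qed
qed

context lorentz_ball
begin

abbreviation "x0 \<equiv> snd c x"
abbreviation "B \<equiv> cball x0 \<rho>"
abbreviation "g q \<equiv> metric M c (\<psi> c q)"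

definition chart_ball :: "real \<Rightarrow> 'a set" where
  "chart_ball e = fst c \<inter> snd c -` ball x0 e"

lemma open_chart_ball: "open (chart_ball e)"
  unfolding chart_ball_def
  by (intro continuous_open_preimage chart_continuous chart_open c open_ball)

lemma center_in_chart_ball: "0 < e \<Longrightarrow> x \<in> chart_ball e"
  using x by (simp add: chart_ball_def)

lemma B_image: "q \<in> B \<Longrightarrow> q \<in> snd c ` fst c"
  using ball_subset by blast

lemma center_in_B: "x0 \<in> B" using \<rho> by simp

lemma g_bilinear: "q \<in> B \<Longrightarrow> bilinear (g q)"
  and g_sym: "q \<in> B \<Longrightarrow> g q u v = g q v u"
  using metric_bilinear[OF c] metric_sym[OF c] \<psi>_mem[OF c B_image] by blast+

lemma g_change:
  assumes "q \<in> B" "q' \<in> B" shows "g q u v \<le> g q' u v + L * norm (q - q') * norm u * norm v"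
  using lipschitz[OF assms, of u v] by linarith

lemma timelike_iff:
  assumes "q \<in> B"
  shows "future_timelike M c (\<psi> c q) v \<longleftrightarrow> g q v v < 0 \<and> 0 < a \<bullet> v"
  using future_iff[OF assms, of v] bilinear_lzero[OF g_bilinear[OF assms]]
  by (cases "v = 0") (auto simp: future_timelike_def)

lemma causal_iff:
  assumes "q \<in> B"
  shows "future_causal M c (\<psi> c q) v \<longleftrightarrow> g q v v \<le> 0 \<and> 0 < a \<bullet> v"
  using future_iff[OF assms, of v]
  by (cases "v = 0") (auto simp: future_causal_def)

lemma chron_in_ball:
  assumes f: "\<And>u. u \<in> {s..t} \<Longrightarrow> f u \<in> B" and "continuous_on {s..t} w" "s < t"
    and "\<And>u. u \<in> {s..t} \<Longrightarrow> (f has_vector_derivative w u) (at u within {s..t})"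
    and w: "\<And>u. u \<in> {s..t} \<Longrightarrow> g (f u) (w u) (w u) < 0" "\<And>u. u \<in> {s..t} \<Longrightarrow> 0 < a \<bullet> w u"
  shows "chron M (\<psi> c (f s)) (\<psi> c (f t))"
  using assms B_image by (intro chron_in_chart[OF c, of f s t w]) (auto simp: timelike_iff)

lemma causal_in_ball:
  assumes f: "\<And>u. u \<in> {s..t} \<Longrightarrow> f u \<in> B" and "continuous_on {s..t} w" "s < t"
    and "\<And>u. u \<in> {s..t} \<Longrightarrow> (f has_vector_derivative w u) (at u within {s..t})"
    and w: "\<And>u. u \<in> {s..t} \<Longrightarrow> g (f u) (w u) (w u) \<le> 0" "\<And>u. u \<in> {s..t} \<Longrightarrow> 0 < a \<bullet> w u"
  shows "causal M (\<psi> c (f s)) (\<psi> c (f t))"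
  using assms B_image by (intro causal_in_chart[OF c, of f s t w]) (auto simp: causal_iff)

lemma chron_segment:
  assumes q: "q \<in> B" "q' \<in> B" and neg: "\<And>y. y \<in> closed_segment q q' \<Longrightarrow> g y (q' - q) (q' - q) < 0"
    and "0 < a \<bullet> (q' - q)"
  shows "chron M (\<psi> c q) (\<psi> c q')"
proof -
  let ?f = "\<lambda>u. q + u *\<^sub>R (q' - q)"
  have seg: "?f u \<in> closed_segment q q'" if "u \<in> {0..1}" for u
    using that by (auto simp: in_segment algebra_simps intro!: exI[of _ u])
  then have "?f u \<in> B" if "u \<in> {0..1}" for u
    using closed_segment_subset[OF q convex_cball] that by blast
  moreover have "(?f has_vector_derivative (q' - q)) (at u within {0..1})" for u
    by (auto intro!: derivative_eq_intros)
  ultimately have "chron M (\<psi> c (?f 0)) (\<psi> c (?f 1))"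
    using assms seg by (intro chron_in_ball[where w = "\<lambda>_. q' - q"]) auto
  then show ?thesis by simp
qed

lemma arc_in_chart_ball:
  assumes "C1_arc M K \<gamma> s t" and \<gamma>: "\<gamma> ` {s..t} \<subseteq> chart_ball e" and "e \<le> \<rho>"
  obtains w where "continuous_on {s..t} w"
    "\<And>u. u \<in> {s..t} \<Longrightarrow> ((\<lambda>u. snd c (\<gamma> u)) has_vector_derivative w u) (at u within {s..t})"
    "\<And>u. u \<in> {s..t} \<Longrightarrow> K c (\<psi> c (snd c (\<gamma> u))) (w u)"
    "\<And>u. u \<in> {s..t} \<Longrightarrow> snd c (\<gamma> u) \<in> ball x0 e" "\<And>u. u \<in> {s..t} \<Longrightarrow> snd c (\<gamma> u) \<in> B"
    "\<And>u. u \<in> {s..t} \<Longrightarrow> \<psi> c (snd c (\<gamma> u)) = \<gamma> u"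
proof -
  have \<gamma>': "\<gamma> u \<in> fst c" "snd c (\<gamma> u) \<in> ball x0 e" if "u \<in> {s..t}" for u
  proof -
    have "\<gamma> u \<in> chart_ball e" using \<gamma> that by blast
    then show "\<gamma> u \<in> fst c" "snd c (\<gamma> u) \<in> ball x0 e" by (auto simp: chart_ball_def)
  qed
  then have "\<gamma> ` {s..t} \<subseteq> fst c" by blast
  then obtain w where "continuous_on {s..t} w"
    "\<And>u. u \<in> {s..t} \<Longrightarrow> ((\<lambda>u. snd c (\<gamma> u)) has_vector_derivative w u) (at u within {s..t})"
    "\<And>u. u \<in> {s..t} \<Longrightarrow> K c (\<gamma> u) (w u)"
    using C1_arc_chartD[OF assms(1) c] by blast
  moreover have "\<psi> c (snd c (\<gamma> u)) = \<gamma> u" if "u \<in> {s..t}" for u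
    using \<gamma>'(1)[OF that] by (rule \<psi>_chart[OF c])
  moreover have "snd c (\<gamma> u) \<in> B" if "u \<in> {s..t}" for u
    using \<gamma>'(2)[OF that] \<open>e \<le> \<rho>\<close> by auto
  ultimately show ?thesis using \<gamma>' by (intro that[of w]) auto
qed

text \<open>A short chord of a timelike curve starting at \<open>x\<close> is almost parallel to the
  initial velocity, and it stays so when its initial point moves by little compared with its
  duration. A straight segment in such a direction is timelike, so nearby points precede a point of
  the given curve.\<close>

lemma past_nhds_center:
  assumes "chron M x y"
  obtains N where "open N" "x \<in> N" "\<And>p. p \<in> N \<Longrightarrow> chron M p y"
proof -
  obtain \<gamma> where \<gamma>: "piecewise_curve M (future_timelike M) \<gamma>" "\<gamma> 0 = x" "\<gamma> 1 = y"
    using assms unfolding chron_def pathstart_def pathfinish_def by blast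
  obtain d where d: "0 < d" "\<And>s t. 0 \<le> s \<Longrightarrow> s < t \<Longrightarrow> t \<le> 1 \<Longrightarrow> 0 - d < s \<Longrightarrow> t < 0 + d \<Longrightarrow> t \<le> 0 \<or> 0 \<le> s \<Longrightarrow>
      C1_arc M (future_timelike M) \<gamma> s t \<and> \<gamma> ` {s..t} \<subseteq> chart_ball \<rho>"
    by (rule piecewise_curve_local[OF \<gamma>(1), of 0 "chart_ball \<rho>"])
      (use open_chart_ball center_in_chart_ball[OF \<rho>] \<gamma>(2) in auto)
  define t1 where "t1 = min (d / 2) (1 / 2)"
  have t1: "0 < t1" "t1 < d" "t1 < 1" using d by (auto simp: t1_def)
  then have "C1_arc M (future_timelike M) \<gamma> 0 t1" "\<gamma> ` {0..t1} \<subseteq> chart_ball \<rho>"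
    using d(2)[of 0 t1] d(1) by auto
  then obtain w where w: "continuous_on {0..t1} w"
    "\<And>u. u \<in> {0..t1} \<Longrightarrow> ((\<lambda>u. snd c (\<gamma> u)) has_vector_derivative w u) (at u within {0..t1})"
    "\<And>u. u \<in> {0..t1} \<Longrightarrow> future_timelike M c (\<psi> c (snd c (\<gamma> u))) (w u)"
    "\<And>u. u \<in> {0..t1} \<Longrightarrow> snd c (\<gamma> u) \<in> ball x0 \<rho>" "\<And>u. u \<in> {0..t1} \<Longrightarrow> snd c (\<gamma> u) \<in> B"
    "\<And>u. u \<in> {0..t1} \<Longrightarrow> \<psi> c (snd c (\<gamma> u)) = \<gamma> u"
    by (rule arc_in_chart_ball) auto
  define f where "f u = snd c (\<gamma> u)" for u
  define v0 where "v0 = w 0"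
  have f0: "f 0 = x0" by (simp add: f_def \<gamma>)
  have v0: "g x0 v0 v0 < 0" "0 < a \<bullet> v0"
    using w(3)[of 0] t1 timelike_iff[OF center_in_B, of v0] by (auto simp: \<gamma> v0_def)
  \<comment> \<open>Half of the available margin. Directions close to \<open>v0\<close> keep
    \<open>g x0 v v < - \<eta>\<close>, and the radius \<open>e\<close> below is chosen so that
    moving the base point costs less than \<eta>.\<close>
  define \<eta> where "\<eta> = - g x0 v0 v0 / 2"
  have \<eta>: "0 < \<eta>" using v0 by (simp add: \<eta>_def)
  have "open {v. g x0 v v < - \<eta> \<and> 0 < a \<bullet> v}"
  proof -
    have "continuous_on UNIV (\<lambda>v. g x0 v v)"
      using bilinear_continuous_on_compose[OF continuous_on_id continuous_on_id g_bilinear[OF center_in_B]]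
      by simp
    then show ?thesis by (intro open_Collect_conj open_Collect_less continuous_intros)
  qed
  moreover have "v0 \<in> {v. g x0 v v < - \<eta> \<and> 0 < a \<bullet> v}" using v0 by (simp add: \<eta>_def)
  ultimately obtain \<epsilon>1 where \<epsilon>1: "0 < \<epsilon>1" "ball v0 \<epsilon>1 \<subseteq> {v. g x0 v v < - \<eta> \<and> 0 < a \<bullet> v}"
    using open_contains_ball by blast
  define \<epsilon> where "\<epsilon> = min \<epsilon>1 1"
  have \<epsilon>: "0 < \<epsilon>" "\<epsilon> \<le> 1" using \<epsilon>1 by (auto simp: \<epsilon>_def)
  have v: "g x0 v v < - \<eta>" "0 < a \<bullet> v" "norm v \<le> norm v0 + 1" if "dist v v0 < \<epsilon>" for v
  proof -
    have "v \<in> ball v0 \<epsilon>1" using that by (simp add: \<epsilon>_def dist_commute)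
    then show "g x0 v v < - \<eta>" "0 < a \<bullet> v" using \<epsilon>1 by blast+
    show "norm v \<le> norm v0 + 1" using that \<epsilon> norm_triangle_ineq2[of v v0] by (simp add: dist_norm)
  qed
  define N where "N = norm v0 + 1"
  have N: "0 < N" by (simp add: N_def add_nonneg_pos)
  define e where "e = min \<rho> (\<eta> / (L * N\<^sup>2 + 1))"
  have LN: "0 < L * N\<^sup>2 + 1" using L by (simp add: add_nonneg_pos)
  have e: "0 < e" "e \<le> \<rho>" using \<rho> \<eta> LN by (auto simp: e_def)
  have gneg: "g q v v < 0" if "dist v v0 < \<epsilon>" "q \<in> ball x0 e" for q v
  proof -
    have q: "q \<in> B" using that(2) e by simp
    have "norm (q - x0) \<le> e" using that(2) by (simp add: dist_norm norm_minus_commute)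
    then have "norm (q - x0) \<le> \<eta> / (L * N\<^sup>2 + 1)" by (simp add: e_def)
    then have "L * norm (q - x0) * norm v * norm v \<le> L * (\<eta> / (L * N\<^sup>2 + 1)) * N * N"
      using v(3)[OF that(1)] L \<eta> LN N by (intro mult_mono) (auto simp: N_def)
    also have "\<dots> = L * N\<^sup>2 * \<eta> / (L * N\<^sup>2 + 1)" by (simp add: power2_eq_square)
    also have "\<dots> < \<eta>" using LN \<eta> by (simp add: divide_simps algebra_simps)
    finally show ?thesis
      using g_change[OF q center_in_B, of v v] v(1)[OF that(1)] by linarith
  qed
  have "((\<lambda>y. (f y - f 0) /\<^sub>R (y - 0)) \<longlongrightarrow> v0) (at 0 within {0..t1})"
    using w(2)[of 0] t1 unfolding f_def v0_def by (subst has_vector_derivative_iff_quotient[symmetric]) auto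
  then have ev1: "\<forall>\<^sub>F y in at 0 within {0..t1}. dist ((f y - x0) /\<^sub>R y) v0 < \<epsilon> / 2"
    using tendstoD[of _ v0 _ "\<epsilon> / 2"] \<epsilon> f0 by simp
  have "(f \<longlongrightarrow> f 0) (at 0 within {0..t1})"
    using has_vector_derivative_continuous[OF w(2)[of 0]] t1 f_def[abs_def] by (auto simp: continuous_within)
  then have ev2: "\<forall>\<^sub>F y in at 0 within {0..t1}. dist (f y) x0 < e" using tendstoD e f0 by fastforce
  have "\<forall>\<^sub>F y in at 0 within {0..t1}. y \<in> {0..t1} \<and> y \<noteq> 0" by (simp add: eventually_at_filter)
  with ev1 ev2 have "\<forall>\<^sub>F y in at 0 within {0..t1}. dist ((f y - x0) /\<^sub>R y) v0 < \<epsilon> / 2 \<and> dist (f y) x0 < e \<and>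
      y \<in> {0..t1} \<and> y \<noteq> 0" by eventually_elim blast
  moreover have "at 0 within {0..t1} \<noteq> bot"
    using t1 by (simp add: trivial_limit_within islimpt_Icc)
  ultimately obtain t where t: "dist ((f t - x0) /\<^sub>R t) v0 < \<epsilon> / 2" "dist (f t) x0 < e" "t \<in> {0..t1}" "t \<noteq> 0"
    using eventually_happens by blast
  \<comment> \<open>Moving the initial point by less than \<open>t * (\<epsilon> / 2)\<close> turns
    the rescaled chord by less than \<open>\<epsilon> / 2\<close>; the other half is used by the
    deviation of the chord of \<open>f\<close> from \<open>v0\<close>.\<close>
  define e' where "e' = min e (t * (\<epsilon> / 2))"
  have e': "0 < e'" "e' \<le> e" using t \<epsilon> e by (auto simp: e'_def)
  show ?thesis
  proof (rule that[of "chart_ball e'"])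
    fix p assume p: "p \<in> chart_ball e'"
    define q where "q = snd c p"
    have q: "q \<in> ball x0 e'" "\<psi> c q = p" using p \<psi>_chart[OF c] by (auto simp: chart_ball_def q_def)
    define v where "v = (f t - q) /\<^sub>R t"
    have "dist v v0 \<le> dist v ((f t - x0) /\<^sub>R t) + dist ((f t - x0) /\<^sub>R t) v0" by (rule dist_triangle)
    also have "dist v ((f t - x0) /\<^sub>R t) = norm (q - x0) / t"
    proof -
      have "v - (f t - x0) /\<^sub>R t = (x0 - q) /\<^sub>R t" by (simp add: v_def scaleR_diff_right)
      then have "dist v ((f t - x0) /\<^sub>R t) = inverse t * norm (q - x0)"
        using t unfolding dist_norm by (simp add: norm_minus_commute[of x0 q])
      then show ?thesis by (simp add: divide_inverse mult.commute)
    qed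
    also have "\<dots> < \<epsilon> / 2"
    proof -
      have "norm (q - x0) < t * (\<epsilon> / 2)" using q(1) by (simp add: e'_def dist_norm norm_minus_commute)
      then show ?thesis using t by (simp add: field_simps)
    qed
    finally have vv0: "dist v v0 < \<epsilon>" using t(1) by linarith
    have ft: "f t \<in> ball x0 e" using t(2) by (simp add: dist_commute)
    have q': "q \<in> ball x0 e" using q(1) e' by simp
    have tv: "f t - q = t *\<^sub>R v" using t by (simp add: v_def)
    have "chron M (\<psi> c q) (\<psi> c (f t))"
    proof (rule chron_segment)
      show "q \<in> B" "f t \<in> B" using q' ft e by auto
      show "0 < a \<bullet> (f t - q)" using v(2)[OF vv0] t by (simp add: tv)
      fix y assume "y \<in> closed_segment q (f t)"
      then have y: "y \<in> ball x0 e" using closed_segment_subset[OF q' ft convex_ball] by blast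
      then have "y \<in> B" using e by simp
      then show "g y (f t - q) (f t - q) < 0"
        using gneg[OF vv0 y] t by (simp add: tv bilinear_lmul bilinear_rmul g_bilinear mult_less_0_iff)
    qed
    then have "chron M p (\<gamma> t)" using w(6)[of t] t by (simp add: q f_def)
    moreover have "chron M (\<gamma> t) (\<gamma> 1)"
      unfolding chron_eq using t t1 by (intro timelike.curve_rel_subcurve \<gamma>) auto
    ultimately show "chron M p y" using chron_trans \<gamma>(3) by blast
  qed (use open_chart_ball center_in_chart_ball e' in auto)
qed

end

lemma (in spacetime_manifold) open_I_minus: "open (I_minus M y)"
proof (rule open_subopen[THEN iffD2], intro ballI)
  fix p assume "p \<in> I_minus M y"
  then have p: "chron M p y" by (simp add: I_minus_def)
  obtain c a T \<rho> L k C m where "lorentz_ball M r c p a T \<rho> L k C m" by (rule ex_lorentz_ball)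
  then interpret lorentz_ball M r c p a T \<rho> L k C m .
  obtain N where "open N" "p \<in> N" "\<And>p. p \<in> N \<Longrightarrow> chron M p y" by (rule past_nhds_center[OF p]) blast
  then show "\<exists>N. open N \<and> p \<in> N \<and> N \<subseteq> I_minus M y" by (intro exI[of _ N]) (auto simp: I_minus_def)
qed

text \<open>The arc is displaced along \<open>T\<close>, with its start fixed and its end still in
  the open set \<open>I_minus M y\<close>. Moving the base point costs a term proportional to the
  displacement, while the additional velocity gains one proportional to the derivative of the
  displacement. With exponential growth at a large rate \<kappa> the gain wins, as in Gronwall's
  argument.\<close>

lemma (in lorentz_ball) push_up_arc:
  assumes arc: "C1_arc M (future_causal M) \<gamma> s t" and "s < t" and \<gamma>: "\<gamma> ` {s..t} \<subseteq> chart_ball (\<rho> / 2)"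
    and y: "chron M (\<gamma> t) y"
  shows "chron M (\<gamma> s) y"
proof -
  obtain w where w: "continuous_on {s..t} w"
    "\<And>u. u \<in> {s..t} \<Longrightarrow> ((\<lambda>u. snd c (\<gamma> u)) has_vector_derivative w u) (at u within {s..t})"
    "\<And>u. u \<in> {s..t} \<Longrightarrow> future_causal M c (\<psi> c (snd c (\<gamma> u))) (w u)"
    "\<And>u. u \<in> {s..t} \<Longrightarrow> snd c (\<gamma> u) \<in> ball x0 (\<rho> / 2)" "\<And>u. u \<in> {s..t} \<Longrightarrow> snd c (\<gamma> u) \<in> B"
    "\<And>u. u \<in> {s..t} \<Longrightarrow> \<psi> c (snd c (\<gamma> u)) = \<gamma> u"
    by (rule arc_in_chart_ball[OF arc \<gamma>]) (use \<rho> in auto)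
  define f where "f u = snd c (\<gamma> u)" for u
  note w = w[folded f_def]
  have wc: "g (f u) (w u) (w u) \<le> 0" "0 < a \<bullet> w u" "norm (w u) \<le> C * (a \<bullet> w u)" if u: "u \<in> {s..t}" for u
    using w(3)[OF u] causal_iff[OF w(5)[OF u]] causal_bound[OF w(5)[OF u], of "w u"] by auto
  have "compact ((\<lambda>u. a \<bullet> w u) ` {s..t})"
    by (intro compact_continuous_image continuous_intros w) simp
  then have "bounded ((\<lambda>u. a \<bullet> w u) ` {s..t})" by (rule compact_imp_bounded)
  then obtain W where "\<forall>y\<in>(\<lambda>u. a \<bullet> w u) ` {s..t}. norm y \<le> W"
    unfolding bounded_iff by blast
  then have W: "\<And>u. u \<in> {s..t} \<Longrightarrow> \<bar>a \<bullet> w u\<bar> \<le> W" by simp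
  have W0: "0 \<le> W" using W[of s] \<open>s < t\<close> by (auto intro: order_trans[OF abs_ge_zero])
  define \<mu> where "\<mu> = m / (2 * (a \<bullet> T))"
  have \<mu>: "0 < \<mu>" using m aT by (simp add: \<mu>_def)
  \<comment> \<open>Dividing the reverse Cauchy-Schwarz inequality by the positive height of
    \<open>w u\<close> leaves a bound that is linear in this height.\<close>
  have gT: "g (f u) (w u) T \<le> - \<mu> * (a \<bullet> w u)" if u: "u \<in> {s..t}" for u
  proof -
    have "2 * (a \<bullet> w u) * (a \<bullet> T) * g (f u) (w u) T \<le> (a \<bullet> T)\<^sup>2 * g (f u) (w u) (w u) + (a \<bullet> w u)\<^sup>2 * g (f u) T T"
    proof (rule reverse_Cauchy_Schwarz[OF g_bilinear g_sym])
      show "0 \<le> g (f u) w w" if "a \<bullet> w = 0" for w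
        by (rule order_trans[OF _ pos[OF w(5)[OF u] that]]) (use k in simp)
    qed (use w(5) u in auto)
    also have "\<dots> \<le> 0 + (a \<bullet> w u)\<^sup>2 * (- m)"
      using wc(1)[OF u] T[OF w(5)[OF u]] by (intro add_mono mult_left_mono) (auto simp: mult_nonneg_nonpos)
    finally have "(a \<bullet> w u) * (2 * (a \<bullet> T) * g (f u) (w u) T) \<le> (a \<bullet> w u) * (- m * (a \<bullet> w u))"
      by (simp add: power2_eq_square algebra_simps)
    then have "2 * (a \<bullet> T) * g (f u) (w u) T \<le> - m * (a \<bullet> w u)"
      using wc(2)[OF u] by (simp only: mult_le_cancel_left_pos)
    then show ?thesis using aT by (simp add: \<mu>_def field_simps)
  qed
  define n where "n = norm T"
  \<comment> \<open>The loss is quadratic in the height of \<open>w u\<close> and the gain only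
    linear, so the bound \<open>W\<close> on the heights enters the rate.\<close>
  define \<kappa> where "\<kappa> = L * n * C\<^sup>2 * W / \<mu> + 1"
  have n: "0 \<le> n" by (simp add: n_def)
  have \<kappa>: "1 \<le> \<kappa>" using L n C W0 \<mu> by (simp add: \<kappa>_def)
  have \<kappa>\<mu>: "L * n * C\<^sup>2 * W < \<kappa> * \<mu>" using \<mu> by (simp add: \<kappa>_def field_simps)
  \<comment> \<open>\<open>e s = 0\<close> fixes the starting point. The derivative is
    \<open>\<kappa> * (e u + 1)\<close>, and its summand \<kappa> makes the new curve strictly
    timelike even where \<open>e\<close> vanishes.\<close>
  define e where "e u = exp (\<kappa> * (u - s)) - 1" for u
  have e: "0 \<le> e u" "e u \<le> e t" if "u \<in> {s..t}" for u
    using that \<kappa> by (auto simp: e_def mult_left_mono)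
  have et: "0 \<le> e t" using e[of t] \<open>s < t\<close> by simp
  have "open (snd c ` fst c \<inter> \<psi> c -` (I_minus M y))"
    by (intro continuous_open_preimage \<psi>_continuous chart_image_open c open_I_minus)
  moreover have "f t \<in> snd c ` fst c \<inter> \<psi> c -` (I_minus M y)"
    using w(5,6)[of t] y \<open>s < t\<close> B_image by (auto simp: I_minus_def)
  ultimately obtain \<eta> where \<eta>: "0 < \<eta>" "ball (f t) \<eta> \<subseteq> snd c ` fst c \<inter> \<psi> c -` (I_minus M y)"
    using open_contains_ball by blast
  \<comment> \<open>A displacement below \<theta> keeps the curve in the ball and its end in the
    past of \<open>y\<close>, and preserves half of the bound \<mu> at the displaced points.\<close>
  define \<theta> where "\<theta> = Min {\<rho> / 2, \<eta>, \<mu> / (2 * (L * n * C + 1))}"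
  have LnC: "0 < L * n * C + 1" using L n C by (simp add: add_nonneg_pos)
  have \<theta>: "0 < \<theta>" "\<theta> \<le> \<rho> / 2" "\<theta> \<le> \<eta>" "\<theta> \<le> \<mu> / (2 * (L * n * C + 1))"
    subgoal using \<rho> \<eta> \<mu> LnC by (simp add: \<theta>_def)
    unfolding \<theta>_def by (rule Min_le; simp)+
  define \<epsilon> where "\<epsilon> = \<theta> / (2 * (e t * n + 1))"
  have etn: "0 < e t * n + 1" using et n by (simp add: add_nonneg_pos)
  have \<epsilon>: "0 < \<epsilon>" using \<theta> etn by (simp add: \<epsilon>_def)
  have \<epsilon>\<theta>: "\<epsilon> * e t * n < \<theta>"
  proof -
    have "\<epsilon> * e t * n \<le> \<epsilon> * (e t * n + 1)" using \<epsilon> by (simp add: algebra_simps)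
    also have "\<dots> = \<theta> / 2" using etn by (simp add: \<epsilon>_def field_simps)
    finally show ?thesis using \<theta> by linarith
  qed
  define F where "F u = f u + (\<epsilon> * e u) *\<^sub>R T" for u
  define w' where "w' u = w u + (\<epsilon> * (\<kappa> * (e u + 1))) *\<^sub>R T" for u
  have Ff: "norm (F u - f u) = \<epsilon> * e u * n" "norm (F u - f u) < \<theta>" if u: "u \<in> {s..t}" for u
  proof -
    show *: "norm (F u - f u) = \<epsilon> * e u * n" using e[OF u] \<epsilon> by (simp add: F_def n_def)
    have "\<epsilon> * e u * n \<le> \<epsilon> * e t * n" using e[OF u] \<epsilon> n by (intro mult_right_mono mult_left_mono) auto
    then show "norm (F u - f u) < \<theta>" using \<epsilon>\<theta> * by linarith
  qed
  have FB: "F u \<in> B" if u: "u \<in> {s..t}" for u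
  proof -
    have "norm (F u - x0) \<le> norm (F u - f u) + norm (f u - x0)" using norm_triangle_ineq[of "F u - f u" "f u - x0"] by simp
    moreover have "norm (f u - x0) < \<rho> / 2" using w(4)[OF u] by (simp add: dist_norm norm_minus_commute)
    ultimately show ?thesis using Ff[OF u] \<theta> by (simp add: dist_norm norm_minus_commute)
  qed
  have neg: "g (F u) (w' u) (w' u) < 0" if u: "u \<in> {s..t}" for u
  proof -
    define A where "A = a \<bullet> w u"
    define e' where "e' = \<kappa> * (e u + 1)"
    have A: "0 < A" "A \<le> W" using wc(2)[OF u] W[OF u] by (auto simp: A_def)
    have e': "0 < e'" using \<kappa> e[OF u] by (simp add: e'_def add_nonneg_pos)
    have 1: "g (F u) (w u) (w u) \<le> (\<epsilon> * A) * (L * n * C\<^sup>2 * W * e u)"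
    proof -
      have "g (F u) (w u) (w u) \<le> 0 + L * norm (F u - f u) * norm (w u) * norm (w u)"
        using g_change[OF FB[OF u] w(5)[OF u], of "w u" "w u"] wc(1)[OF u] by linarith
      also have "\<dots> \<le> L * norm (F u - f u) * (C * A) * (C * A)"
        using wc(3)[OF u] L C A by (simp only: add_0, intro mult_mono) (auto simp: A_def)
      also have "\<dots> = (L * n * C\<^sup>2 * e u * \<epsilon> * A) * A"
        using Ff(1)[OF u] by (simp add: power2_eq_square)
      also have "\<dots> \<le> (L * n * C\<^sup>2 * e u * \<epsilon> * A) * W"
        using L n C e[OF u] \<epsilon> A by (intro mult_left_mono) auto
      finally show ?thesis by (simp add: algebra_simps)
    qed
    have 2: "g (F u) (w u) T \<le> - (\<mu> / 2) * A"
    proof -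
      have "g (F u) (w u) T \<le> - \<mu> * A + L * norm (F u - f u) * norm (w u) * norm T"
        using g_change[OF FB[OF u] w(5)[OF u], of "w u" T] gT[OF u] by (simp add: A_def)
      moreover have "L * norm (F u - f u) * norm (w u) * norm T \<le> L * \<theta> * (C * A) * n"
        using wc(3)[OF u] L C A Ff(2)[OF u] n \<theta>(1) by (intro mult_mono) (auto simp: A_def n_def)
      moreover have "L * \<theta> * (C * A) * n \<le> (\<mu> / 2) * A"
      proof -
        have "(L * n * C) * \<theta> \<le> (L * n * C + 1) * (\<mu> / (2 * (L * n * C + 1)))"
          using \<theta> L n C by (intro mult_mono) auto
        also have "\<dots> = \<mu> / 2" using LnC by (simp add: field_simps)
        finally have "(L * n * C) * \<theta> * A \<le> \<mu> / 2 * A" using A by (intro mult_right_mono) auto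
        then show ?thesis by (simp add: algebra_simps)
      qed
      ultimately show ?thesis by (simp add: algebra_simps)
    qed
    have "g (F u) (w' u) (w' u) = g (F u) (w u) (w u) + 2 * (\<epsilon> * e') * g (F u) (w u) T + (\<epsilon> * e')\<^sup>2 * g (F u) T T"
      unfolding w'_def e'_def[symmetric] using g_bilinear[OF FB[OF u]] g_sym[OF FB[OF u], of T "w u"]
      by (simp add: bilinear_ladd bilinear_radd bilinear_lmul bilinear_rmul power2_eq_square algebra_simps)
    also have "\<dots> \<le> (\<epsilon> * A) * (L * n * C\<^sup>2 * W * e u) + 2 * (\<epsilon> * e') * (- (\<mu> / 2) * A) + 0"
    proof (intro add_mono mult_left_mono 1 2)
      show "(\<epsilon> * e')\<^sup>2 * g (F u) T T \<le> 0" using T[OF FB[OF u]] m by (simp add: mult_nonneg_nonpos)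
    qed (use \<epsilon> e' in auto)
    also have "\<dots> = (\<epsilon> * A) * (L * n * C\<^sup>2 * W * e u - e' * \<mu>)" by (simp add: algebra_simps)
    also have "\<dots> < 0"
    proof -
      have "L * n * C\<^sup>2 * W * e u \<le> \<kappa> * \<mu> * e u" using \<kappa>\<mu> e[OF u] by (intro mult_right_mono) auto
      also have "\<dots> < e' * \<mu>" using \<kappa> \<mu> by (simp add: e'_def algebra_simps)
      finally show ?thesis using \<epsilon> A by (simp add: mult_pos_neg)
    qed
    finally show ?thesis .
  qed
  have "chron M (\<psi> c (F s)) (\<psi> c (F t))"
  proof (rule chron_in_ball[where w = w'])
    show "continuous_on {s..t} w'" unfolding w'_def e_def by (intro continuous_intros w)
    show "(F has_vector_derivative w' u) (at u within {s..t})" if u: "u \<in> {s..t}" for u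
    proof -
      have ed: "(e has_real_derivative \<kappa> * (e u + 1)) (at u within {s..t})"
        unfolding e_def[abs_def] by (auto intro!: derivative_eq_intros)
      show ?thesis unfolding F_def w'_def
        by (auto intro!: derivative_eq_intros w(2)[OF u] ed)
    qed
    show "0 < a \<bullet> w' u" if u: "u \<in> {s..t}" for u
      unfolding w'_def using wc(2)[OF u] \<epsilon> \<kappa> e(1)[OF u] aT by (simp add: inner_add_right add_pos_nonneg)
  qed (use FB neg \<open>s < t\<close> in auto)
  moreover have "F s = f s" by (simp add: F_def e_def)
  moreover have "chron M (\<psi> c (F t)) y"
  proof -
    have "F t \<in> ball (f t) \<eta>" using Ff(2)[of t] \<theta> \<open>s < t\<close> by (simp add: dist_norm norm_minus_commute)
    then show ?thesis using \<eta> by (auto simp: I_minus_def)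
  qed
  ultimately show ?thesis using chron_trans w(6)[of s] \<open>s < t\<close> by auto
qed

text \<open>\<open>push_up_arc\<close> is local; bisection (\<open>Bolzano\<close>) extends the
  backward propagation of \<open>chron M _ y\<close> to the whole curve. Near \<open>u\<close> it is
  used on each side separately, as \<open>u\<close> may be a break point.\<close>

lemma (in spacetime_manifold) causal_chron:
  assumes "causal M p q" "chron M q y"
  shows "chron M p y"
proof (cases "p = q")
  case False
  then obtain \<gamma> where \<gamma>: "piecewise_curve M (future_causal M) \<gamma>" "\<gamma> 0 = p" "\<gamma> 1 = q"
    using assms unfolding causal_def pathstart_def pathfinish_def by blast
  define P where "P s t \<longleftrightarrow> (0 \<le> s \<and> t \<le> 1 \<longrightarrow> chron M (\<gamma> t) y \<longrightarrow> chron M (\<gamma> s) y)" for s t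
  have "P 0 1"
  proof (rule Bolzano)
    show "P s v" if "P s t" "P t v" "s \<le> t" "t \<le> v" for s t v
      using that unfolding P_def by auto
    fix u :: real assume u: "0 \<le> u" "u \<le> 1"
    obtain c a T \<rho> L k C m where "lorentz_ball M r c (\<gamma> u) a T \<rho> L k C m" by (rule ex_lorentz_ball)
    then interpret lorentz_ball M r c "\<gamma> u" a T \<rho> L k C m .
    obtain d where d: "0 < d" "\<And>s t. 0 \<le> s \<Longrightarrow> s < t \<Longrightarrow> t \<le> 1 \<Longrightarrow> u - d < s \<Longrightarrow> t < u + d \<Longrightarrow> t \<le> u \<or> u \<le> s \<Longrightarrow>
      C1_arc M (future_causal M) \<gamma> s t \<and> \<gamma> ` {s..t} \<subseteq> chart_ball (\<rho> / 2)"
      by (rule piecewise_curve_local[OF \<gamma>(1), of u "chart_ball (\<rho> / 2)"])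
        (use open_chart_ball center_in_chart_ball \<rho> u in auto)
    have "P s t" if st: "s \<le> u" "u \<le> t" "t - s < d" for s t
      unfolding P_def
    proof (intro impI)
      assume 01: "0 \<le> s \<and> t \<le> 1" and "chron M (\<gamma> t) y"
      then have "chron M (\<gamma> u) y"
        using d(2)[of u t] st 01 u push_up_arc[of \<gamma> u t y] by (cases "u = t") auto
      then show "chron M (\<gamma> s) y"
        using d(2)[of s u] st 01 u push_up_arc[of \<gamma> s u y] by (cases "u = s") auto
    qed
    then show "\<exists>d>0. \<forall>s t. s \<le> u \<and> u \<le> t \<and> t - s < d \<longrightarrow> P s t" using d(1) by blast
  qed simp
  then show ?thesis using \<gamma> assms by (simp add: P_def)
qed (use assms in simp)

section \<open>Time reversal\<close>

definition time_reverse ::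
  "('a::topological_space, 'e::euclidean_space) lorentz_manifold \<Rightarrow> ('a, 'e) lorentz_manifold" where
  "time_reverse M = M\<lparr>tfield := \<lambda>c p. - tfield M c p\<rparr>"

lemma time_reverse_simps [simp]:
  "charts (time_reverse M) = charts M" "metric (time_reverse M) = metric M"
  "tfield (time_reverse M) c p = - tfield M c p" "time_reverse (time_reverse M) = M"
  by (simp_all add: time_reverse_def)

context spacetime_manifold
begin

lemma spacetime_time_reverse: "spacetime r (time_reverse M)"
proof -
  have "lorentz_metric r (time_reverse M)"
    using spacetime by (simp add: spacetime_def lorentz_metric_def)
  moreover have "time_oriented (time_reverse M)"
    unfolding time_oriented_def
  proof (intro conjI ballI)
    fix c p assume "c \<in> charts (time_reverse M)" "p \<in> fst c"
    then show "metric (time_reverse M) c p (tfield (time_reverse M) c p) (tfield (time_reverse M) c p) < 0"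
      using tfield_timelike[of c p] by (simp add: bilinear_lneg bilinear_rneg metric_bilinear)
  next
    fix c d p assume *: "c \<in> charts (time_reverse M)" "d \<in> charts (time_reverse M)" "p \<in> fst c \<inter> fst d"
    then have "linear (jacobian c d p)"
      using transition_has_derivative_jacobian[of c d p] has_derivative_linear by auto
    then show "tfield (time_reverse M) d p = jacobian c d p (tfield (time_reverse M) c p)"
      using * tfield_jacobian[of c d p] by (simp add: linear_neg)
  next
    fix c assume "c \<in> charts (time_reverse M)"
    then show "continuous_on (fst c) (tfield (time_reverse M) c)"
      using continuous_on_minus[OF tfield_continuous[of c]] by (simp add: time_reverse_def)
  qed
  ultimately show ?thesis using spacetime by (simp add: spacetime_def)
qed

lemma chron_reverse:
  assumes "chron M p q" shows "chron (time_reverse M) q p"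
proof -
  \<comment> \<open>\<open>piecewise_curve\<close> depends on the manifold only through its charts,
    so the cone field of the reversed spacetime may be used with \<open>M\<close> itself.\<close>
  have "curve_rel M (future_timelike (time_reverse M)) q p"
    by (rule curve_rel_reverse[OF assms[unfolded chron_eq]])
      (auto simp: future_timelike_def bilinear_lneg bilinear_rneg metric_bilinear)
  then show ?thesis by (simp add: chron_def curve_rel_def piecewise_curve_def C1_arc_def)
qed

lemma causal_reverse:
  assumes "causal M p q" shows "causal (time_reverse M) q p"
proof (cases "p = q")
  case False
  then have "curve_rel M (future_causal M) p q" using assms by (simp add: causal_eq)
  then have "curve_rel M (future_causal (time_reverse M)) q p"
    by (rule curve_rel_reverse)
      (auto simp: future_causal_def bilinear_lneg bilinear_rneg metric_bilinear)
  then show ?thesis by (simp add: causal_def curve_rel_def piecewise_curve_def C1_arc_def)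
qed (simp add: causal_def)

end

lemma (in spacetime_manifold) reversed: "spacetime_manifold (time_reverse M) r"
  by unfold_locales (rule spacetime_time_reverse)

section \<open>Dual statements, chronological neighbours, and increments of piecewise curves\<close>

context spacetime_manifold
begin

lemma chron_time_reverse: "chron (time_reverse M) p q \<longleftrightarrow> chron M q p"
  using chron_reverse spacetime_manifold.chron_reverse[OF reversed] by force

lemma causal_time_reverse: "causal (time_reverse M) p q \<longleftrightarrow> causal M q p"
  using causal_reverse spacetime_manifold.causal_reverse[OF reversed] by force

lemma time_reverse_sets:
  "I_plus (time_reverse M) p = I_minus M p" "I_minus (time_reverse M) p = I_plus M p"
  "J_plus (time_reverse M) p = J_minus M p" "J_minus (time_reverse M) p = J_plus M p"
  "(p, q) \<in> J_rel (time_reverse M) \<longleftrightarrow> (q, p) \<in> J_rel M"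
  by (simp_all add: I_plus_def I_minus_def J_plus_def J_minus_def J_rel_def
      chron_time_reverse causal_time_reverse)

lemma open_I_plus: "open (I_plus M p)"
  using spacetime_manifold.open_I_minus[OF reversed] by (simp add: time_reverse_sets)

lemma I_plus_eq_of_causal_of_mem_closure:
  assumes xz: "causal M x z" and cl: "x \<in> closure (J_plus M z)"
  shows "I_plus M x = I_plus M z"
proof
  show "I_plus M z \<subseteq> I_plus M x" using causal_chron[OF xz] by (auto simp: I_plus_def)
  show "I_plus M x \<subseteq> I_plus M z"
  proof
    fix y assume "y \<in> I_plus M x"
    then have "x \<in> I_minus M y" by (simp add: I_plus_def I_minus_def)
    then obtain w where "w \<in> I_minus M y" "w \<in> J_plus M z"
      using cl open_I_minus[of y] by (auto simp: closure_iff_nhds_not_empty)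
    then show "y \<in> I_plus M z"
      using causal_chron by (auto simp: I_plus_def I_minus_def J_plus_def)
  qed
qed

lemma chron_between:
  assumes "chron M p q" obtains v where "chron M p v" "chron M v q"
proof -
  obtain \<gamma> where \<gamma>: "piecewise_curve M (future_timelike M) \<gamma>" "\<gamma> 0 = p" "\<gamma> 1 = q"
    using assms unfolding chron_def pathstart_def pathfinish_def by blast
  then show ?thesis
    using that[of "\<gamma> (1/2)"] timelike.curve_rel_subcurve[OF \<gamma>(1), of 0 "1/2"]
      timelike.curve_rel_subcurve[OF \<gamma>(1), of "1/2" 1] by (simp add: chron_eq)
qed

text \<open>The two points are obtained by shifting the coordinates of \<open>p\<close> by small
  multiples of \<open>T\<close> in both directions. That \<open>w\<close> differs from
  \<open>p\<close> is recorded because a closed timelike curve is later refuted by a second point on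
  it.\<close>

lemma chron_near:
  assumes N: "open N" "p \<in> N"
  obtains v w where "v \<in> N" "chron M p v" "w \<in> N" "w \<noteq> p" "chron M w p"
proof -
  obtain c a T \<rho> L k C m where "lorentz_ball M r c p a T \<rho> L k C m" by (rule ex_lorentz_ball)
  then interpret lorentz_ball M r c p a T \<rho> L k C m .
  have "open (snd c ` fst c \<inter> \<psi> c -` N)"
    by (intro continuous_open_preimage \<psi>_continuous chart_image_open c N)
  moreover have "x0 \<in> snd c ` fst c \<inter> \<psi> c -` N" using N x \<psi>_chart[OF c x] by simp
  ultimately obtain e where e: "0 < e" "ball x0 e \<subseteq> snd c ` fst c \<inter> \<psi> c -` N"
    using open_contains_ball by blast
  define t where "t = min e \<rho> / (2 * norm T)"
  have T0: "T \<noteq> 0" using aT by auto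
  then have t: "0 < t" using e \<rho> by (simp add: t_def)
  have tT: "norm (t *\<^sub>R T) < e" "norm (t *\<^sub>R T) < \<rho>" using e \<rho> T0 by (auto simp: t_def)
  have mem: "x0 + t *\<^sub>R T \<in> B" "x0 - t *\<^sub>R T \<in> B" using tT by (auto simp: dist_norm)
  have neg: "g y (t *\<^sub>R T) (t *\<^sub>R T) < 0" if "y \<in> B" for y
    using T[OF that] m t by (simp add: bilinear_lmul bilinear_rmul g_bilinear[OF that] mult_less_0_iff)
  have "chron M (\<psi> c x0) (\<psi> c (x0 + t *\<^sub>R T))" "chron M (\<psi> c (x0 - t *\<^sub>R T)) (\<psi> c x0)"
    using mem center_in_B closed_segment_subset[OF _ _ convex_cball, of x0 x0 \<rho> "x0 + t *\<^sub>R T"]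
      closed_segment_subset[OF _ _ convex_cball, of "x0 - t *\<^sub>R T" x0 \<rho> x0] neg t aT
    by (auto intro!: chron_segment)
  moreover have "\<psi> c (x0 + t *\<^sub>R T) \<in> N" "\<psi> c (x0 - t *\<^sub>R T) \<in> N"
    using tT e by (auto intro!: subsetD[OF e(2), THEN IntD2, unfolded vimage_eq] simp: dist_norm)
  moreover have "\<psi> c (x0 - t *\<^sub>R T) \<noteq> p"
  proof
    assume "\<psi> c (x0 - t *\<^sub>R T) = p"
    then have "x0 - t *\<^sub>R T = x0" using chart_\<psi>[OF c B_image[OF mem(2)]] by simp
    then show False using t T0 by simp
  qed
  ultimately show ?thesis using that \<psi>_chart[OF c x] by metis
qed

lemma mem_closure_I_plus: "p \<in> closure (I_plus M p)"
  unfolding closure_iff_nhds_not_empty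
proof (intro allI impI)
  fix A V assume "V \<subseteq> A" "open V" "p \<in> V"
  then obtain v where "v \<in> V" "chron M p v" using chron_near[of V p] by metis
  then show "I_plus M p \<inter> A \<noteq> {}" using \<open>V \<subseteq> A\<close> by (auto simp: I_plus_def)
qed

text \<open>A convex cone is closed under addition, so the increments over single arcs add up.
  Bisection replaces an enumeration of the break points.\<close>

lemma increment_in_cone_piecewise:
  assumes pw: "piecewise_curve M Kc \<gamma>" and st: "0 \<le> s" "s \<le> t" "t \<le> 1" and c: "c \<in> charts M"
    and \<gamma>: "\<gamma> ` {s..t} \<subseteq> fst c"
    and K: "convex K" "closed K" "\<And>k v. v \<in> K \<Longrightarrow> 0 \<le> k \<Longrightarrow> k *\<^sub>R v \<in> K" "0 \<in> K"
    and v: "\<And>u v. u \<in> {s..t} \<Longrightarrow> Kc c (\<gamma> u) v \<Longrightarrow> v \<in> K"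
  shows "snd c (\<gamma> t) - snd c (\<gamma> s) \<in> K"
proof -
  have add: "v + w \<in> K" if "v \<in> K" "w \<in> K" for v w
  proof -
    have "(1/2) *\<^sub>R v + (1/2) *\<^sub>R w \<in> K" using that K(1) by (intro convexD) auto
    then have "2 *\<^sub>R ((1/2) *\<^sub>R v + (1/2) *\<^sub>R w) \<in> K" by (intro K(3)) auto
    then show ?thesis by (simp add: scaleR_add_right)
  qed
  define P where "P s' t' \<longleftrightarrow> (s \<le> s' \<and> t' \<le> t \<longrightarrow> snd c (\<gamma> t') - snd c (\<gamma> s') \<in> K)" for s' t'
  have "P s t"
  proof (rule Bolzano)
    show "P s' v'" if "P s' t'" "P t' v'" "s' \<le> t'" "t' \<le> v'" for s' t' v'
      using that add[of "snd c (\<gamma> v') - snd c (\<gamma> t')" "snd c (\<gamma> t') - snd c (\<gamma> s')"] by (auto simp: P_def)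
    fix u assume u: "s \<le> u" "u \<le> t"
    obtain d where d: "0 < d" "\<And>s t. 0 \<le> s \<Longrightarrow> s < t \<Longrightarrow> t \<le> 1 \<Longrightarrow> u - d < s \<Longrightarrow> t < u + d \<Longrightarrow> t \<le> u \<or> u \<le> s \<Longrightarrow>
      C1_arc M Kc \<gamma> s t \<and> \<gamma> ` {s..t} \<subseteq> UNIV"
      by (rule piecewise_curve_local[OF pw, of u UNIV]) (use u st in auto)
    have arc: "snd c (\<gamma> t') - snd c (\<gamma> s') \<in> K"
      if "s \<le> s'" "s' < t'" "t' \<le> t" "u - d < s'" "t' < u + d" "t' \<le> u \<or> u \<le> s'" for s' t'
    proof -
      have sub: "{s'..t'} \<subseteq> {s..t}" using that by auto
      then have "\<gamma> ` {s'..t'} \<subseteq> fst c" using \<gamma> by blast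
      moreover have "C1_arc M Kc \<gamma> s' t'" using d(2)[of s' t'] that st by auto
      ultimately obtain w where "continuous_on {s'..t'} w"
        and w: "\<And>u. u \<in> {s'..t'} \<Longrightarrow> ((\<lambda>u. snd c (\<gamma> u)) has_vector_derivative w u) (at u within {s'..t'})"
          "\<And>u. u \<in> {s'..t'} \<Longrightarrow> Kc c (\<gamma> u) (w u)"
        using C1_arc_chartD[OF _ c] by blast
      show ?thesis
        by (rule increment_in_closed_convex_cone[OF K(1-3) \<open>s' < t'\<close> w(1)]) (use v w(2) sub in blast)+
    qed
    have "P s' t'" if st': "s' \<le> u" "u \<le> t'" "t' - s' < d" for s' t'
      unfolding P_def
    proof
      assume "s \<le> s' \<and> t' \<le> t"
      then have "snd c (\<gamma> t') - snd c (\<gamma> u) \<in> K" "snd c (\<gamma> u) - snd c (\<gamma> s') \<in> K"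
        using arc[of u t'] arc[of s' u] st' u K(4) by (cases "u = t'"; cases "u = s'"; auto)+
      then show "snd c (\<gamma> t') - snd c (\<gamma> s') \<in> K" using add by fastforce
    qed
    then show "\<exists>d>0. \<forall>s' t'. s' \<le> u \<and> u \<le> t' \<and> t' - s' < d \<longrightarrow> P s' t'" using d(1) by blast
  qed (use st in simp)
  then show ?thesis by (simp add: P_def)
qed

end

section \<open>Limits of timelike curves\<close>

context lorentz_ball
begin

definition chart_cball :: "'a set" where
  "chart_cball = fst c \<inter> snd c -` B"

text \<open>Both bounds come from closed convex cones containing all velocities. For the second one
  the metric is frozen at the end point and lowered by \<delta> times the squared height, where
  \<delta> dominates the variation of the metric along the curve. The displacement then lies in this
  wider cone, and since \<delta> is proportional to the height of the displacement, a third power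
  results.\<close>

lemma displacement:
  assumes pw: "piecewise_curve M (future_timelike M) \<gamma>" and st: "0 \<le> s" "s \<le> t" "t \<le> 1"
    and \<gamma>: "\<gamma> ` {s..t} \<subseteq> chart_cball"
  defines "D \<equiv> snd c (\<gamma> t) - snd c (\<gamma> s)"
  shows "norm D \<le> C * (a \<bullet> D)" "g (snd c (\<gamma> t)) D D \<le> L * C ^ 3 * (a \<bullet> D) ^ 3"
proof -
  define f where "f u = snd c (\<gamma> u)" for u
  have \<gamma>': "\<gamma> u \<in> fst c" "f u \<in> B" "\<psi> c (f u) = \<gamma> u" if "u \<in> {s..t}" for u
  proof -
    have "\<gamma> u \<in> chart_cball" using \<gamma> that by blast
    then show "\<gamma> u \<in> fst c" "f u \<in> B" "\<psi> c (f u) = \<gamma> u"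
      using \<psi>_chart[OF c] by (auto simp: chart_cball_def f_def)
  qed
  have v: "g (f u) v v < 0" "0 < a \<bullet> v" "norm v \<le> C * (a \<bullet> v)"
    if "u \<in> {s..t}" "future_timelike M c (\<gamma> u) v" for u v
    using timelike_iff[OF \<gamma>'(2)[OF that(1)], of v] causal_bound[OF \<gamma>'(2)[OF that(1)], of v] that \<gamma>'(3)[OF that(1)]
    by auto
  have inc: "norm (f u' - f u) \<le> C * (a \<bullet> (f u' - f u))" if u: "s \<le> u" "u \<le> u'" "u' \<le> t" for u u'
  proof -
    let ?K = "{v. norm v \<le> C * (a \<bullet> v)}"
    have "snd c (\<gamma> u') - snd c (\<gamma> u) \<in> ?K"
    proof (rule increment_in_cone_piecewise[OF pw _ _ _ c])
      show "convex ?K"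
      proof (rule convexI; clarify)
        fix v w :: 'e and p q :: real
        assume vw: "norm v \<le> C * (a \<bullet> v)" "norm w \<le> C * (a \<bullet> w)" and pq: "0 \<le> p" "0 \<le> q"
        have "norm (p *\<^sub>R v + q *\<^sub>R w) \<le> p * norm v + q * norm w"
          using pq by (intro order_trans[OF norm_triangle_ineq]) auto
        also have "\<dots> \<le> p * (C * (a \<bullet> v)) + q * (C * (a \<bullet> w))"
          using pq vw by (intro add_mono mult_left_mono)
        finally show "norm (p *\<^sub>R v + q *\<^sub>R w) \<le> C * (a \<bullet> (p *\<^sub>R v + q *\<^sub>R w))"
          by (simp add: inner_add_right algebra_simps)
      qed
      show "closed ?K" by (intro closed_Collect_le continuous_intros)
      show "k *\<^sub>R v \<in> ?K" if "v \<in> ?K" "0 \<le> k" for k v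
        using that mult_left_mono[of "norm v" "C * (a \<bullet> v)" k] by (simp add: algebra_simps)
      show "v \<in> ?K" if "u'' \<in> {u..u'}" "future_timelike M c (\<gamma> u'') v" for u'' v
        using v(3)[of u'' v] that u by auto
    qed (use \<gamma>'(1) u st in auto)
    then show ?thesis by (simp add: f_def)
  qed
  have D: "D = f t - f s" by (simp add: D_def f_def)
  show "norm D \<le> C * (a \<bullet> D)" unfolding D using inc st by simp
  define h where "h = a \<bullet> D"
  have mono: "0 \<le> a \<bullet> (f u' - f u)" if "s \<le> u" "u \<le> u'" "u' \<le> t" for u u'
    using order_trans[OF norm_ge_zero inc[OF that]] C by (simp add: zero_le_mult_iff)
  have h: "0 \<le> h" using mono st by (simp add: h_def D)
  define \<delta> where "\<delta> = L * C ^ 3 * h"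
  have \<delta>: "0 \<le> \<delta>" using L C h by (simp add: \<delta>_def)
  have ft: "f t \<in> B" using \<gamma>'(2) st by simp
  \<comment> \<open>The correction vanishes at height zero, so \<open>Q\<close> keeps the positivity
    there that makes \<open>solid_cone Q a\<close> convex.\<close>
  define Q where "Q v w = g (f t) v w - \<delta> * (a \<bullet> v) * (a \<bullet> w)" for v w
  have Q: "bilinear Q" "Q v w = Q w v" for v w
  proof -
    show "Q v w = Q w v" using g_sym[OF ft] by (simp add: Q_def)
    show "bilinear Q"
      using g_bilinear[OF ft] unfolding bilinear_def Q_def
      by (auto simp: linear_iff algebra_simps inner_simps)
  qed
  have Qpos: "0 < Q w w" if "a \<bullet> w = 0" "w \<noteq> 0" for w
  proof -
    have "0 < k * (norm w)\<^sup>2" using k that by simp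
    then show ?thesis using pos[OF ft that(1)] that by (simp add: Q_def)
  qed
  have "snd c (\<gamma> t) - snd c (\<gamma> s) \<in> solid_cone Q a"
  proof (rule increment_in_cone_piecewise[OF pw _ _ _ c])
    show "convex (solid_cone Q a)" by (rule solid_cone_convex[OF Q Qpos])
    show "closed (solid_cone Q a)" by (rule solid_cone_closed[OF Q(1)])
    show "k *\<^sub>R v \<in> solid_cone Q a" if "v \<in> solid_cone Q a" "0 \<le> k" for k v
      by (rule solid_cone_scaleR[OF Q(1) that])
    show "0 \<in> solid_cone Q a" using bilinear_lzero[OF Q(1)] by (simp add: solid_cone_def)
    fix u v assume u: "u \<in> {s..t}" and tv: "future_timelike M c (\<gamma> u) v"
    have "norm (f t - f u) \<le> C * h"
    proof -
      have "a \<bullet> (f t - f u) \<le> h" using mono[of s u] u by (simp add: h_def D inner_diff_right)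
      then show ?thesis using inc[of u t] u C by (auto intro: order_trans[OF _ mult_left_mono])
    qed
    then have "L * norm (f t - f u) * norm v * norm v \<le> L * (C * h) * (C * (a \<bullet> v)) * (C * (a \<bullet> v))"
      using v[OF u tv] L C h by (intro mult_mono) auto
    also have "\<dots> = \<delta> * (a \<bullet> v) * (a \<bullet> v)" by (simp add: \<delta>_def power3_eq_cube algebra_simps)
    finally have "g (f t) v v \<le> \<delta> * (a \<bullet> v) * (a \<bullet> v)"
      using g_change[OF ft \<gamma>'(2)[OF u], of v v] v(1)[OF u tv] by linarith
    then show "v \<in> solid_cone Q a" using v(2)[OF u tv] by (simp add: solid_cone_def Q_def)
  qed (use \<gamma>'(1) st in auto)
  then have "Q D D \<le> 0" by (simp add: solid_cone_def D_def)
  then show "g (snd c (\<gamma> t)) D D \<le> L * C ^ 3 * (a \<bullet> D) ^ 3"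
    by (simp add: Q_def \<delta>_def h_def f_def power3_eq_cube algebra_simps)
qed

text \<open>The parameter of \<open>F\<close> is the drop of \<open>inner a\<close> below the end point, so time runs backwards.\<close>

lemma final_segment:
  assumes "chron M z y" and z: "z \<notin> chart_ball \<rho>" and y: "y \<in> chart_ball (\<rho> / 2)"
  obtains F where "F 0 = snd c y"
    "\<And>s. s \<in> {0..\<rho> / (4 * C)} \<Longrightarrow> F s \<in> B"
    "\<And>s. s \<in> {0..\<rho> / (4 * C)} \<Longrightarrow> chron M z (\<psi> c (F s))"
    "\<And>s s'. 0 \<le> s \<Longrightarrow> s < s' \<Longrightarrow> s' \<le> \<rho> / (4 * C) \<Longrightarrow> chron M (\<psi> c (F s')) (\<psi> c (F s)) \<and>
       a \<bullet> (F s - F s') = s' - s \<and> norm (F s - F s') \<le> C * (s' - s) \<and>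
       g (F s) (F s - F s') (F s - F s') \<le> L * C ^ 3 * (s' - s) ^ 3"
proof -
  obtain \<gamma> where \<gamma>: "piecewise_curve M (future_timelike M) \<gamma>" "\<gamma> 0 = z" "\<gamma> 1 = y"
    using assms(1) unfolding chron_def pathstart_def pathfinish_def by blast
  have cont: "continuous_on {0..1} \<gamma>" using \<gamma>(1) by (simp add: piecewise_curve_def path_def)
  \<comment> \<open>The parameters at which the curve is outside the open ball; only the piece after
    the last of them is used.\<close>
  define A where "A = {0..1} \<inter> \<gamma> -` (- chart_ball \<rho>)"
  have "closed A" unfolding A_def
    by (intro continuous_closed_preimage cont) (use open_chart_ball in auto)
  then have A: "compact A" unfolding A_def using compact_Int_closed[OF compact_Icc, of A 0 1]
    by (simp add: A_def Int_absorb1)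
  have "0 \<in> A" using z \<gamma> by (simp add: A_def)
  then obtain u0 where u0: "u0 \<in> A" "\<And>u. u \<in> A \<Longrightarrow> u \<le> u0"
    using compact_attains_sup[OF A] by blast
  have y': "y \<in> chart_ball \<rho>" using y \<rho> by (auto simp: chart_ball_def)
  then have "u0 \<noteq> 1" using u0(1) \<gamma> by (auto simp: A_def)
  then have u01: "0 \<le> u0" "u0 < 1" using u0(1) by (auto simp: A_def)
  have in_ball: "\<gamma> u \<in> chart_ball \<rho>" if "u0 < u" "u \<le> 1" for u
    using u0(2)[of u] that u01 by (force simp: A_def)
  have in_cball: "\<gamma> u \<in> chart_cball" if u: "u \<in> {u0..1}" for u
  proof -
    have "compact (\<psi> c ` B)"
      by (intro compact_continuous_image continuous_on_subset[OF \<psi>_continuous[OF c]] compact_cball ball_subset)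
    then have "closed (\<psi> c ` B)" by (rule compact_imp_closed)
    moreover have "\<gamma> u \<in> \<psi> c ` B" if "u \<in> {u0<..1}" for u
    proof -
      have "\<gamma> u \<in> fst c" "snd c (\<gamma> u) \<in> B" using in_ball[of u] that by (auto simp: chart_ball_def)
      then show ?thesis using \<psi>_chart[OF c, of "\<gamma> u"] by (metis imageI)
    qed
    ultimately have "\<gamma> ` closure {u0<..1} \<subseteq> \<psi> c ` B"
      using u01 by (intro image_closure_subset continuous_on_subset[OF cont]) auto
    then have "\<gamma> u \<in> \<psi> c ` B" using u01 u by auto
    then show ?thesis using \<psi>_mem[OF c] chart_\<psi>[OF c] B_image by (auto simp: chart_cball_def)
  qed
  define f where "f u = snd c (\<gamma> u)" for u
  have f: "f u \<in> B" "\<psi> c (f u) = \<gamma> u" if "u \<in> {u0..1}" for u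
    using in_cball[OF that] \<psi>_chart[OF c] by (auto simp: chart_cball_def f_def)
  have contf: "continuous_on {u0..1} f"
    unfolding f_def using u01 in_cball
    by (intro continuous_on_compose2[OF chart_continuous[OF c] continuous_on_subset[OF cont]])
      (auto simp: chart_cball_def)
  have disp: "norm (f u' - f u) \<le> C * (a \<bullet> (f u' - f u))"
    "g (f u') (f u' - f u) (f u' - f u) \<le> L * C ^ 3 * (a \<bullet> (f u' - f u)) ^ 3"
    if "u0 \<le> u" "u \<le> u'" "u' \<le> 1" for u u'
  proof -
    have "\<gamma> ` {u..u'} \<subseteq> chart_cball" using in_cball that by (intro image_subsetI) auto
    then show "norm (f u' - f u) \<le> C * (a \<bullet> (f u' - f u))"
      "g (f u') (f u' - f u) (f u' - f u) \<le> L * C ^ 3 * (a \<bullet> (f u' - f u)) ^ 3"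
      using displacement[OF \<gamma>(1), of u u'] that u01 by (simp_all add: f_def)
  qed
  define \<tau> where "\<tau> u = a \<bullet> (f 1 - f u)" for u
  have mono: "\<tau> u' \<le> \<tau> u" if "u0 \<le> u" "u \<le> u'" "u' \<le> 1" for u u'
    using order_trans[OF norm_ge_zero disp(1)[OF that]] C by (simp add: zero_le_mult_iff \<tau>_def inner_diff_right)
  \<comment> \<open>From the sphere to the half ball the coordinates move by at least
    \<open>\<rho> / 2\<close>, so the height rises by at least \<open>\<rho> / (2 * C)\<close>.
    Using only half of this rise keeps the parameters strictly beyond \<open>u0\<close>, hence
    positive, so that a nontrivial timelike piece leads from \<open>z\<close> to each point.\<close>
  have "\<rho> / 2 \<le> norm (f 1 - f u0)"
  proof -
    have "f u0 \<notin> ball x0 \<rho>"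
      using u0(1) in_cball[of u0] u01 by (auto simp: A_def chart_ball_def chart_cball_def f_def)
    moreover have "f 1 \<in> ball x0 (\<rho> / 2)" using y \<gamma> by (simp add: chart_ball_def f_def)
    ultimately have "\<rho> \<le> norm (f u0 - x0)" "norm (f 1 - x0) \<le> \<rho> / 2" by (auto simp: dist_norm norm_minus_commute)
    then show ?thesis using norm_triangle_ineq2[of "f u0 - x0" "f 1 - x0"] by (simp add: norm_minus_commute)
  qed
  also have "\<dots> \<le> C * \<tau> u0" using disp(1)[of u0 1] u01 by (simp add: \<tau>_def)
  finally have "\<rho> / (2 * C) \<le> \<tau> u0" using C by (simp add: field_simps)
  moreover have "\<rho> / (4 * C) < \<rho> / (2 * C)" using C \<rho> by (simp add: field_simps)
  ultimately have \<tau>0: "\<rho> / (4 * C) < \<tau> u0" by linarith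
  have "\<exists>u. u0 < u \<and> u \<le> 1 \<and> \<tau> u = s" if s: "s \<in> {0..\<rho> / (4 * C)}" for s
  proof -
    have "\<exists>u. u0 \<le> u \<and> u \<le> 1 \<and> \<tau> u = s"
    proof (rule IVT2')
      show "\<tau> 1 \<le> s" "s \<le> \<tau> u0" using s \<tau>0 by (auto simp: \<tau>_def)
      show "continuous_on {u0..1} \<tau>" unfolding \<tau>_def by (intro continuous_intros contf)
    qed (use u01 in simp)
    then obtain u where "u0 \<le> u" "u \<le> 1" "\<tau> u = s" by blast
    moreover then have "u \<noteq> u0" using s \<tau>0 by auto
    ultimately show ?thesis by force
  qed
  then obtain U where U: "\<And>s. s \<in> {0..\<rho> / (4 * C)} \<Longrightarrow> u0 < U s \<and> U s \<le> 1 \<and> \<tau> (U s) = s" by metis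
  show ?thesis
  proof (rule that[of "\<lambda>s. f (U s)"])
    have "0 \<in> {0..\<rho> / (4 * C)}" using \<rho> C by simp
    \<comment> \<open>The choice \<open>U 0\<close> need not be 1, but a zero difference in height
      forces the same point.\<close>
    then have "norm (f 1 - f (U 0)) \<le> 0" using U[of 0] disp(1)[of "U 0" 1] by (simp add: \<tau>_def)
    then show "f (U 0) = snd c y" using \<gamma> by (simp add: f_def)
    show "f (U s) \<in> B" if "s \<in> {0..\<rho> / (4 * C)}" for s using f(1) U[OF that] by simp
    show "chron M z (\<psi> c (f (U s)))" if "s \<in> {0..\<rho> / (4 * C)}" for s
      using f(2)[of "U s"] U[OF that] timelike.curve_rel_subcurve[OF \<gamma>(1), of 0 "U s"] u01 \<gamma>
      by (simp add: chron_eq)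
    fix s s' assume s: "0 \<le> s" "s < s'" "s' \<le> \<rho> / (4 * C)"
    have U': "u0 < U s" "U s \<le> 1" "\<tau> (U s) = s" "u0 < U s'" "U s' \<le> 1" "\<tau> (U s') = s'"
      using U[of s] U[of s'] s by auto
    have less: "U s' < U s"
      using mono[of "U s" "U s'"] U' s by (intro ccontr[of "U s' < U s"]) (auto simp: not_less)
    have "chron M (\<psi> c (f (U s'))) (\<psi> c (f (U s)))"
      using f(2)[of "U s"] f(2)[of "U s'"] U' timelike.curve_rel_subcurve[OF \<gamma>(1), of "U s'" "U s"] less u01
      by (simp add: chron_eq)
    moreover have "a \<bullet> (f (U s) - f (U s')) = s' - s"
      using U'(3,6) by (simp add: \<tau>_def inner_diff_right)
    ultimately show "chron M (\<psi> c (f (U s'))) (\<psi> c (f (U s))) \<and>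
       a \<bullet> (f (U s) - f (U s')) = s' - s \<and> norm (f (U s) - f (U s')) \<le> C * (s' - s) \<and>
       g (f (U s)) (f (U s) - f (U s')) (f (U s) - f (U s')) \<le> L * C ^ 3 * (s' - s) ^ 3"
      using disp[of "U s'" "U s"] U' less by simp
  qed
qed

lemma \<psi>_tendsto:
  assumes "(X \<longlongrightarrow> q) G" "\<And>n. X n \<in> B" "q \<in> B"
  shows "((\<lambda>n. \<psi> c (X n)) \<longlongrightarrow> \<psi> c q) G"
  by (rule continuous_on_tendsto_compose[OF continuous_on_subset[OF \<psi>_continuous[OF c] ball_subset]])
    (use assms in auto)

text \<open>Joint continuity follows from the Lipschitz bound in the base point and the continuity
  of the quadratic form at a fixed base point.\<close>

lemma g_tendsto:
  assumes X: "(X \<longlongrightarrow> q) G" "\<And>n. X n \<in> B" "q \<in> B" and V: "(V \<longlongrightarrow> v) G"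
  shows "((\<lambda>n. g (X n) (V n) (V n)) \<longlongrightarrow> g q v v) G"
proof -
  have "isCont (\<lambda>v. g q v v) v"
    using bilinear_continuous_on_compose[OF continuous_on_id continuous_on_id g_bilinear[OF X(3)], of UNIV]
    by (simp add: continuous_on_eq_continuous_at)
  then have 1: "((\<lambda>n. g q (V n) (V n)) \<longlongrightarrow> g q v v) G" using V by (rule isCont_tendsto_compose)
  have "((\<lambda>n. g (X n) (V n) (V n) - g q (V n) (V n)) \<longlongrightarrow> 0) G"
  proof (rule Lim_null_comparison)
    show "\<forall>\<^sub>F n in G. norm (g (X n) (V n) (V n) - g q (V n) (V n)) \<le> L * norm (X n - q) * norm (V n) * norm (V n)"
      using lipschitz[OF X(2,3)] by (intro always_eventually) auto
    have "((\<lambda>n. L * norm (X n - q) * norm (V n) * norm (V n)) \<longlongrightarrow> L * norm (q - q) * norm v * norm v) G"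
      by (intro tendsto_intros X V)
    then show "((\<lambda>n. L * norm (X n - q) * norm (V n) * norm (V n)) \<longlongrightarrow> 0) G" by simp
  qed
  from tendsto_add[OF this 1] show ?thesis by simp
qed

text \<open>Chronological relations need not survive a limit, so the approximating curves
  \<open>G\<close> are returned together with \<open>F\<close>; only the equation for heights and
  the closed inequalities pass to \<open>F\<close>. The common Lipschitz constant \<open>C\<close>
  provides equicontinuity.\<close>

lemma limit_curve:
  assumes z: "z \<notin> chart_ball \<rho>" and cl: "x \<in> closure (I_plus M z)"
  obtains G F where
    "\<And>s. s \<in> {0..\<rho> / (4 * C)} \<Longrightarrow> (\<lambda>n. \<psi> c (G n s)) \<longlonglongrightarrow> \<psi> c (F s)"
    "\<And>n s. s \<in> {0..\<rho> / (4 * C)} \<Longrightarrow> chron M z (\<psi> c (G n s))"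
    "\<And>n s s'. 0 \<le> s \<Longrightarrow> s < s' \<Longrightarrow> s' \<le> \<rho> / (4 * C) \<Longrightarrow> chron M (\<psi> c (G n s')) (\<psi> c (G n s))"
    "F 0 = x0" "\<And>s. s \<in> {0..\<rho> / (4 * C)} \<Longrightarrow> F s \<in> B"
    "\<And>s s'. 0 \<le> s \<Longrightarrow> s < s' \<Longrightarrow> s' \<le> \<rho> / (4 * C) \<Longrightarrow> a \<bullet> (F s - F s') = s' - s \<and>
       norm (F s - F s') \<le> C * (s' - s) \<and> g (F s) (F s - F s') (F s - F s') \<le> L * C ^ 3 * (s' - s) ^ 3"
proof -
  define H where "H = \<rho> / (4 * C)"
  have H: "0 < H" using \<rho> C by (simp add: H_def)
  have "\<exists>y. chron M z y \<and> y \<in> chart_ball (\<rho> / 2) \<and> norm (snd c y - x0) < 1 / real (Suc n)" for n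
  proof -
    let ?e = "min (\<rho> / 2) (1 / real (Suc n))"
    have "x \<in> chart_ball ?e" using \<rho> by (intro center_in_chart_ball) simp
    then have "I_plus M z \<inter> chart_ball ?e \<noteq> {}"
      using cl open_chart_ball[of ?e] by (auto simp: closure_iff_nhds_not_empty)
    then show ?thesis by (auto simp: I_plus_def chart_ball_def dist_norm norm_minus_commute)
  qed
  then obtain Y where Y: "\<And>n. chron M z (Y n)" "\<And>n. Y n \<in> chart_ball (\<rho> / 2)"
    "\<And>n. norm (snd c (Y n) - x0) < 1 / real (Suc n)" by metis
  let ?P = "\<lambda>n F. F 0 = snd c (Y n) \<and> (\<forall>s. s \<in> {0..H} \<longrightarrow> F s \<in> B \<and> chron M z (\<psi> c (F s))) \<and>
    (\<forall>s s'. 0 \<le> s \<longrightarrow> s < s' \<longrightarrow> s' \<le> H \<longrightarrow> chron M (\<psi> c (F s')) (\<psi> c (F s)) \<and>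
       a \<bullet> (F s - F s') = s' - s \<and> norm (F s - F s') \<le> C * (s' - s) \<and>
       g (F s) (F s - F s') (F s - F s') \<le> L * C ^ 3 * (s' - s) ^ 3)"
  have "\<exists>F. ?P n F" for n
  proof (rule final_segment[OF Y(1) z Y(2), of n], goal_cases)
    case (1 F)
    show ?case unfolding H_def by (intro exI[of _ F] conjI allI impI 1; simp)
  qed
  then obtain G where G: "\<And>n. ?P n (G n)" by metis
  have GB: "G n s \<in> B" "chron M z (\<psi> c (G n s))" if "s \<in> {0..H}" for n s
    using G that by blast+
  have Gpair: "chron M (\<psi> c (G n s')) (\<psi> c (G n s)) \<and>
       a \<bullet> (G n s - G n s') = s' - s \<and> norm (G n s - G n s') \<le> C * (s' - s) \<and>
       g (G n s) (G n s - G n s') (G n s - G n s') \<le> L * C ^ 3 * (s' - s) ^ 3"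
    if "0 \<le> s" "s < s'" "s' \<le> H" for n s s'
    using G that by blast
  have lip: "norm (G n s - G n s') \<le> C * norm (s - s')" if "s \<in> {0..H}" "s' \<in> {0..H}" for n s s'
  proof (cases s s' rule: linorder_cases)
    case less
    then show ?thesis using Gpair[of s s' n] that by simp
  next
    case greater
    then show ?thesis using Gpair[of s' s n] that by (simp add: norm_minus_commute)
  qed simp
  have bnd: "norm (G n s) \<le> norm x0 + \<rho>" if "s \<in> {0..H}" for n s
    using GB(1)[OF that, of n] norm_triangle_ineq2[of "G n s" x0] by (auto simp: dist_norm norm_minus_commute)
  obtain F \<sigma> where F: "continuous_on {0..H} F" "strict_mono (\<sigma> :: nat \<Rightarrow> nat)"
    "\<And>e. 0 < e \<Longrightarrow> \<exists>N. \<forall>n s. n \<ge> N \<and> s \<in> {0..H} \<longrightarrow> norm (G (\<sigma> n) s - F s) < e"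
  proof (rule Arzela_Ascoli[of "{0..H}" G "norm x0 + \<rho>"])
    fix s e :: real assume s: "s \<in> {0..H}" and e: "0 < e"
    have "norm (G n s - G n s') < e" if "s' \<in> {0..H}" "norm (s - s') < e / C" for n s'
      using lip[OF s that(1), of n] that(2) C by (simp add: field_simps)
    then show "\<exists>d>0. \<forall>n y. y \<in> {0..H} \<and> norm (s - y) < d \<longrightarrow> norm (G n s - G n y) < e"
      using e C by (intro exI[of _ "e / C"]) auto
  qed (use bnd in auto)
  have lim: "(\<lambda>n. G (\<sigma> n) s) \<longlonglongrightarrow> F s" if "s \<in> {0..H}" for s
    using F(3) that by (intro LIMSEQ_I) blast
  have FB: "F s \<in> B" if s: "s \<in> {0..H}" for s
    by (rule closed_sequentially[OF closed_cball _ lim[OF s]]) (use GB s in blast)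
  show ?thesis
  proof (rule that[of "\<lambda>n. G (\<sigma> n)" F, folded H_def])
    show "(\<lambda>n. \<psi> c (G (\<sigma> n) s)) \<longlonglongrightarrow> \<psi> c (F s)" if "s \<in> {0..H}" for s
      by (rule \<psi>_tendsto[OF lim[OF that] _ FB[OF that]]) (use GB that in blast)
    show "F 0 = x0"
    proof (rule LIMSEQ_unique)
      show "(\<lambda>n. G (\<sigma> n) 0) \<longlonglongrightarrow> F 0" using lim H by simp
      have "(\<lambda>n. snd c (Y n)) \<longlonglongrightarrow> x0"
        by (rule LIM_zero_cancel, rule Lim_null_comparison[OF _ LIMSEQ_inverse_real_of_nat])
          (use Y(3) in \<open>auto intro!: always_eventually less_imp_le simp: inverse_eq_divide\<close>)
      then have "(\<lambda>n. snd c (Y (\<sigma> n))) \<longlonglongrightarrow> x0" using LIMSEQ_subseq_LIMSEQ[OF _ F(2)] by (auto simp: o_def)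
      then show "(\<lambda>n. G (\<sigma> n) 0) \<longlonglongrightarrow> x0" using G by simp
    qed
    fix s s' assume s: "0 \<le> s" "s < s'" "s' \<le> H"
    have lD: "(\<lambda>n. G (\<sigma> n) s - G (\<sigma> n) s') \<longlonglongrightarrow> F s - F s'" using s by (intro tendsto_intros lim) auto
    have Gs: "a \<bullet> (G n s - G n s') = s' - s" "norm (G n s - G n s') \<le> C * (s' - s)"
      "g (G n s) (G n s - G n s') (G n s - G n s') \<le> L * C ^ 3 * (s' - s) ^ 3" "G n s \<in> B" for n
      using Gpair[OF s, of n] GB(1)[of s n] s by auto
    have "(\<lambda>n. a \<bullet> (G (\<sigma> n) s - G (\<sigma> n) s')) \<longlonglongrightarrow> a \<bullet> (F s - F s')" by (intro tendsto_intros lD)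
    then have "a \<bullet> (F s - F s') = s' - s" using Gs(1) by (simp add: LIMSEQ_const_iff)
    moreover have "norm (F s - F s') \<le> C * (s' - s)"
      by (rule tendsto_upperbound[OF tendsto_norm[OF lD]]) (use Gs(2) in auto)
    moreover have "g (F s) (F s - F s') (F s - F s') \<le> L * C ^ 3 * (s' - s) ^ 3"
      by (rule tendsto_upperbound[OF g_tendsto[OF lim _ FB lD]]) (use Gs s in auto)
    ultimately show "a \<bullet> (F s - F s') = s' - s \<and>
       norm (F s - F s') \<le> C * (s' - s) \<and> g (F s) (F s - F s') (F s - F s') \<le> L * C ^ 3 * (s' - s) ^ 3"
      by blast
  qed (use Gpair GB FB in auto)
qed

end

section \<open>Achronality of limits\<close>

context spacetime_manifold
begin

text \<open>Take \<open>v\<close> chronologically between \<open>p\<close> and \<open>q\<close>.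
  Openness gives \<open>chron M z v\<close>, hence \<open>chron M x v\<close>, and places
  \<open>Y n\<close> in the future of \<open>v\<close> for large \<open>n\<close>, so
  \<open>x\<close> is in the closure of \<open>J_plus M v\<close>. The closure condition forces
  \<open>x = v\<close>, a closed timelike curve through \<open>x\<close>, and a second point on such
  a curve violates the same condition. The disjunction admits the case in which \<open>q\<close> is
  the end point \<open>x\<close> itself.\<close>

lemma limits_not_chron:
  assumes P: "\<And>p q. causal M p q \<Longrightarrow> p \<in> closure (J_plus M q) \<Longrightarrow> p = q"
    and xz: "I_plus M x = I_plus M z"
    and lim: "P \<longlonglongrightarrow> p" "Q \<longlonglongrightarrow> q" "Y \<longlonglongrightarrow> x"
    and PQ: "\<And>n. chron M z (P n)" "\<And>n. Q n = Y n \<or> chron M (Q n) (Y n)"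
  shows "\<not> chron M p q"
proof
  assume "chron M p q"
  then obtain v where v: "chron M p v" "chron M v q" by (rule chron_between)
  have J: "I_plus M w \<subseteq> J_plus M w" for w
    using chron_imp_causal by (auto simp: I_plus_def J_plus_def)
  have "\<forall>\<^sub>F n in sequentially. P n \<in> I_minus M v"
    using v(1) by (intro topological_tendstoD[OF lim(1) open_I_minus]) (simp add: I_minus_def)
  then obtain n where "P n \<in> I_minus M v" using eventually_happens' trivial_limit_sequentially by blast
  then have "v \<in> I_plus M z" using PQ(1) chron_trans by (auto simp: I_minus_def I_plus_def)
  then have "v \<in> I_plus M x" using xz by simp
  then have xv: "chron M x v" by (simp add: I_plus_def)
  have "\<forall>\<^sub>F n in sequentially. Q n \<in> I_plus M v"
    using v(2) by (intro topological_tendstoD[OF lim(2) open_I_plus]) (simp add: I_plus_def)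
  then have "\<forall>\<^sub>F n in sequentially. Y n \<in> closure (J_plus M v)"
  proof eventually_elim
    case (elim n)
    then have "Y n \<in> I_plus M v" using PQ(2)[of n] chron_trans by (auto simp: I_plus_def)
    then show ?case using J closure_subset by blast
  qed
  then have "x \<in> closure (J_plus M v)"
    by (rule Lim_in_closed_set[OF closed_closure _ trivial_limit_sequentially lim(3)])
  then have "x = v" using P xv chron_imp_causal by blast
  then have "open (I_plus M x)" "x \<in> I_plus M x" using xv open_I_plus by (auto simp: I_plus_def)
  then obtain w where "w \<in> I_plus M x" "w \<noteq> x" "chron M w x" using chron_near by metis
  then show False using P[of w x] chron_imp_causal J closure_subset by blast
qed

end

section \<open>Regularity of an achronal limit curve\<close>

context lorentz_ball
begin

lemma achronal_curve_end:
  assumes "0 < H"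
    and FB: "\<And>s. s \<in> {0..2 * H} \<Longrightarrow> F s \<in> B"
    and F: "\<And>s s'. 0 \<le> s \<Longrightarrow> s < s' \<Longrightarrow> s' \<le> 2 * H \<Longrightarrow> a \<bullet> (F s - F s') = s' - s \<and>
       norm (F s - F s') \<le> C * (s' - s) \<and> g (F s) (F s - F s') (F s - F s') \<le> L * C ^ 3 * (s' - s) ^ 3"
    and achronal: "\<And>s s'. 0 \<le> s \<Longrightarrow> s < s' \<Longrightarrow> s' \<le> 2 * H \<Longrightarrow> \<not> chron M (\<psi> c (F s')) (\<psi> c (F s))"
  shows "causal M (\<psi> c (F H)) (\<psi> c (F 0))"
proof -
  define E where "E = L * C ^ 3"
  have E: "0 \<le> E" using L C by (simp add: E_def)
  have aF: "a \<bullet> (F s - F s') = s' - s" and nF: "norm (F s - F s') \<le> C * (s' - s)"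
    and gF: "g (F s) (F s - F s') (F s - F s') \<le> E * (s' - s) ^ 3"
    if "0 \<le> s" "s < s'" "s' \<le> 2 * H" for s s'
    using F[OF that] by (simp_all add: E_def)
  \<comment> \<open>The cost of moving the base point of the metric by at most \<open>C * h\<close>
    in a square of a chord of duration \<open>h\<close>.\<close>
  have err: "L * norm p * norm v * norm v \<le> E * h ^ 3"
    if "norm p \<le> C * h" "norm v \<le> C * h" "0 \<le> h" for p v :: 'e and h
  proof -
    have "L * norm p * norm v * norm v \<le> L * (C * h) * (C * h) * (C * h)"
      using that L C by (intro mult_mono) auto
    then show ?thesis by (simp add: E_def power3_eq_cube algebra_simps)
  qed
  have gF': "g (F s') (F s - F s') (F s - F s') \<le> 2 * E * (s' - s) ^ 3" if s: "0 \<le> s" "s < s'" "s' \<le> 2 * H" for s s'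
    using g_change[OF FB FB, of s' s "F s - F s'" "F s - F s'"] gF[OF s] s nF[OF s]
      err[of "F s' - F s" "s' - s" "F s - F s'"] by (simp add: norm_minus_commute)
  \<comment> \<open>Below this value the square of the chord would stay negative along the entire
    straight segment, because the base point moves by at most \<open>C * (s' - s)\<close>; the
    segment would be timelike.\<close>
  have lower: "- (E * (s' - s) ^ 3) \<le> g (F s) (F s - F s') (F s - F s')" if s: "0 \<le> s" "s < s'" "s' \<le> 2 * H" for s s'
  proof (rule ccontr)
    assume neg: "\<not> ?thesis"
    have "chron M (\<psi> c (F s')) (\<psi> c (F s))"
    proof (rule chron_segment)
      show mem: "F s' \<in> B" "F s \<in> B" using FB s by auto
      show "0 < a \<bullet> (F s - F s')" using aF[OF s] s by simp
      fix y assume y: "y \<in> closed_segment (F s') (F s)"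
      then have "y \<in> B" using closed_segment_subset[OF mem convex_cball] by blast
      moreover have "norm (y - F s) \<le> C * (s' - s)" using segment_bound(2)[OF y] nF[OF s] by simp
      ultimately show "g y (F s - F s') (F s - F s') < 0"
        using g_change[OF _ mem(2), of y "F s - F s'" "F s - F s'"] err[of "y - F s" "s' - s" "F s - F s'"]
          nF[OF s] s neg by linarith
    qed
    then show False using achronal[OF s] by blast
  qed
  \<comment> \<open>14 = 2 * 1 + 2 * 2 + 8: the squares of the two chords at the common base point
    \<open>F s\<close> are bounded by 1 and 2 times \<open>E * h ^ 3\<close>, and that of their sum,
    of duration 2 h, from below by -8 times it.\<close>
  define A where "A = sqrt (14 * E / k)"
  have second: "norm (F s - 2 *\<^sub>R F (s + h) + F (s + 2 * h)) \<le> A * h * sqrt h"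
    if s: "0 \<le> s" "0 < h" "s + 2 * h \<le> 2 * H" for s h
  proof -
    define D1 D2 where "D1 = F s - F (s + h)" and "D2 = F (s + h) - F (s + 2 * h)"
    have sB: "F s \<in> B" "F (s + h) \<in> B" using s FB by auto
    have 1: "g (F s) D1 D1 \<le> E * h ^ 3" using gF[of s "s + h"] s by (simp add: D1_def)
    have 2: "g (F s) D2 D2 \<le> 2 * (E * h ^ 3)"
      using g_change[OF sB, of D2 D2] gF[of "s + h" "s + 2 * h"] s nF[of "s + h" "s + 2 * h"] nF[of s "s + h"]
        err[of "F s - F (s + h)" h D2] by (simp add: D2_def)
    have 3: "- (8 * (E * h ^ 3)) \<le> g (F s) (D1 + D2) (D1 + D2)"
      using lower[of s "s + 2 * h"] s by (simp add: D1_def D2_def power_mult_distrib)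
    have w: "F s - 2 *\<^sub>R F (s + h) + F (s + 2 * h) = D1 - D2" by (simp add: D1_def D2_def scaleR_2)
    have "a \<bullet> (D1 - D2) = 0"
      using aF[of s "s + h"] aF[of "s + h" "s + 2 * h"] s unfolding D1_def D2_def by (simp add: inner_diff_right)
    then have "k * (norm (D1 - D2))\<^sup>2 \<le> g (F s) (D1 - D2) (D1 - D2)" by (rule pos[OF sB(1)])
    also have "\<dots> = 2 * g (F s) D1 D1 + 2 * g (F s) D2 D2 - g (F s) (D1 + D2) (D1 + D2)"
      using g_bilinear[OF sB(1)]
      by (simp add: bilinear_ladd bilinear_radd bilinear_lsub bilinear_rsub)
    also have "\<dots> \<le> 14 * (E * h ^ 3)" using 1 2 3 by linarith
    finally have "(norm (D1 - D2))\<^sup>2 \<le> 14 * E / k * h ^ 3" using k by (simp add: field_simps)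
    also have "\<dots> = (A * h * sqrt h)\<^sup>2"
    proof -
      have "A\<^sup>2 = 14 * E / k" "(sqrt h)\<^sup>2 = h" using E k s by (auto simp: A_def)
      then show ?thesis unfolding power_mult_distrib by (simp add: power3_eq_cube power2_eq_square)
    qed
    finally have sq: "(norm (D1 - D2))\<^sup>2 \<le> (A * h * sqrt h)\<^sup>2" .
    show ?thesis
    proof -
      have "0 \<le> A * h * sqrt h" using E k s by (simp add: A_def)
      then show ?thesis unfolding w by (rule power2_le_imp_le[OF sq])
    qed
  qed
  have "C-lipschitz_on {0..2 * H} F"
  proof (rule lipschitz_onI)
    fix s s' assume "s \<in> {0..2 * H}" "s' \<in> {0..2 * H}"
    then show "dist (F s) (F s') \<le> C * dist s s'"
      using nF[of s s'] nF[of s' s] by (cases s s' rule: linorder_cases) (auto simp: dist_norm norm_minus_commute)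
  qed (use C in simp)
  then have "continuous_on {0..2 * H} F" by (rule lipschitz_on_continuous_on)
  then obtain v where contv: "continuous_on {0..H} v"
    and v: "\<And>s. s \<in> {0..H} \<Longrightarrow> (F has_vector_derivative v s) (at s within {0..H})"
    using C1_if_small_second_differences[OF \<open>0 < H\<close> _ second] by blast
  \<comment> \<open>Dividing the cubic bound by the squared duration leaves a factor tending to
    zero, so limits of chords are causal. Their height is -1 because the parameter of
    \<open>F\<close> is the drop in height; in particular the velocity never vanishes.\<close>
  have v_causal: "g (F s) (v s) (v s) \<le> 0" "a \<bullet> v s = -1" if s: "s \<in> {0..H}" for s
  proof -
    let ?V = "\<lambda>y. (F y - F s) /\<^sub>R (y - s)"
    let ?G = "at s within {0..H}"
    have nontriv: "?G \<noteq> bot" using s \<open>0 < H\<close> by (simp add: trivial_limit_within islimpt_Icc)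
    have V: "(?V \<longlongrightarrow> v s) ?G" using v[OF s] by (simp add: has_vector_derivative_iff_quotient)
    have sB: "F s \<in> B" using s FB \<open>0 < H\<close> by auto
    have est: "g (F s) (?V y) (?V y) \<le> 2 * E * \<bar>y - s\<bar>" "a \<bullet> ?V y = -1" if y: "y \<in> {0..H}" "y \<noteq> s" for y
    proof -
      have y2: "y \<le> 2 * H" "s \<le> 2 * H" using y s \<open>0 < H\<close> by auto
      have "g (F s) (?V y) (?V y) = g (F s) (F y - F s) (F y - F s) / (y - s)\<^sup>2"
        by (simp add: bilinear_lmul bilinear_rmul g_bilinear[OF sB] power2_eq_square divide_inverse)
      also have "\<dots> \<le> 2 * E * \<bar>y - s\<bar> ^ 3 / (y - s)\<^sup>2"
      proof (intro divide_right_mono)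
        show "g (F s) (F y - F s) (F y - F s) \<le> 2 * E * \<bar>y - s\<bar> ^ 3"
        proof (cases "y < s")
          case True
          then show ?thesis using gF'[of y s] y s y2 by simp
        next
          case False
          then have "s < y" using y by simp
          moreover have "g (F s) (F y - F s) (F y - F s) = g (F s) (F s - F y) (F s - F y)"
            using g_bilinear[OF sB] by (simp add: bilinear_lsub bilinear_rsub)
          moreover have "0 \<le> E * (y - s) ^ 3" using E \<open>s < y\<close> by simp
          ultimately show ?thesis using gF[of s y] y s y2 by simp
        qed
      qed simp
      also have "\<dots> = 2 * E * \<bar>y - s\<bar>"
      proof -
        have "\<bar>y - s\<bar> ^ 3 = \<bar>y - s\<bar> * (y - s)\<^sup>2" by (simp add: power3_eq_cube power2_eq_square)
        then show ?thesis using y by simp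
      qed
      finally show "g (F s) (?V y) (?V y) \<le> 2 * E * \<bar>y - s\<bar>" .
      have "a \<bullet> (F y - F s) = s - y"
        using aF[of y s] aF[of s y] y s y2 by (cases "y < s") (auto simp: inner_diff_right)
      then have "a \<bullet> ?V y = inverse (y - s) * (s - y)" by (simp only: inner_scaleR_right)
      moreover have "inverse (y - s) * (s - y) = -1" using y by (simp add: divide_simps)
      ultimately show "a \<bullet> ?V y = -1" by simp
    qed
    have ev: "\<forall>\<^sub>F y in ?G. y \<in> {0..H} \<and> y \<noteq> s" by (simp add: eventually_at_filter)
    have "((\<lambda>y. 2 * E * \<bar>y - s\<bar>) \<longlongrightarrow> 2 * E * \<bar>s - s\<bar>) ?G" by (intro tendsto_intros)
    then have lim0: "((\<lambda>y. 2 * E * \<bar>y - s\<bar>) \<longlongrightarrow> 0) ?G" by simp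
    have "\<forall>\<^sub>F y in ?G. g (F s) (?V y) (?V y) \<le> 2 * E * \<bar>y - s\<bar>"
      using ev by eventually_elim (use est in blast)
    then show "g (F s) (v s) (v s) \<le> 0"
      by (rule tendsto_le[OF nontriv lim0 g_tendsto[OF tendsto_const sB sB V]])
    have "((\<lambda>y. a \<bullet> ?V y) \<longlongrightarrow> a \<bullet> v s) ?G" by (intro tendsto_intros V)
    moreover have "\<forall>\<^sub>F y in ?G. a \<bullet> ?V y = -1"
      using ev by eventually_elim (use est in blast)
    then have "((\<lambda>y. a \<bullet> ?V y) \<longlongrightarrow> -1) ?G" by (rule tendsto_eventually)
    ultimately show "a \<bullet> v s = -1" using tendsto_unique[OF nontriv] by blast
  qed
  \<comment> \<open>The parameter of \<open>F\<close> increases towards the past, so the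
    future-directed curve is \<open>F (H - u)\<close>.\<close>
  have "causal M (\<psi> c (F (H - 0))) (\<psi> c (F (H - H)))"
  proof (rule causal_in_ball[of 0 H "\<lambda>u. F (H - u)" "\<lambda>u. - v (H - u)"])
    show "continuous_on {0..H} (\<lambda>u. - v (H - u))"
      by (intro continuous_intros continuous_on_compose2[OF contv]) auto
    show "F (H - u) \<in> B" if "u \<in> {0..H}" for u using that FB by auto
    show "((\<lambda>u. F (H - u)) has_vector_derivative - v (H - u)) (at u within {0..H})" if u: "u \<in> {0..H}" for u
    proof -
      have 1: "((\<lambda>u. H - u) has_vector_derivative - 1) (at u within {0..H})"
        by (auto intro!: derivative_eq_intros)
      have 2: "(F has_vector_derivative v (H - u)) (at (H - u) within (\<lambda>u. H - u) ` {0..H})"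
        by (rule has_vector_derivative_within_subset[OF v]) (use u in auto)
      show ?thesis using vector_diff_chain_within[OF 1 2] by (simp add: o_def)
    qed
    show "g (F (H - u)) (- v (H - u)) (- v (H - u)) \<le> 0" if "u \<in> {0..H}" for u
      using v_causal(1)[of "H - u"] that FB[of "H - u"]
      by (simp add: bilinear_lneg bilinear_rneg g_bilinear)
    show "0 < a \<bullet> - v (H - u)" if "u \<in> {0..H}" for u
      using v_causal(2)[of "H - u"] that by simp
  qed (rule \<open>0 < H\<close>)
  then show ?thesis by simp
qed

text \<open>All constants survive on a smaller ball, which allows the radius to be adapted to a
  second point.\<close>

lemma shrink:
  assumes "0 < \<rho>'" "\<rho>' \<le> \<rho>"
  shows "lorentz_ball M r c x a T \<rho>' L k C m"
proof -
  have sub: "q \<in> B" if "q \<in> cball x0 \<rho>'" for q using that assms by auto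
  show ?thesis
    apply unfold_locales
    subgoal by (rule c)
    subgoal by (rule x)
    subgoal by (rule assms)
    subgoal using sub ball_subset by blast
    subgoal by (intro lipschitz sub)
    subgoal by (rule L)
    subgoal by (intro pos sub)
    subgoal by (rule k)
    subgoal by (intro causal_bound sub)
    subgoal by (rule C)
    subgoal by (intro future_iff sub)
    subgoal by (intro T sub)
    subgoal by (rule m)
    subgoal by (rule aT)
    done
qed

end

section \<open>The two characterizations\<close>

context spacetime_manifold
begin

lemma eq_if_I_plus_eq:
  assumes P: "\<And>p q. causal M p q \<Longrightarrow> p \<in> closure (J_plus M q) \<Longrightarrow> p = q"
    and xz: "I_plus M x = I_plus M z"
  shows "x = z"
proof (rule ccontr)
  assume "x \<noteq> z"
  obtain c a T \<rho>0 L k C m where "lorentz_ball M r c x a T \<rho>0 L k C m" by (rule ex_lorentz_ball)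
  then interpret big: lorentz_ball M r c x a T \<rho>0 L k C m .
  \<comment> \<open>At most the coordinate distance to \<open>z\<close>, so that \<open>z\<close> is
    outside the open ball and curves from \<open>z\<close> have to enter it. A \<open>z\<close>
    outside the chart domain imposes no restriction.\<close>
  define \<rho> where "\<rho> = (if z \<in> fst c then min \<rho>0 (dist (snd c x) (snd c z)) else \<rho>0)"
  have "snd c x \<noteq> snd c z" if "z \<in> fst c"
    using \<psi>_chart[OF big.c that] \<psi>_chart[OF big.c big.x] \<open>x \<noteq> z\<close> by metis
  then have "0 < \<rho>" "\<rho> \<le> \<rho>0" using big.\<rho> by (auto simp: \<rho>_def)
  then have "lorentz_ball M r c x a T \<rho> L k C m" by (rule big.shrink)
  then interpret lorentz_ball M r c x a T \<rho> L k C m .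
  have z: "z \<notin> chart_ball \<rho>" by (auto simp: chart_ball_def \<rho>_def)
  have cl: "x \<in> closure (I_plus M z)" using mem_closure_I_plus[of x] xz by simp
  obtain G F where lim: "\<And>s. s \<in> {0..\<rho> / (4 * C)} \<Longrightarrow> (\<lambda>n. \<psi> c (G n s)) \<longlonglongrightarrow> \<psi> c (F s)"
    and G: "\<And>n s. s \<in> {0..\<rho> / (4 * C)} \<Longrightarrow> chron M z (\<psi> c (G n s))"
      "\<And>n s s'. 0 \<le> s \<Longrightarrow> s < s' \<Longrightarrow> s' \<le> \<rho> / (4 * C) \<Longrightarrow> chron M (\<psi> c (G n s')) (\<psi> c (G n s))"
    and F: "F 0 = x0" "\<And>s. s \<in> {0..\<rho> / (4 * C)} \<Longrightarrow> F s \<in> B"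
      "\<And>s s'. 0 \<le> s \<Longrightarrow> s < s' \<Longrightarrow> s' \<le> \<rho> / (4 * C) \<Longrightarrow> a \<bullet> (F s - F s') = s' - s \<and>
       norm (F s - F s') \<le> C * (s' - s) \<and> g (F s) (F s - F s') (F s - F s') \<le> L * C ^ 3 * (s' - s) ^ 3"
    by (rule limit_curve[OF z cl]) blast
  \<comment> \<open>Half the duration of the limit curve, as \<open>achronal_curve_end\<close>
    consumes \<open>2 * H\<close> to produce a causal curve of duration \<open>H\<close>.\<close>
  define H where "H = \<rho> / (8 * C)"
  have H: "0 < H" "\<rho> / (4 * C) = 2 * H" using \<rho> C by (auto simp: H_def)
  note lim = lim[unfolded H(2)] and G = G[unfolded H(2)] and F = F[unfolded H(2)]
  have \<psi>F0: "\<psi> c (F 0) = x" using \<psi>_chart[OF c x] by (simp add: F)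
  have "\<not> chron M (\<psi> c (F s')) (\<psi> c (F s))" if s: "0 \<le> s" "s < s'" "s' \<le> 2 * H" for s s'
  proof (rule limits_not_chron[OF P xz])
    show "(\<lambda>n. \<psi> c (G n s')) \<longlonglongrightarrow> \<psi> c (F s')" "(\<lambda>n. \<psi> c (G n s)) \<longlonglongrightarrow> \<psi> c (F s)"
      using s by (auto intro: lim)
    show "(\<lambda>n. \<psi> c (G n 0)) \<longlonglongrightarrow> x" using lim[of 0] H \<psi>F0 by simp
    show "chron M z (\<psi> c (G n s'))" for n using s by (auto intro: G)
    show "\<psi> c (G n s) = \<psi> c (G n 0) \<or> chron M (\<psi> c (G n s)) (\<psi> c (G n 0))" for n
      using s G(2)[of 0 s n] by (cases "s = 0") auto
  qed
  then have "causal M (\<psi> c (F H)) (\<psi> c (F 0))"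
    using F(2,3) by (intro achronal_curve_end[OF H(1), of F])
  then have "causal M (\<psi> c (F H)) x" by (simp add: \<psi>F0)
  moreover have "\<psi> c (F H) \<in> closure (J_plus M x)"
  proof (rule Lim_in_closed_set[OF closed_closure _ trivial_limit_sequentially lim])
    have "\<psi> c (G n H) \<in> J_plus M x" for n
      using G(1)[of H n] H xz chron_imp_causal by (auto simp: I_plus_def J_plus_def set_eq_iff)
    then show "\<forall>\<^sub>F n in sequentially. \<psi> c (G n H) \<in> closure (J_plus M x)"
      using closure_subset by (intro always_eventually) blast
  qed (use H in simp)
  ultimately have "\<psi> c (F H) = x" by (rule P)
  then have "F H = x0" using chart_\<psi>[OF c B_image[OF F(2)[of H]]] H by simp
  \<comment> \<open>The heights of \<open>F 0\<close> and \<open>F H\<close> differ by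
    \<open>H\<close>, so the two points cannot coincide.\<close>
  then show False using F(3)[of 0 H] F(1) H by simp
qed

lemma future_distinguishing_iff:
  "future_distinguishing M \<longleftrightarrow> (\<forall>x z. (x, z) \<in> J_rel M \<and> x \<in> closure (J_plus M z) \<longrightarrow> x = z)"
proof
  assume "future_distinguishing M"
  then show "\<forall>x z. (x, z) \<in> J_rel M \<and> x \<in> closure (J_plus M z) \<longrightarrow> x = z"
    using I_plus_eq_of_causal_of_mem_closure by (auto simp: future_distinguishing_def J_rel_def)
next
  assume "\<forall>x z. (x, z) \<in> J_rel M \<and> x \<in> closure (J_plus M z) \<longrightarrow> x = z"
  then show "future_distinguishing M"
    using eq_if_I_plus_eq unfolding future_distinguishing_def J_rel_def by blast
qed

text \<open>Time reversal swaps the two points of the causal relation as well as future and past, so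
  the reversed criterion is the stated one with \<open>x\<close> and \<open>z\<close>
  exchanged.\<close>

lemma past_distinguishing_iff:
  "past_distinguishing M \<longleftrightarrow> (\<forall>x z. (x, z) \<in> J_rel M \<and> z \<in> closure (J_minus M x) \<longrightarrow> x = z)"
proof -
  have "past_distinguishing M \<longleftrightarrow> future_distinguishing (time_reverse M)"
    by (simp add: past_distinguishing_def future_distinguishing_def time_reverse_sets)
  also have "\<dots> \<longleftrightarrow> (\<forall>z x. (x, z) \<in> J_rel M \<and> z \<in> closure (J_minus M x) \<longrightarrow> z = x)"
    using spacetime_manifold.future_distinguishing_iff[OF reversed] by (simp add: time_reverse_sets)
  finally show ?thesis by blast
qed

end

theorem theorem3p1:
  fixes M :: "('a::{t2_space, second_countable_topology}, 'e::euclidean_space) lorentz_manifold"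
    and r :: enat
  assumes "spacetime r M"
  shows "(future_distinguishing M \<longleftrightarrow>
            (\<forall>x z. (x, z) \<in> J_rel M \<and> x \<in> closure (J_plus M z) \<longrightarrow> x = z)) \<and>
         (past_distinguishing M \<longleftrightarrow>
            (\<forall>x z. (x, z) \<in> J_rel M \<and> z \<in> closure (J_minus M x) \<longrightarrow> x = z))"
proof -
  interpret spacetime_manifold M r by unfold_locales (rule assms)
  show ?thesis using future_distinguishing_iff past_distinguishing_iff by blast
qed

end
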